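(* For every ergodic invertible measure-preserving transformation $T$ of an infinite standard probability space $(X,\mu)$, the reversing symmetry group $$\mathrm{Aut}^{\pm}(T):=\{S\in\mathrm{Aut}(X,\mu)\ :\ STS^{-1}=T^{\pm1}\}$$ is isomorphic to $\mathrm{Aut}(\Gamma)$ for some graphing $\Gamma$ that is local-global equivalent to the cyclic graphings $\mathbf C_a$, $a\in\mathbb R\setminus\mathbb Q$. In particular, there are graphings $\Gamma$ for which $\mathrm{Aut}(\Gamma)$ carries no Hausdorff compact topology making it a topological group.
   Context: Standard probability space: a complete probability space isomorphic (mod null sets) to an interval with Lebesgue measure together with at most countably many point masses. It is infinite if it does not reduce, modulo null sets, to finitely many atoms. $\mathrm{Aut}(X,\mu)$ is the group of invertible measure-preserving transformations of $(X,\mu)$, identified when they agree almost everywhere. Graphing: a tuple $\Gamma=(V,\mathcal B,E,\mu)$ where $(V,\mathcal B,\mu)$ is a standard probability space and $E\subseteq V\times V$ is a Borel symmetric edge set making $(V,E)$ a loopless graph of bounded degree, such that for all $A,B\in\mathcal B$, $\int_A \sharp(x\to B)\,d\mu(x)=\int_B\sharp(y\to A)\,d\mu(y)$, where $\sharp(x\to B)$ is the number of edges from $x$ to points of $B$. The edge measure $\eta_\Gamma$ on $V\times V$ is determined by $\eta_\Gamma(A\times B)=\int_A\sharp(x\to B)\,d\mu(x)$. Automorphism of a graphing $\Gamma$: an automorphism of the measure algebra of $(\mathcal B,\mu)$ (equivalently, a $\mu$-preserving automorphism $\varphi$ of $V$, modulo null sets) with $(\varphi\times\varphi)_*\eta_\Gamma=\eta_\Gamma$.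 These form the group $\mathrm{Aut}(\Gamma)$. Isomorphism of groups means as abstract groups. Cyclic graphing $\mathbf C_a$: the graphing on $\mathbb R/\mathbb Z$ with Lebesgue measure in which $z_1,z_2$ are joined by an edge precisely when $z_1-z_2\equiv\pm a \pmod{\mathbb Z}$. Local-global equivalence: for a graphing $\Gamma$ and integers $r\ge 0$, $m\ge 1$, every measurable coloring $f:V\to\{1,\dots,m\}$ gives a probability distribution on the (finite) set of isomorphism classes of rooted $m$-colored graphs of radius $\le r$ with the relevant degree bound, namely the law of the colored $r$-neighborhood of a $\mu$-random vertex, rooted at that vertex. Let $Q_{\Gamma,r,m}$ be the set of all distributions so obtained as $f$ varies. Two graphings $\Gamma_1,\Gamma_2$ are local-global equivalent if $Q_{\Gamma_1,r,m}$ and $Q_{\Gamma_2,r,m}$ have the same closure for all $r,m$. *)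

theory Defs
  imports "HOL-Probability.Probability_Measure" "HOL-Algebra.Group"
begin

section \<open>Standard probability spaces and their automorphisms\<close>

text \<open>Isomorphism modulo null sets: measure-preserving maps in both directions that are inverse
  to each other almost everywhere.\<close>

definition iso_mod_null :: "'a measure \<Rightarrow> 'b measure \<Rightarrow> ('a \<Rightarrow> 'b) \<Rightarrow> bool" where
  "iso_mod_null M N f \<longleftrightarrow>
     f \<in> measurable M N \<and> distr M N f = N \<and>
     (\<exists>g. g \<in> measurable N M \<and> distr N M g = M \<and>
          (AE x in M. g (f x) = x) \<and> (AE y in N. f (g y) = y))"

text \<open>The interval \<open>[0, c]\<close> with Lebesgue measure, together with point masses \<open>p 0, p 1, \<dots>\<close>
  placed outside the interval at \<open>-1, -2, \<dots>\<close>; unused atoms get \<open>p n = 0\<close>, and the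
  complement of the interval and the atoms is a null set.\<close>

definition interval_with_atoms :: "real \<Rightarrow> (nat \<Rightarrow> real) \<Rightarrow> real measure" where
  "interval_with_atoms c p =
     measure_of UNIV (sets lebesgue)
       (\<lambda>A. emeasure lebesgue (A \<inter> {0..c}) + (\<Sum>n. ennreal (p n) * indicator A (- real (Suc n))))"

definition standard_probability_space :: "'a measure \<Rightarrow> bool" where
  "standard_probability_space M \<longleftrightarrow>
     prob_space M \<and> complete_measure M \<and>
     (\<exists>c p f. 0 \<le> c \<and> (\<forall>n. 0 \<le> p n) \<and> iso_mod_null M (interval_with_atoms c p) f)"

definition finitely_many_atoms :: "'a measure \<Rightarrow> bool" where
  "finitely_many_atoms M \<longleftrightarrow> (\<exists>F. finite F \<and> F \<subseteq> space M \<and> (AE x in M. x \<in> F))"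

definition invertible_mpt :: "'a measure \<Rightarrow> ('a \<Rightarrow> 'a) set" where
  "invertible_mpt M = {T. iso_mod_null M M T}"

definition ergodic :: "'a measure \<Rightarrow> ('a \<Rightarrow> 'a) \<Rightarrow> bool" where
  "ergodic M T \<longleftrightarrow>
     (\<forall>A\<in>sets M. T -` A \<inter> space M = A \<longrightarrow> measure M A = 0 \<or> measure M A = 1)"

definition ae_class :: "'a measure \<Rightarrow> ('a \<Rightarrow> 'a) \<Rightarrow> ('a \<Rightarrow> 'a) set" where
  "ae_class M T = {S \<in> invertible_mpt M. AE x in M. S x = T x}"

definition Aut_space :: "'a measure \<Rightarrow> ('a \<Rightarrow> 'a) set monoid" where
  "Aut_space M =
     \<lparr>carrier = ae_class M ` invertible_mpt M,
      mult = (\<lambda>A B. {R \<in> invertible_mpt M. \<exists>S\<in>A. \<exists>S'\<in>B. AE x in M. R x = S (S' x)}),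
      one = ae_class M id\<rparr>"

definition reversing_symmetry_group :: "'a measure \<Rightarrow> ('a \<Rightarrow> 'a) \<Rightarrow> ('a \<Rightarrow> 'a) set monoid" where
  "reversing_symmetry_group M T =
     (let G = Aut_space M; t = ae_class M T in
      G\<lparr>carrier := {s \<in> carrier G.
           s \<otimes>\<^bsub>G\<^esub> t \<otimes>\<^bsub>G\<^esub> inv\<^bsub>G\<^esub> s = t \<or> s \<otimes>\<^bsub>G\<^esub> t \<otimes>\<^bsub>G\<^esub> inv\<^bsub>G\<^esub> s = inv\<^bsub>G\<^esub> t}\<rparr>)"


section \<open>Graphings\<close>

definition standard_borel :: "'a measure \<Rightarrow> bool" where
  "standard_borel N \<longleftrightarrow>
     (\<exists>\<tau>. topspace \<tau> = space N \<and> second_countable \<tau> \<and> completely_metrizable_space \<tau> \<and>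
          sets N = sigma_sets (space N) {U. openin \<tau> U})"

text \<open>The underlying data is a Borel measure \<open>vborel\<close> on the vertex set, which gives a meaning to
  ``Borel edge set''. The complete probability space \<open>(V, \<B>, \<mu>)\<close> of a graphing is the
  completion \<open>vspace\<close>; its measurable sets are what vertex sets, colorings and automorphisms
  refer to. An undirected edge \<open>xy\<close> is represented by both pairs \<open>(x, y)\<close> and \<open>(y, x)\<close>.\<close>

record 'v graphing_data =
  vborel :: "'v measure"
  edges :: "('v \<times> 'v) set"

definition vspace :: "'v graphing_data \<Rightarrow> 'v measure" where
  "vspace \<Gamma> = completion (vborel \<Gamma>)"

definition edges_to :: "'v graphing_data \<Rightarrow> 'v \<Rightarrow> 'v set \<Rightarrow> nat" where
  "edges_to \<Gamma> x B = card {y \<in> B. (x, y) \<in> edges \<Gamma>}"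

definition graphing :: "'v graphing_data \<Rightarrow> bool" where
  "graphing \<Gamma> \<longleftrightarrow>
     standard_borel (vborel \<Gamma>) \<and>
     standard_probability_space (vspace \<Gamma>) \<and>
     edges \<Gamma> \<in> sets (vborel \<Gamma> \<Otimes>\<^sub>M vborel \<Gamma>) \<and>
     sym (edges \<Gamma>) \<and> irrefl (edges \<Gamma>) \<and>
     (\<exists>D. \<forall>x\<in>space (vspace \<Gamma>). finite {y. (x, y) \<in> edges \<Gamma>} \<and> card {y. (x, y) \<in> edges \<Gamma>} \<le> D) \<and>
     (\<forall>A\<in>sets (vspace \<Gamma>). \<forall>B\<in>sets (vspace \<Gamma>).
        (\<integral>\<^sup>+x\<in>A. of_nat (edges_to \<Gamma> x B) \<partial>vspace \<Gamma>) =
        (\<integral>\<^sup>+y\<in>B. of_nat (edges_to \<Gamma> y A) \<partial>vspace \<Gamma>))"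

definition edge_measure :: "'v graphing_data \<Rightarrow> ('v \<times> 'v) measure" where
  "edge_measure \<Gamma> =
     (THE \<eta>. sets \<eta> = sets (vspace \<Gamma> \<Otimes>\<^sub>M vspace \<Gamma>) \<and>
        (\<forall>A\<in>sets (vspace \<Gamma>). \<forall>B\<in>sets (vspace \<Gamma>).
           emeasure \<eta> (A \<times> B) = (\<integral>\<^sup>+x\<in>A. of_nat (edges_to \<Gamma> x B) \<partial>vspace \<Gamma>)))"

text \<open>The marginals of the edge measure are absolutely continuous, so the condition below
  does not depend on the representative of the class.\<close>

definition Aut_graphing :: "'v graphing_data \<Rightarrow> ('v \<Rightarrow> 'v) set monoid" where
  "Aut_graphing \<Gamma> =
     (Aut_space (vspace \<Gamma>))\<lparr>carrier :=
        {c \<in> carrier (Aut_space (vspace \<Gamma>)). \<forall>\<phi>\<in>c.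
           distr (edge_measure \<Gamma>) (vspace \<Gamma> \<Otimes>\<^sub>M vspace \<Gamma>) (map_prod \<phi> \<phi>) = edge_measure \<Gamma>}\<rparr>"

text \<open>The circle \<open>\<real>/\<int>\<close> is represented by the fundamental domain \<open>[0, 1)\<close>.\<close>

definition cyclic_graphing :: "real \<Rightarrow> real graphing_data" where
  "cyclic_graphing a =
     \<lparr>vborel = restrict_space lborel {0..<1},
      edges = {(x, y). x \<in> {0..<1} \<and> y \<in> {0..<1} \<and> (x - y - a \<in> \<int> \<or> x - y + a \<in> \<int>)}\<rparr>"


section \<open>Local-global equivalence\<close>

text \<open>The values of the coloring outside the vertex set are irrelevant.\<close>

record 'v rooted_colored_graph =
  rverts :: "'v set"
  redges :: "('v \<times> 'v) set"
  rroot :: "'v"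
  rcolor :: "'v \<Rightarrow> nat"

definition rooted_colored_iso ::
    "'v rooted_colored_graph \<Rightarrow> 'w rooted_colored_graph \<Rightarrow> bool" where
  "rooted_colored_iso G H \<longleftrightarrow>
     (\<exists>h. bij_betw h (rverts G) (rverts H) \<and> h (rroot G) = rroot H \<and>
        (\<forall>x\<in>rverts G. \<forall>y\<in>rverts G. (x, y) \<in> redges G \<longleftrightarrow> (h x, h y) \<in> redges H) \<and>
        (\<forall>x\<in>rverts G. rcolor H (h x) = rcolor G x))"

definition nbhd ::
    "'v graphing_data \<Rightarrow> nat \<Rightarrow> ('v \<Rightarrow> nat) \<Rightarrow> 'v \<Rightarrow> 'v rooted_colored_graph" where
  "nbhd \<Gamma> r f x =
     (let W = {y. \<exists>k\<le>r. (x, y) \<in> edges \<Gamma> ^^ k} in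
      \<lparr>rverts = W, redges = edges \<Gamma> \<inter> W \<times> W, rroot = x, rcolor = f\<rparr>)"

text \<open>Isomorphism classes of finite rooted colored graphs are represented by their members with
  vertices in \<open>nat\<close>.\<close>

definition nbhd_class ::
    "'v graphing_data \<Rightarrow> nat \<Rightarrow> ('v \<Rightarrow> nat) \<Rightarrow> 'v \<Rightarrow> nat rooted_colored_graph set" where
  "nbhd_class \<Gamma> r f x =
     {H. redges H \<subseteq> rverts H \<times> rverts H \<and> rooted_colored_iso (nbhd \<Gamma> r f x) H}"

text \<open>A distribution on isomorphism classes is given by its mass function.\<close>

definition nbhd_law ::
    "'v graphing_data \<Rightarrow> nat \<Rightarrow> ('v \<Rightarrow> nat) \<Rightarrow> nat rooted_colored_graph set \<Rightarrow> real" where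
  "nbhd_law \<Gamma> r f C = measure (vspace \<Gamma>) {x \<in> space (vspace \<Gamma>). nbhd_class \<Gamma> r f x = C}"

definition local_laws ::
    "'v graphing_data \<Rightarrow> nat \<Rightarrow> nat \<Rightarrow> (nat rooted_colored_graph set \<Rightarrow> real) set" where
  "local_laws \<Gamma> r m = nbhd_law \<Gamma> r ` measurable (vspace \<Gamma>) (count_space {1..m})"

text \<open>The closure is taken in the product topology on functions. For fixed \<open>r\<close>, \<open>m\<close> and degree
  bound all laws vanish outside a fixed finite set of classes, so this is the
  usual closure in a finite-dimensional simplex.\<close>

definition local_global_equivalent :: "'v graphing_data \<Rightarrow> 'w graphing_data \<Rightarrow> bool" where
  "local_global_equivalent \<Gamma>\<^sub>1 \<Gamma>\<^sub>2 \<longleftrightarrow>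
     (\<forall>r. \<forall>m\<ge>1. closure (local_laws \<Gamma>\<^sub>1 r m) = closure (local_laws \<Gamma>\<^sub>2 r m))"


section \<open>Topological groups\<close>

definition group_topology :: "('g, 'm) monoid_scheme \<Rightarrow> 'g topology \<Rightarrow> bool" where
  "group_topology G \<tau> \<longleftrightarrow>
     topspace \<tau> = carrier G \<and>
     continuous_map (prod_topology \<tau> \<tau>) \<tau> (\<lambda>(x, y). x \<otimes>\<^bsub>G\<^esub> y) \<and>
     continuous_map \<tau> \<tau> (\<lambda>x. inv\<^bsub>G\<^esub> x)"

end

theory Submission
  imports Defs "HOL-Probability.Distribution_Functions" "HOL-Analysis.Kronecker_Approximation_Theorem"
begin

text \<open>
  An ergodic transformation of a space with an atom lives on finitely many points. Hence \<open>X\<close> has no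
  atoms and may be taken to be the unit interval (\<open>ergodic_iso_unit_interval\<close>), and \<open>T\<close> may be
  taken to be a Borel bijection (\<open>borel_automorphism_exists\<close>). The graphing \<open>\<Gamma>\<close> joins every point
  \<open>x\<close> to \<open>T x\<close> and \<open>T\<inverse> x\<close>. Almost all of its components are two-way infinite paths.

  A measure preserving map \<open>\<phi>\<close> preserves the edge measure iff the conjugate \<open>P = \<phi> T \<phi>\<inverse>\<close> and its inverse
  send almost every \<open>x\<close> to the two neighbors of \<open>x\<close>, in some order. The set of points with \<open>P x = T x\<close>
  is then invariant, and by ergodicity \<open>P = T\<close> or \<open>P = T\<inverse>\<close> (\<open>preserves_edge_measure_iff\<close>). So the
  automorphisms of \<open>\<Gamma>\<close> are the reversing symmetries of \<open>T\<close>.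

  A neighborhood of radius \<open>r\<close> in a colored path is a word of \<open>2 r + 1\<close> colors, up to reversal. To copy the
  word frequencies of a coloring of one system to another one, cover almost all of the
  second system by long orbit segments of a fixed length, which is what the Rokhlin lemma provides
  (\<open>rokhlin_tower\<close>), and color each of them like a random orbit segment of the first system
  (\<open>coloring_transfer\<close>). The frequencies are then right except near the ends of the segments. The Rokhlin
  lemma is derived from the existence of arbitrarily small sets that meet almost every orbit. Ergodicity
  yields such sets for \<open>T\<close>, and the density of its orbits yields them for an irrational rotation,
  whose graphing is the cyclic one; so the copying works in both directions.

  For the last claim the graphing without edges is enough. Its automorphism group consists of all
  measure preserving automorphisms of the unit interval. In a compact Hausdorff group a system of equations with
  solvable finite parts is solvable (\<open>compact_group_solves_system\<close>). The system
  \<open>x \<sigma>\<^sub>i = \<sigma>\<^sub>i\<^sub>+\<^sub>1 x\<close>, where \<open>\<sigma>\<^sub>i\<close> flips the \<open>i\<close>-th binary digit, has solvable finite parts and no solution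
  (\<open>Aut_space_unit_lebesgue_no_compact_topology\<close>).
\<close>



section \<open>The automorphism group of a measure space\<close>

lemma AE_measure_preserving:
  assumes "f \<in> measurable M N" "distr M N f = N" "AE y in N. P y"
  shows "AE x in M. P (f x)"
proof -
  have "AE y in distr M N f. P y" unfolding assms(2) by (rule assms(3))
  then show ?thesis by (rule AE_distrD[OF assms(1)])
qed

lemma iso_mod_nullE:
  assumes "iso_mod_null M N f"
  obtains g where "f \<in> measurable M N" "distr M N f = N" "g \<in> measurable N M" "distr N M g = M"
    "AE x in M. g (f x) = x" "AE y in N. f (g y) = y" "iso_mod_null N M g"
  using assms unfolding iso_mod_null_def by blast

lemma iso_mod_nullI:
  assumes "f \<in> measurable M N" "distr M N f = N" "g \<in> measurable N M" "distr N M g = M"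
    "AE x in M. g (f x) = x" "AE y in N. f (g y) = y"
  shows "iso_mod_null M N f"
  using assms unfolding iso_mod_null_def by blast

lemma iso_mod_null_comp:
  assumes "iso_mod_null M N f" "iso_mod_null N K f'"
  shows "iso_mod_null M K (f' \<circ> f)"
proof -
  obtain g where g: "f \<in> measurable M N" "distr M N f = N" "g \<in> measurable N M" "distr N M g = M"
    "AE x in M. g (f x) = x" "AE y in N. f (g y) = y"
    using assms(1) by (rule iso_mod_nullE)
  obtain g' where g': "f' \<in> measurable N K" "distr N K f' = K" "g' \<in> measurable K N" "distr K N g' = N"
    "AE x in N. g' (f' x) = x" "AE y in K. f' (g' y) = y"
    using assms(2) by (rule iso_mod_nullE)
  show ?thesis
  proof (rule iso_mod_nullI)
    show "f' \<circ> f \<in> measurable M K" "g \<circ> g' \<in> measurable K M"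
      using g g' by (auto intro: measurable_comp)
    show "distr M K (f' \<circ> f) = K" "distr K M (g \<circ> g') = M"
      using distr_distr[OF g'(1) g(1)] distr_distr[OF g(3) g'(3)] g g' by auto
    have "AE x in M. g' (f' (f x)) = f x" by (rule AE_measure_preserving[OF g(1,2) g'(5)])
    then show "AE x in M. (g \<circ> g') ((f' \<circ> f) x) = x" using g(5) by eventually_elim simp
    have "AE x in K. f (g (g' x)) = g' x" by (rule AE_measure_preserving[OF g'(3,4) g(6)])
    then show "AE x in K. (f' \<circ> f) ((g \<circ> g') x) = x" using g'(6) by eventually_elim simp
  qed
qed

lemma iso_mod_null_id: "iso_mod_null M M id"
  by (rule iso_mod_nullI[where g = id]) (auto simp: id_def distr_id2)

lemma invertible_mptD:
  assumes "S \<in> invertible_mpt M"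
  shows "S \<in> measurable M M" "distr M M S = M"
  using assms unfolding invertible_mpt_def iso_mod_null_def by auto

lemma invertible_mpt_comp:
  "S \<in> invertible_mpt M \<Longrightarrow> S' \<in> invertible_mpt M \<Longrightarrow> S \<circ> S' \<in> invertible_mpt M"
  unfolding invertible_mpt_def using iso_mod_null_comp by blast

lemma id_invertible_mpt: "id \<in> invertible_mpt M"
  unfolding invertible_mpt_def using iso_mod_null_id by blast

lemma invertible_mptE:
  assumes "S \<in> invertible_mpt M"
  obtains S' where "S' \<in> invertible_mpt M" "AE x in M. S' (S x) = x" "AE x in M. S (S' x) = x"
  using assms unfolding invertible_mpt_def by (auto elim: iso_mod_nullE)

lemma AE_invertible:
  assumes "S \<in> invertible_mpt M" "AE x in M. P x"
  shows "AE x in M. P (S x)"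
  using AE_measure_preserving[OF invertible_mptD[OF assms(1)] assms(2)] .

lemma ae_class_eq_iff:
  assumes "S \<in> invertible_mpt M" "S' \<in> invertible_mpt M"
  shows "ae_class M S = ae_class M S' \<longleftrightarrow> (AE x in M. S x = S' x)"
proof
  assume "ae_class M S = ae_class M S'"
  moreover have "S \<in> ae_class M S" using assms unfolding ae_class_def by auto
  ultimately show "AE x in M. S x = S' x" unfolding ae_class_def by auto
next
  assume *: "AE x in M. S x = S' x"
  have "(AE x in M. R x = S x) \<longleftrightarrow> (AE x in M. R x = S' x)" for R
  proof
    assume "AE x in M. R x = S x"
    then show "AE x in M. R x = S' x" using * by eventually_elim simp
  next
    assume "AE x in M. R x = S' x"
    then show "AE x in M. R x = S x" using * by eventually_elim simp
  qed
  then show "ae_class M S = ae_class M S'" unfolding ae_class_def by auto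
qed

lemma carrier_Aut_space: "carrier (Aut_space M) = ae_class M ` invertible_mpt M"
  unfolding Aut_space_def by simp

lemma ae_class_in_carrier: "S \<in> invertible_mpt M \<Longrightarrow> ae_class M S \<in> carrier (Aut_space M)"
  unfolding carrier_Aut_space by auto

lemma one_Aut_space: "\<one>\<^bsub>Aut_space M\<^esub> = ae_class M id"
  unfolding Aut_space_def by simp

lemma mult_ae_class:
  assumes S: "S \<in> invertible_mpt M" and S': "S' \<in> invertible_mpt M"
  shows "ae_class M S \<otimes>\<^bsub>Aut_space M\<^esub> ae_class M S' = ae_class M (S \<circ> S')"
proof -
  have "(\<exists>s\<in>ae_class M S. \<exists>s'\<in>ae_class M S'. AE x in M. R x = s (s' x)) \<longleftrightarrow>
        (AE x in M. R x = S (S' x))" for R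
  proof (intro iffI; (elim bexE)?)
    fix s s' assume s: "s \<in> ae_class M S" "s' \<in> ae_class M S'" and R: "AE x in M. R x = s (s' x)"
    have "AE x in M. s (s' x) = S (s' x)"
      using s by (intro AE_invertible[of s' M "\<lambda>x. s x = S x"]) (auto simp: ae_class_def)
    moreover have "AE x in M. s' x = S' x" using s by (auto simp: ae_class_def)
    ultimately show "AE x in M. R x = S (S' x)" using R by eventually_elim simp
  next
    assume "AE x in M. R x = S (S' x)"
    then show "\<exists>s\<in>ae_class M S. \<exists>s'\<in>ae_class M S'. AE x in M. R x = s (s' x)"
      using S S' by (intro bexI[of _ S] bexI[of _ S']) (auto simp: ae_class_def)
  qed
  then show ?thesis unfolding Aut_space_def by (auto simp: ae_class_def)
qed

lemma group_Aut_space: "group (Aut_space M)"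
proof (rule groupI)
  show "\<one>\<^bsub>Aut_space M\<^esub> \<in> carrier (Aut_space M)"
    unfolding one_Aut_space by (intro ae_class_in_carrier id_invertible_mpt)
next
  fix x y assume "x \<in> carrier (Aut_space M)" "y \<in> carrier (Aut_space M)"
  then show "x \<otimes>\<^bsub>Aut_space M\<^esub> y \<in> carrier (Aut_space M)"
    unfolding carrier_Aut_space by (auto simp: mult_ae_class intro: invertible_mpt_comp)
next
  fix x y z assume "x \<in> carrier (Aut_space M)" "y \<in> carrier (Aut_space M)" "z \<in> carrier (Aut_space M)"
  then show "x \<otimes>\<^bsub>Aut_space M\<^esub> y \<otimes>\<^bsub>Aut_space M\<^esub> z = x \<otimes>\<^bsub>Aut_space M\<^esub> (y \<otimes>\<^bsub>Aut_space M\<^esub> z)"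
    unfolding carrier_Aut_space by (auto simp: mult_ae_class invertible_mpt_comp o_assoc)
next
  fix x assume "x \<in> carrier (Aut_space M)"
  then obtain S where S: "S \<in> invertible_mpt M" "x = ae_class M S" unfolding carrier_Aut_space by auto
  show "\<one>\<^bsub>Aut_space M\<^esub> \<otimes>\<^bsub>Aut_space M\<^esub> x = x"
    unfolding one_Aut_space S(2) by (simp add: mult_ae_class S id_invertible_mpt)
  obtain S' where S': "S' \<in> invertible_mpt M" "AE x in M. S' (S x) = x"
    using invertible_mptE[OF S(1)] by auto
  have "ae_class M S' \<otimes>\<^bsub>Aut_space M\<^esub> ae_class M S = ae_class M id"
    using S S' by (simp add: mult_ae_class ae_class_eq_iff invertible_mpt_comp id_invertible_mpt)
  then show "\<exists>y\<in>carrier (Aut_space M). y \<otimes>\<^bsub>Aut_space M\<^esub> x = \<one>\<^bsub>Aut_space M\<^esub>"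
    using S S' ae_class_in_carrier[OF S'(1)] unfolding one_Aut_space by auto
qed

lemma inv_ae_class:
  assumes S: "S \<in> invertible_mpt M" and S': "S' \<in> invertible_mpt M" and "AE x in M. S' (S x) = x"
  shows "inv\<^bsub>Aut_space M\<^esub> (ae_class M S) = ae_class M S'"
proof -
  have "ae_class M S' \<otimes>\<^bsub>Aut_space M\<^esub> ae_class M S = \<one>\<^bsub>Aut_space M\<^esub>"
    using assms by (simp add: mult_ae_class one_Aut_space ae_class_eq_iff invertible_mpt_comp id_invertible_mpt)
  then show ?thesis
    using group.inv_equality[OF group_Aut_space] S S' ae_class_in_carrier by blast
qed

text \<open>Multiplying by \<open>s\<close> on the right turns \<open>s t s\<inverse> = t\<close> and \<open>s t s\<inverse> = t\<inverse>\<close> into commutation relations, which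
  can be read off almost everywhere from representatives.\<close>

lemma reversing_symmetry_group_eq:
  assumes T: "T \<in> invertible_mpt M" and T': "T' \<in> invertible_mpt M" and "AE x in M. T' (T x) = x"
  shows "reversing_symmetry_group M T = (Aut_space M)\<lparr>carrier := ae_class M `
    {R \<in> invertible_mpt M. (AE x in M. R (T x) = T (R x)) \<or> (AE x in M. R (T x) = T' (R x))}\<rparr>"
proof -
  interpret G: group "Aut_space M" by (rule group_Aut_space)
  have tc: "ae_class M T \<in> carrier (Aut_space M)" "ae_class M T' \<in> carrier (Aut_space M)"
    using T T' by (auto intro: ae_class_in_carrier)
  have conj_iff: "s \<otimes>\<^bsub>Aut_space M\<^esub> t \<otimes>\<^bsub>Aut_space M\<^esub> inv\<^bsub>Aut_space M\<^esub> s = u \<longleftrightarrow>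
      s \<otimes>\<^bsub>Aut_space M\<^esub> t = u \<otimes>\<^bsub>Aut_space M\<^esub> s"
    if "s \<in> carrier (Aut_space M)" "t \<in> carrier (Aut_space M)" "u \<in> carrier (Aut_space M)" for s t u
    using that by (metis G.inv_solve_right G.m_closed G.inv_closed)
  have "{s \<in> carrier (Aut_space M).
           s \<otimes>\<^bsub>Aut_space M\<^esub> ae_class M T \<otimes>\<^bsub>Aut_space M\<^esub> inv\<^bsub>Aut_space M\<^esub> s = ae_class M T \<or>
           s \<otimes>\<^bsub>Aut_space M\<^esub> ae_class M T \<otimes>\<^bsub>Aut_space M\<^esub> inv\<^bsub>Aut_space M\<^esub> s = inv\<^bsub>Aut_space M\<^esub> (ae_class M T)} =
        {s \<in> carrier (Aut_space M).
           s \<otimes>\<^bsub>Aut_space M\<^esub> ae_class M T = ae_class M T \<otimes>\<^bsub>Aut_space M\<^esub> s \<or>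
           s \<otimes>\<^bsub>Aut_space M\<^esub> ae_class M T = ae_class M T' \<otimes>\<^bsub>Aut_space M\<^esub> s}"
    using conj_iff tc by (auto simp: inv_ae_class[OF assms])
  also have "\<dots> = ae_class M ` {R \<in> invertible_mpt M.
      (AE x in M. R (T x) = T (R x)) \<or> (AE x in M. R (T x) = T' (R x))}"
  proof -
    have "ae_class M R \<otimes>\<^bsub>Aut_space M\<^esub> ae_class M T = ae_class M U \<otimes>\<^bsub>Aut_space M\<^esub> ae_class M R \<longleftrightarrow>
        (AE x in M. R (T x) = U (R x))" if "R \<in> invertible_mpt M" "U \<in> invertible_mpt M" for R U
      using that T by (simp add: mult_ae_class ae_class_eq_iff invertible_mpt_comp)
    then show ?thesis unfolding carrier_Aut_space using T T' by blast
  qed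
  finally show ?thesis unfolding reversing_symmetry_group_def Let_def by simp
qed

text \<open>An isomorphism modulo null sets conjugates one automorphism group onto the other, and with
  it the reversing symmetries of a transformation onto those of the conjugate transformation.\<close>

lemma reversing_symmetry_group_conjugate:
  assumes f: "iso_mod_null M N f" and g: "iso_mod_null N M g"
    and gf: "AE x in M. g (f x) = x" and fg: "AE y in N. f (g y) = y"
    and T: "T \<in> invertible_mpt M"
  shows "f \<circ> T \<circ> g \<in> invertible_mpt N"
    and "reversing_symmetry_group M T \<cong> reversing_symmetry_group N (f \<circ> T \<circ> g)"
proof -
  have conj_inv: "f \<circ> R \<circ> g \<in> invertible_mpt N" if "R \<in> invertible_mpt M" for R
    using that iso_mod_null_comp[OF g iso_mod_null_comp[OF _ f]]
    unfolding invertible_mpt_def by blast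
  have conj_inv': "g \<circ> R \<circ> f \<in> invertible_mpt M" if "R \<in> invertible_mpt N" for R
    using that iso_mod_null_comp[OF f iso_mod_null_comp[OF _ g]]
    unfolding invertible_mpt_def by blast
  show "f \<circ> T \<circ> g \<in> invertible_mpt N" using T by (rule conj_inv)
  have pull_f: "AE x in M. P (f x)" if "AE y in N. P y" for P
    using AE_measure_preserving[OF _ _ that] f unfolding iso_mod_null_def by blast
  have pull_g: "AE x in N. P (g x)" if "AE y in M. P y" for P
    using AE_measure_preserving[OF _ _ that] g unfolding iso_mod_null_def by blast
  have transfer: "(AE x in M. A x = B x) \<longleftrightarrow> (AE y in N. f (A (g y)) = f (B (g y)))"
    if AB: "A \<in> invertible_mpt M" "B \<in> invertible_mpt M" for A B
  proof
    assume "AE x in M. A x = B x"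
    from pull_g[OF this] show "AE y in N. f (A (g y)) = f (B (g y))" by eventually_elim simp
  next
    assume "AE y in N. f (A (g y)) = f (B (g y))"
    from pull_f[OF this] have "AE x in M. f (A x) = f (B x)"
      using gf by eventually_elim simp
    then show "AE x in M. A x = B x"
      using AE_invertible[OF AB(1) gf] AE_invertible[OF AB(2) gf] by eventually_elim metis
  qed
  have comp: "AE y in N. f (A (g (f (B (g y))))) = f (A (B (g y)))" if "B \<in> invertible_mpt M" for A B
    using pull_g[OF AE_invertible[OF that gf]] by eventually_elim simp
  \<comment> \<open>the class of \<open>R\<close> goes to the class of \<open>f R g\<close>, whichever representative is chosen\<close>
  define H where "H c = ae_class N (f \<circ> (SOME R. R \<in> invertible_mpt M \<and> c = ae_class M R) \<circ> g)" for c
  have H: "H (ae_class M R) = ae_class N (f \<circ> R \<circ> g)" if R: "R \<in> invertible_mpt M" for R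
  proof -
    define R' where "R' = (SOME R'. R' \<in> invertible_mpt M \<and> ae_class M R = ae_class M R')"
    have "R' \<in> invertible_mpt M \<and> ae_class M R = ae_class M R'"
      unfolding R'_def by (rule someI[of _ R]) (use R in auto)
    then have "R' \<in> invertible_mpt M" "AE x in M. R' x = R x"
      using R by (auto simp: ae_class_eq_iff elim: AE_mp)
    then show ?thesis unfolding H_def R'_def[symmetric]
      using R transfer[of R' R] by (simp add: ae_class_eq_iff conj_inv)
  qed
  have H_iff: "H (ae_class M R) = H (ae_class M R') \<longleftrightarrow> ae_class M R = ae_class M R'"
    if "R \<in> invertible_mpt M" "R' \<in> invertible_mpt M" for R R'
    using that transfer[of R R'] by (simp add: H ae_class_eq_iff conj_inv)
  have H_mult: "H (ae_class M R \<otimes>\<^bsub>Aut_space M\<^esub> ae_class M R') =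
      H (ae_class M R) \<otimes>\<^bsub>Aut_space N\<^esub> H (ae_class M R')"
    if "R \<in> invertible_mpt M" "R' \<in> invertible_mpt M" for R R'
  proof -
    have "AE y in N. f (R (R' (g y))) = f (R (g (f (R' (g y)))))"
      using comp[OF that(2), of R] by eventually_elim simp
    then show ?thesis using that
      by (simp add: mult_ae_class H conj_inv invertible_mpt_comp ae_class_eq_iff)
  qed
  obtain T' where T': "T' \<in> invertible_mpt M" "AE x in M. T' (T x) = x"
    using invertible_mptE[OF T] by auto
  have T'N: "AE y in N. (f \<circ> T' \<circ> g) ((f \<circ> T \<circ> g) y) = y"
    using comp[OF T, of T'] pull_g[OF T'(2)] fg by eventually_elim simp
  let ?K = "{R \<in> invertible_mpt M. (AE x in M. R (T x) = T (R x)) \<or> (AE x in M. R (T x) = T' (R x))}"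
  let ?K' = "{R \<in> invertible_mpt N. (AE x in N. R ((f \<circ> T \<circ> g) x) = (f \<circ> T \<circ> g) (R x)) \<or>
     (AE x in N. R ((f \<circ> T \<circ> g) x) = (f \<circ> T' \<circ> g) (R x))}"
  have rel: "(AE x in M. R (T x) = U (R x)) \<longleftrightarrow>
      (AE x in N. (f \<circ> R \<circ> g) ((f \<circ> T \<circ> g) x) = (f \<circ> U \<circ> g) ((f \<circ> R \<circ> g) x))"
    if R: "R \<in> invertible_mpt M" and U: "U \<in> invertible_mpt M" for R U
  proof -
    have "(AE x in M. R (T x) = U (R x)) \<longleftrightarrow> (AE y in N. f (R (T (g y))) = f (U (R (g y))))"
      using transfer[of "R \<circ> T" "U \<circ> R"] R U T by (simp add: invertible_mpt_comp)
    also have "\<dots> \<longleftrightarrow> (AE x in N. (f \<circ> R \<circ> g) ((f \<circ> T \<circ> g) x) = (f \<circ> U \<circ> g) ((f \<circ> R \<circ> g) x))"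
    proof
      assume "AE y in N. f (R (T (g y))) = f (U (R (g y)))"
      then show "AE x in N. (f \<circ> R \<circ> g) ((f \<circ> T \<circ> g) x) = (f \<circ> U \<circ> g) ((f \<circ> R \<circ> g) x)"
        using comp[OF T, of R] comp[OF R, of U] by eventually_elim simp
    next
      assume "AE x in N. (f \<circ> R \<circ> g) ((f \<circ> T \<circ> g) x) = (f \<circ> U \<circ> g) ((f \<circ> R \<circ> g) x)"
      then show "AE y in N. f (R (T (g y))) = f (U (R (g y)))"
        using comp[OF T, of R] comp[OF R, of U] by eventually_elim simp
    qed
    finally show ?thesis .
  qed
  have img: "H ` (ae_class M ` ?K) = ae_class N ` ?K'"
  proof (intro equalityI subsetI)
    fix c assume "c \<in> H ` (ae_class M ` ?K)"
    then obtain R where R: "R \<in> ?K" "c = H (ae_class M R)" by auto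
    then have "f \<circ> R \<circ> g \<in> ?K'" using rel[of R T] rel[of R T'] T T' conj_inv by blast
    then show "c \<in> ae_class N ` ?K'" using R H by auto
  next
    fix c assume "c \<in> ae_class N ` ?K'"
    then obtain R' where R': "R' \<in> ?K'" "c = ae_class N R'" by auto
    define R where "R = g \<circ> R' \<circ> f"
    have R: "R \<in> invertible_mpt M" using R' conj_inv' unfolding R_def by auto
    have R'N: "R' \<in> invertible_mpt N" using R' by auto
    have eq: "AE y in N. (f \<circ> R \<circ> g) y = R' y"
      using AE_invertible[OF R'N fg] fg unfolding R_def by eventually_elim simp
    have eqT: "AE y in N. (f \<circ> R \<circ> g) ((f \<circ> T \<circ> g) y) = R' ((f \<circ> T \<circ> g) y)"
      by (rule AE_invertible[OF conj_inv[OF T] eq])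
    have "(AE x in N. (f \<circ> R \<circ> g) ((f \<circ> T \<circ> g) x) = U ((f \<circ> R \<circ> g) x))"
      if "AE x in N. R' ((f \<circ> T \<circ> g) x) = U (R' x)" for U
      using that eq eqT by eventually_elim metis
    then have "R \<in> ?K" using R' R rel[of R T] rel[of R T'] T T' by blast
    moreover have "c = H (ae_class M R)"
      using R' R eq by (simp add: H ae_class_eq_iff conj_inv) (auto elim: AE_mp)
    ultimately show "c \<in> H ` (ae_class M ` ?K)" by auto
  qed
  have eqM: "reversing_symmetry_group M T = (Aut_space M)\<lparr>carrier := ae_class M ` ?K\<rparr>"
    by (rule reversing_symmetry_group_eq[OF T T'])
  have eqN: "reversing_symmetry_group N (f \<circ> T \<circ> g) = (Aut_space N)\<lparr>carrier := ae_class N ` ?K'\<rparr>"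
    by (rule reversing_symmetry_group_eq[OF conj_inv[OF T] conj_inv[OF T'(1)] T'N])
  let ?G = "(Aut_space M)\<lparr>carrier := ae_class M ` ?K\<rparr>" and ?G' = "(Aut_space N)\<lparr>carrier := ae_class N ` ?K'\<rparr>"
  have "H \<in> iso (reversing_symmetry_group M T) (reversing_symmetry_group N (f \<circ> T \<circ> g))"
    unfolding eqM eqN
  proof (rule isoI)
    show "H \<in> hom ?G ?G'"
    proof (rule homI)
      fix x assume "x \<in> carrier ?G"
      then show "H x \<in> carrier ?G'" using img by auto
    next
      fix x y assume "x \<in> carrier ?G" "y \<in> carrier ?G"
      then show "H (x \<otimes>\<^bsub>?G\<^esub> y) = H x \<otimes>\<^bsub>?G'\<^esub> H y"
        using H_mult by auto
    qed
    show "bij_betw H (carrier ?G) (carrier ?G')"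
      using img H_iff by (auto simp: bij_betw_def inj_on_def)
  qed
  then show "reversing_symmetry_group M T \<cong> reversing_symmetry_group N (f \<circ> T \<circ> g)"
    unfolding is_iso_def by auto
qed



section \<open>Ergodicity\<close>

lemma funpow_measure_preserving:
  assumes "T \<in> measurable M M" "distr M M T = M"
  shows "(T ^^ n) \<in> measurable M M" "distr M M (T ^^ n) = M"
proof (induction n)
  case 0
  show "T ^^ 0 \<in> measurable M M" "distr M M (T ^^ 0) = M" by (auto simp: id_def distr_id2)
next
  case (Suc n)
  show "T ^^ Suc n \<in> measurable M M" using measurable_comp[OF Suc(1) assms(1)] by simp
  show "distr M M (T ^^ Suc n) = M" using distr_distr[OF assms(1) Suc(1)] Suc(2) assms(2) by simp
qed

lemma measure_vimage:
  assumes "T \<in> measurable M M" "distr M M T = M" "A \<in> sets M"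
  shows "measure M (T -` A \<inter> space M) = measure M A"
  using measure_distr[OF assms(1,3)] assms(2) by simp

text \<open>A form of ergodicity that depends only on the class of the transformation modulo null sets.\<close>

definition ae_ergodic :: "'a measure \<Rightarrow> ('a \<Rightarrow> 'a) \<Rightarrow> bool" where
  "ae_ergodic M T \<longleftrightarrow> (\<forall>A\<in>sets M. (AE x in M. T x \<in> A \<longleftrightarrow> x \<in> A) \<longrightarrow> measure M A = 0 \<or> measure M A = 1)"

text \<open>If \<open>A\<close> is invariant up to a null set, then the set of points that visit \<open>A\<close> infinitely often is
  strictly invariant and differs from \<open>A\<close> by a null set.\<close>

lemma ergodic_imp_ae_ergodic:
  assumes T: "T \<in> measurable M M" "distr M M T = M" and erg: "ergodic M T"
  shows "ae_ergodic M T"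
  unfolding ae_ergodic_def
proof (intro ballI impI)
  fix A assume A: "A \<in> sets M" and inv: "AE x in M. T x \<in> A \<longleftrightarrow> x \<in> A"
  define L where "L = {x \<in> space M. \<forall>m. \<exists>n\<ge>m. (T ^^ n) x \<in> A}"
  have [measurable]: "(T ^^ n) \<in> measurable M M" for n by (rule funpow_measure_preserving[OF T])
  have L: "L \<in> sets M" unfolding L_def using A by measurable
  have "(\<forall>m. \<exists>n\<ge>m. (T ^^ n) (T x) \<in> A) \<longleftrightarrow> (\<forall>m. \<exists>n\<ge>m. (T ^^ n) x \<in> A)" for x
  proof
    assume *: "\<forall>m. \<exists>n\<ge>m. (T ^^ n) (T x) \<in> A"
    show "\<forall>m. \<exists>n\<ge>m. (T ^^ n) x \<in> A"
    proof
      fix m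
      obtain n where "n \<ge> m" "(T ^^ n) (T x) \<in> A" using * by blast
      then show "\<exists>n\<ge>m. (T ^^ n) x \<in> A" by (intro exI[of _ "Suc n"]) (simp add: funpow_swap1)
    qed
  next
    assume *: "\<forall>m. \<exists>n\<ge>m. (T ^^ n) x \<in> A"
    show "\<forall>m. \<exists>n\<ge>m. (T ^^ n) (T x) \<in> A"
    proof
      fix m
      obtain n where "n \<ge> Suc m" "(T ^^ n) x \<in> A" using * by blast
      then show "\<exists>n\<ge>m. (T ^^ n) (T x) \<in> A"
        by (intro exI[of _ "n - 1"]) (cases n, auto simp: funpow_swap1)
    qed
  qed
  then have "T -` L \<inter> space M = L"
    using measurable_space[OF T(1)] unfolding L_def by auto
  then have 01: "measure M L = 0 \<or> measure M L = 1" using erg L unfolding ergodic_def by blast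
  have "AE x in M. (T ^^ n) x \<in> A \<longleftrightarrow> x \<in> A" for n
  proof (induction n)
    case (Suc n)
    have "AE x in M. T ((T ^^ n) x) \<in> A \<longleftrightarrow> (T ^^ n) x \<in> A"
      by (rule AE_measure_preserving[OF funpow_measure_preserving[OF T] inv])
    then show ?case using Suc by eventually_elim simp
  qed simp
  then have "AE x in M. \<forall>n. (T ^^ n) x \<in> A \<longleftrightarrow> x \<in> A" by (simp add: AE_all_countable)
  then have "AE x in M. x \<in> A \<longleftrightarrow> x \<in> L" using AE_space by eventually_elim (auto simp: L_def)
  then have "measure M A = measure M L" using A L by (rule measure_eq_AE)
  with 01 show "measure M A = 0 \<or> measure M A = 1" by simp
qed

lemma ae_ergodic_conjugate:
  assumes f: "f \<in> measurable M N" "distr M N f = N"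
    and T: "T \<in> measurable M M" "distr M M T = M" and gf: "AE x in M. g (f x) = x"
    and erg: "ae_ergodic M T"
  shows "ae_ergodic N (f \<circ> T \<circ> g)"
  unfolding ae_ergodic_def
proof (intro ballI impI)
  fix A assume A: "A \<in> sets N" and inv: "AE x in N. (f \<circ> T \<circ> g) x \<in> A \<longleftrightarrow> x \<in> A"
  let ?B = "f -` A \<inter> space M"
  have "AE x in M. f (T (g (f x))) \<in> A \<longleftrightarrow> f x \<in> A"
    using AE_measure_preserving[OF f inv] by simp
  then have "AE x in M. T x \<in> ?B \<longleftrightarrow> x \<in> ?B"
    using gf AE_space by eventually_elim (use measurable_space[OF T(1)] in auto)
  moreover have "?B \<in> sets M" using f A by (auto intro: measurable_sets)
  ultimately have "measure M ?B = 0 \<or> measure M ?B = 1" using erg unfolding ae_ergodic_def by blast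
  moreover have "measure M ?B = measure N A"
    using measure_distr[OF f(1) A] f(2) by simp
  ultimately show "measure N A = 0 \<or> measure N A = 1" by simp
qed

lemma ae_ergodic_AE_cong:
  assumes "ae_ergodic M T" "AE x in M. T x = T' x"
  shows "ae_ergodic M T'"
  unfolding ae_ergodic_def
proof (intro ballI impI)
  fix A assume A: "A \<in> sets M" and "AE x in M. T' x \<in> A \<longleftrightarrow> x \<in> A"
  then have "AE x in M. T x \<in> A \<longleftrightarrow> x \<in> A" using assms(2) by (auto elim: AE_mp)
  then show "measure M A = 0 \<or> measure M A = 1" using assms(1) A unfolding ae_ergodic_def by blast
qed

text \<open>A forward invariant set is invariant up to a null set, because it has the same measure as its
  preimage.\<close>

lemma (in prob_space) ae_ergodic_forward_invariant:
  assumes T: "T \<in> measurable M M" "distr M M T = M" and erg: "ae_ergodic M T"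
    and A: "A \<in> sets M" and fwd: "AE x in M. x \<in> A \<longrightarrow> T x \<in> A"
  shows "measure M A = 0 \<or> measure M A = 1"
proof -
  let ?B = "T -` A \<inter> space M"
  have B: "?B \<in> sets M" using T A by (auto intro: measurable_sets)
  have "prob (?B - A) = prob ?B - prob (?B \<inter> A)"
    by (rule finite_measure_Diff'[OF B A])
  moreover have "prob (?B \<inter> A) = prob A"
    using fwd AE_space by (intro finite_measure_eq_AE) (use A B in \<open>auto elim: AE_mp\<close>)
  ultimately have "prob (?B - A) = 0" using measure_vimage[OF T A] by simp
  then have "?B - A \<in> null_sets M" using A B by (intro null_setsI) (auto simp: emeasure_eq_measure)
  then have "AE x in M. x \<notin> ?B - A" by (rule AE_not_in)
  then have "AE x in M. T x \<in> A \<longleftrightarrow> x \<in> A" using fwd AE_space by eventually_elim auto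
  then show ?thesis using erg A unfolding ae_ergodic_def by blast
qed

text \<open>The points of mass at least \<open>\<epsilon>\<close> form a finite set, and it is forward invariant since masses
  do not decrease along an orbit. So an ergodic transformation of a space with an atom lives on finitely
  many points.\<close>

lemma (in prob_space) ae_ergodic_atom:
  assumes T: "T \<in> measurable M M" "distr M M T = M" and erg: "ae_ergodic M T"
    and single: "\<And>x. x \<in> space M \<Longrightarrow> {x} \<in> sets M" and a: "a \<in> space M" "measure M {a} > 0"
  obtains F where "finite F" "F \<subseteq> space M" "AE x in M. x \<in> F"
proof -
  define F where "F = {x \<in> space M. prob {x} \<ge> prob {a}}"
  have bound: "real (card G) * prob {a} \<le> 1" if "finite G" "G \<subseteq> F" for G
  proof -
    have "real (card G) * prob {a} = (\<Sum>x\<in>G. prob {a})" by simp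
    also have "\<dots> \<le> (\<Sum>x\<in>G. prob {x})" by (rule sum_mono) (use that in \<open>auto simp: F_def\<close>)
    also have "\<dots> = prob G"
      by (rule finite_measure_eq_sum_singleton[symmetric]) (use that single in \<open>auto simp: F_def\<close>)
    finally show ?thesis using prob_le_1[of G] by linarith
  qed
  have fin: "finite F"
  proof (rule ccontr)
    assume "infinite F"
    obtain n :: nat where n: "1 / prob {a} < real n" using reals_Archimedean2 by blast
    obtain G where "finite G" "card G = n" "G \<subseteq> F"
      using infinite_arbitrarily_large[OF \<open>infinite F\<close>] by blast
    with bound[of G] n a show False by (simp add: field_simps)
  qed
  have F: "F \<in> sets M"
    using sets.finite_UN[OF fin, of "\<lambda>x. {x}"] single by (auto simp: F_def)
  have fwd: "T x \<in> F" if "x \<in> F" for x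
  proof -
    have Tx: "T x \<in> space M" using that measurable_space[OF T(1)] by (auto simp: F_def)
    have "prob {a} \<le> prob {x}" using that by (simp add: F_def)
    also have "\<dots> \<le> prob (T -` {T x} \<inter> space M)"
      by (rule finite_measure_mono) (use that T single[OF Tx] in \<open>auto simp: F_def intro: measurable_sets\<close>)
    also have "\<dots> = prob {T x}" by (rule measure_vimage[OF T single[OF Tx]])
    finally show ?thesis using Tx by (simp add: F_def)
  qed
  have "prob F = 0 \<or> prob F = 1"
    by (rule ae_ergodic_forward_invariant[OF T erg F]) (use fwd in auto)
  moreover have "prob {a} \<le> prob F" using F a by (intro finite_measure_mono) (auto simp: F_def)
  ultimately have "AE x in M. x \<in> F" using F a by (simp add: prob_eq_1)
  then show thesis using that[of F] fin F sets.sets_into_space by blast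
qed

section \<open>Ergodic systems on the unit interval\<close>

definition sum_measure :: "'a measure \<Rightarrow> 'a measure \<Rightarrow> 'a measure" where
  "sum_measure M N = measure_of (space M) (sets M) (\<lambda>A. emeasure M A + emeasure N A)"

lemma sets_sum_measure: "sets (sum_measure M N) = sets M"
  and space_sum_measure: "space (sum_measure M N) = space M"
  unfolding sum_measure_def by (simp_all add: sets.sigma_sets_eq space_measure_of sets.space_closed)

lemma emeasure_sum_measure:
  assumes "sets N = sets M" "A \<in> sets M"
  shows "emeasure (sum_measure M N) A = emeasure M A + emeasure N A"
  unfolding sum_measure_def
proof (rule emeasure_measure_of_sigma[OF sets.sigma_algebra_axioms _ _ assms(2)])
  show "positive (sets M) (\<lambda>A. emeasure M A + emeasure N A)" by (simp add: positive_def)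
  show "countably_additive (sets M) (\<lambda>A. emeasure M A + emeasure N A)"
  proof (rule countably_additiveI)
    fix A :: "nat \<Rightarrow> 'a set" assume A: "range A \<subseteq> sets M" "disjoint_family A" "\<Union>(range A) \<in> sets M"
    have "(\<Sum>i. emeasure M (A i) + emeasure N (A i)) = (\<Sum>i. emeasure M (A i)) + (\<Sum>i. emeasure N (A i))"
      by (rule suminf_add[symmetric]) auto
    also have "\<dots> = emeasure M (\<Union>(range A)) + emeasure N (\<Union>(range A))"
      using A assms(1) by (simp add: suminf_emeasure)
    finally show "(\<Sum>i. emeasure M (A i) + emeasure N (A i)) = emeasure M (\<Union>(range A)) + emeasure N (\<Union>(range A))" .
  qed
qed

text \<open>The set function that defines \<open>interval_with_atoms\<close> is a sum of two measures, hence countably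
  additive, so that it gives the actual values of the measure.\<close>

lemma interval_with_atoms_eq_sum_measure:
  fixes c :: real and p :: "nat \<Rightarrow> real"
  defines "I \<equiv> density lebesgue (indicator {0..c})"
    and "P \<equiv> distr (density (count_space UNIV) (\<lambda>n. ennreal (p n))) lebesgue (\<lambda>n. - real (Suc n))"
  shows "interval_with_atoms c p = sum_measure I P"
    and "\<And>A. A \<in> sets lebesgue \<Longrightarrow> emeasure I A = emeasure lebesgue (A \<inter> {0..c})"
    and "\<And>A. A \<in> sets lebesgue \<Longrightarrow> emeasure P A = (\<Sum>n. ennreal (p n) * indicator A (- real (Suc n)))"
proof -
  show P: "emeasure P A = (\<Sum>n. ennreal (p n) * indicator A (- real (Suc n)))"
    if "A \<in> sets lebesgue" for A
    using that unfolding P_def by (subst emeasure_distr)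
      (auto simp: emeasure_density nn_integral_count_space_nat indicator_def vimage_def intro!: suminf_cong)
  show I: "emeasure I A = emeasure lebesgue (A \<inter> {0..c})" if "A \<in> sets lebesgue" for A
  proof -
    have "emeasure I A = (\<integral>\<^sup>+x. indicator {0..c} x * indicator A x \<partial>lebesgue)"
      unfolding I_def by (rule emeasure_density[OF borel_measurable_indicator that]) auto
    also have "\<dots> = (\<integral>\<^sup>+x. indicator (A \<inter> {0..c}) x \<partial>lebesgue)"
      by (intro nn_integral_cong) (auto simp: indicator_def)
    also have "\<dots> = emeasure lebesgue (A \<inter> {0..c})" using that by (intro nn_integral_indicator) auto
    finally show ?thesis .
  qed
  have sp: "space I = UNIV" "sets I = sets lebesgue" unfolding I_def by auto
  have "sigma_sets UNIV (sets lebesgue) = sets (lebesgue :: real measure)"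
    using sets.sigma_sets_eq[of "lebesgue :: real measure"] by simp
  then show "interval_with_atoms c p = sum_measure I P"
    unfolding interval_with_atoms_def sum_measure_def sp
    by (intro measure_of_eq) (auto simp: I P simp del: mult_minus_left of_nat_Suc)
qed

lemma sets_interval_with_atoms: "sets (interval_with_atoms c p) = sets lebesgue"
  and space_interval_with_atoms: "space (interval_with_atoms c p) = UNIV"
  by (simp_all add: interval_with_atoms_eq_sum_measure(1) sets_sum_measure space_sum_measure)

lemma emeasure_interval_with_atoms:
  assumes "A \<in> sets lebesgue"
  shows "emeasure (interval_with_atoms c p) A =
    emeasure lebesgue (A \<inter> {0..c}) + (\<Sum>n. ennreal (p n) * indicator A (- real (Suc n)))"
  using assms
  by (simp add: interval_with_atoms_eq_sum_measure emeasure_sum_measure del: mult_minus_left of_nat_Suc emeasure_completion)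

text \<open>The vertex space of the cyclic graphings; all graphings below live on it.\<close>

abbreviation unit_borel :: "real measure" where
  "unit_borel \<equiv> restrict_space lborel {0..<1}"

abbreviation unit_lebesgue :: "real measure" where
  "unit_lebesgue \<equiv> completion unit_borel"

lemma sets_unit_borel_iff: "A \<in> sets unit_borel \<longleftrightarrow> A \<in> sets borel \<and> A \<subseteq> {0..<1}"
  by (subst sets_restrict_space_iff) auto

lemma space_unit_borel [simp]: "space unit_borel = {0..<1}"
  by (simp add: space_restrict_space)

lemma emeasure_unit_borel: "A \<in> sets unit_borel \<Longrightarrow> emeasure unit_borel A = emeasure lborel A"
  by (subst emeasure_restrict_space) (auto simp: sets_unit_borel_iff)

lemma measure_unit_borel: "A \<in> sets unit_borel \<Longrightarrow> measure unit_borel A = measure lborel A"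
  by (simp add: measure_def emeasure_unit_borel)

lemma measurable_id_unit_borel: "(\<lambda>x. x) \<in> borel_measurable unit_borel"
  by (intro measurable_restrict_space1) simp

lemma sets_unit_borel_preimage:
  assumes "h \<in> measurable unit_borel L" "E \<in> sets L"
  shows "{x \<in> {0..<1}. h x \<in> E} \<in> sets unit_borel"
proof -
  have "{x \<in> {0..<1}. h x \<in> E} = h -` E \<inter> space unit_borel" by auto
  then show ?thesis using measurable_sets[OF assms] by simp
qed

lemma prob_space_unit_borel: "prob_space unit_borel"
  by (rule prob_spaceI) (simp add: emeasure_unit_borel sets_unit_borel_iff)

lemma prob_space_unit_lebesgue: "prob_space unit_lebesgue"
proof (rule prob_spaceI)
  have "{0..<1} \<in> sets unit_borel" by (simp add: sets_unit_borel_iff)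
  then show "emeasure unit_lebesgue (space unit_lebesgue) = 1"
    using prob_space.emeasure_space_1[OF prob_space_unit_borel] by simp
qed

lemma unit_lebesgue:
  shows sets_unit_lebesgue_iff: "A \<in> sets unit_lebesgue \<longleftrightarrow> A \<in> sets lebesgue \<and> A \<subseteq> {0..<1}"
    and emeasure_unit_lebesgue: "A \<in> sets unit_lebesgue \<Longrightarrow> emeasure unit_lebesgue A = emeasure lebesgue A"
proof -
  have null: "N \<in> null_sets unit_borel \<longleftrightarrow> N \<in> null_sets lborel \<and> N \<subseteq> {0..<1}" for N
    by (subst null_sets_restrict_space) auto
  have split: "\<exists>S N N'. A = S \<union> N \<and> N \<subseteq> N' \<and> N' \<in> null_sets unit_borel \<and> S \<in> sets unit_borel"
    if "A \<in> sets lebesgue" "A \<subseteq> {0..<1}"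
  proof -
    obtain S N N' where *: "A = S \<union> N" "N \<subseteq> N'" "N' \<in> null_sets lborel" "S \<in> sets lborel"
      using \<open>A \<in> sets lebesgue\<close> by (rule sets_completionE)
    have "N' \<inter> {0..<1} \<in> null_sets lborel" using * by (intro null_set_Int2) auto
    with * that show ?thesis
      by (intro exI[of _ "S"] exI[of _ "N"] exI[of _ "N' \<inter> {0..<1}"]) (auto simp: null sets_unit_borel_iff)
  qed
  have leb: "A \<in> sets lebesgue \<and> A \<subseteq> {0..<1}" if A: "A \<in> sets unit_lebesgue"
  proof -
    obtain S N N' where *: "A = S \<union> N" "N \<subseteq> N'" "N' \<in> null_sets unit_borel" "S \<in> sets unit_borel"
      using A by (rule sets_completionE)
    then show ?thesis using sets_completionI[of A S N N' lborel] by (auto simp: null sets_unit_borel_iff)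
  qed
  show iff: "A \<in> sets unit_lebesgue \<longleftrightarrow> A \<in> sets lebesgue \<and> A \<subseteq> {0..<1}"
    using leb split sets_completionI[of A _ _ _ unit_borel] by blast
  show "emeasure unit_lebesgue A = emeasure lebesgue A" if A: "A \<in> sets unit_lebesgue"
  proof -
    obtain S N N' where *: "A = S \<union> N" "N \<subseteq> N'" "N' \<in> null_sets unit_borel" "S \<in> sets unit_borel"
      using A by (rule sets_completionE)
    have "N \<in> null_sets unit_lebesgue" "N \<in> null_sets lebesgue"
      using * null by (auto simp: null_sets_completion_iff2)
    then have "emeasure unit_lebesgue A = emeasure unit_lebesgue S" "emeasure lebesgue A = emeasure lebesgue S"
      using * by (auto intro!: emeasure_Un_null_set simp: sets_unit_borel_iff simp del: emeasure_completion)
    then show ?thesis using * by (simp add: emeasure_unit_borel) (simp add: sets_unit_borel_iff)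
  qed
qed

lemma iso_mod_null_unit_interval: "iso_mod_null (interval_with_atoms 1 (\<lambda>_. 0)) unit_lebesgue (\<lambda>x. if x \<in> {0..<1} then x else 0)"
    (is "iso_mod_null ?I _ ?f")
proof (rule iso_mod_nullI[where g = id])
  have sets: "A \<in> sets lebesgue \<and> A \<subseteq> {0..<1}" if "A \<in> sets unit_lebesgue" for A
    using that by (simp add: sets_unit_lebesgue_iff)
  have em: "emeasure ?I A = emeasure lebesgue (A \<inter> {0..<1})" if "A \<in> sets lebesgue" for A
  proof -
    have "A \<inter> {0..<1} \<union> A \<inter> {1} = A \<inter> {0..1}" by auto
    moreover have "A \<inter> {1} \<in> null_sets lebesgue"
      by (rule null_sets_completion_subset[of _ "{1}"]) (auto intro: null_sets_completionI)
    ultimately show ?thesis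
      using emeasure_Un_null_set[of "A \<inter> {0..<1}" lebesgue "A \<inter> {1}"] sets.Int[OF that, of "{0..<1}"]
      by (simp add: emeasure_interval_with_atoms that del: emeasure_completion)
  qed
  show f: "?f \<in> measurable ?I unit_lebesgue"
  proof (rule measurableI)
    fix A assume A: "A \<in> sets unit_lebesgue"
    have "?f -` A = (if 0 \<in> A then A \<union> - {0..<1} else A)"
      using sets[OF A] by (auto split: if_splits)
    then show "?f -` A \<inter> space ?I \<in> sets ?I"
      using sets[OF A] by (auto simp: sets_interval_with_atoms space_interval_with_atoms intro!: sets.Un)
  qed auto
  show g: "id \<in> measurable unit_lebesgue ?I"
    by (rule measurableI) (auto simp: space_interval_with_atoms sets_interval_with_atoms sets_unit_lebesgue_iff)
  show "distr ?I unit_lebesgue ?f = unit_lebesgue"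
  proof (rule measure_eqI)
    fix A assume "A \<in> sets (distr ?I unit_lebesgue ?f)"
    then have A: "A \<in> sets unit_lebesgue" by simp
    have "?f -` A \<in> sets lebesgue"
      using measurable_sets[OF f A] by (simp add: sets_interval_with_atoms space_interval_with_atoms)
    moreover have "?f -` A \<inter> {0..<1} = A" using sets[OF A] by auto
    ultimately show "emeasure (distr ?I unit_lebesgue ?f) A = emeasure unit_lebesgue A"
      using A f by (simp add: emeasure_distr space_interval_with_atoms em emeasure_unit_lebesgue del: emeasure_completion)
  qed simp
  show "distr unit_lebesgue ?I id = ?I"
  proof (rule measure_eqI)
    fix A assume "A \<in> sets (distr unit_lebesgue ?I id)"
    then have A: "A \<in> sets lebesgue" by (simp add: sets_interval_with_atoms)
    then have "A \<inter> {0..<1} \<in> sets unit_lebesgue"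
      using sets.Int[OF A, of "{0..<1}"] by (simp add: sets_unit_lebesgue_iff)
    then show "emeasure (distr unit_lebesgue ?I id) A = emeasure ?I A"
      using A g by (simp add: emeasure_distr em emeasure_unit_lebesgue sets_interval_with_atoms del: emeasure_completion)
  qed simp
  have "- {0..<1} \<in> null_sets ?I" by (auto simp: null_sets_def em sets_interval_with_atoms)
  then have "AE x in ?I. x \<notin> - {0..<1}" by (rule AE_not_in)
  then show "AE x in ?I. id (?f x) = x" by eventually_elim auto
  show "AE x in unit_lebesgue. ?f (id x) = x" using AE_space by eventually_elim auto
qed

text \<open>Atoms of \<open>X\<close> would confine the transformation to finitely many points, so only an interval
  remains, which has length \<open>1\<close>.\<close>

lemma ergodic_iso_unit_interval:
  assumes X: "standard_probability_space X" "\<not> finitely_many_atoms X"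
    and T: "T \<in> invertible_mpt X" and erg: "ergodic X T"
  obtains f where "iso_mod_null X unit_lebesgue f"
proof -
  obtain c p f where cp: "0 \<le> c" "\<And>n. 0 \<le> p n" and f: "iso_mod_null X (interval_with_atoms c p) f"
    using X(1) unfolding standard_probability_space_def by blast
  interpret X: prob_space X using X(1) unfolding standard_probability_space_def by auto
  define I where "I = interval_with_atoms c p"
  obtain g where fg: "f \<in> measurable X I" "distr X I f = I" "g \<in> measurable I X" "distr I X g = X"
    "AE x in X. g (f x) = x" "AE y in I. f (g y) = y" "iso_mod_null I X g"
    using f unfolding I_def by (rule iso_mod_nullE)
  interpret I: prob_space I using X.prob_space_distr[OF fg(1)] fg(2) by simp
  define T' where "T' = f \<circ> T \<circ> g"
  have T': "T' \<in> invertible_mpt I"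
    unfolding T'_def
    by (rule reversing_symmetry_group_conjugate(1)[OF _ _ _ _ T]) (use fg f in \<open>simp_all add: I_def\<close>)
  have erg': "ae_ergodic I T'"
    unfolding T'_def using fg invertible_mptD[OF T] erg
    by (intro ae_ergodic_conjugate ergodic_imp_ae_ergodic) auto
  have sp: "space I = UNIV" "sets I = sets lebesgue"
    by (simp_all add: I_def space_interval_with_atoms sets_interval_with_atoms)
  have p0: "p n = 0" for n
  proof (rule ccontr)
    assume "p n \<noteq> 0"
    let ?a = "- real (Suc n)"
    have "ennreal (p n) = (\<Sum>k\<in>{n}. ennreal (p k) * indicator {?a} (- real (Suc k)))" by simp
    also have "\<dots> \<le> (\<Sum>k. ennreal (p k) * indicator {?a} (- real (Suc k)))" by (rule sum_le_suminf) auto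
    also have "\<dots> = emeasure I {?a}" by (simp add: I_def emeasure_interval_with_atoms)
    finally have "measure I {?a} > 0"
      using \<open>p n \<noteq> 0\<close> cp(2)[of n] by (auto simp: I.emeasure_eq_measure)
    then obtain F where F: "finite F" "F \<subseteq> space I" "AE x in I. x \<in> F"
      using I.ae_ergodic_atom[OF invertible_mptD[OF T'] erg', of ?a] sp by auto
    have "AE x in X. f x \<in> F" by (rule AE_measure_preserving[OF fg(1,2) F(3)])
    then have "AE x in X. x \<in> g ` F" using fg(5) by eventually_elim (metis image_eqI)
    then have "finitely_many_atoms X"
      unfolding finitely_many_atoms_def using F(1) measurable_space[OF fg(3)] sp
      by (intro exI[of _ "g ` F"]) auto
    with X(2) show False by simp
  qed
  then have p: "p = (\<lambda>_. 0)" by auto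
  have "emeasure I UNIV = ennreal c"
    using cp(1) by (simp add: I_def p emeasure_interval_with_atoms)
  then have "c = 1" using I.emeasure_space_1 cp(1) sp by simp
  then have "iso_mod_null X (interval_with_atoms 1 (\<lambda>_. 0)) f" using f p by simp
  from iso_mod_null_comp[OF this iso_mod_null_unit_interval] show thesis by (rule that)
qed

lemma standard_probability_space_unit_lebesgue: "standard_probability_space unit_lebesgue"
proof -
  obtain g where "iso_mod_null unit_lebesgue (interval_with_atoms 1 (\<lambda>_. 0)) g"
    using iso_mod_null_unit_interval by (rule iso_mod_nullE)
  then show ?thesis
    unfolding standard_probability_space_def
    using prob_space_unit_lebesgue completion.complete_measure_axioms[of unit_borel]
    by (intro conjI exI[of _ 1] exI[of _ "\<lambda>_. 0"] exI[of _ g]) auto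
qed



section \<open>Borel automorphisms of the unit interval\<close>

text \<open>The two maps are mutually inverse at every point, so that orbits can be followed in
  both directions without exceptional null sets.\<close>

locale borel_automorphism =
  fixes T S :: "real \<Rightarrow> real"
  assumes T_measurable: "T \<in> measurable unit_borel unit_borel"
    and S_measurable: "S \<in> measurable unit_borel unit_borel"
    and distr_T: "distr unit_borel unit_borel T = unit_borel"
    and ST: "\<And>x. x \<in> {0..<1} \<Longrightarrow> S (T x) = x"
    and TS: "\<And>x. x \<in> {0..<1} \<Longrightarrow> T (S x) = x"

lemma measure_preserving_completion:
  assumes T: "T \<in> measurable M M" "distr M M T = M"
  shows "T \<in> measurable (completion M) (completion M)"
    and "distr (completion M) (completion M) T = completion M"
proof -
  have eq: "distr (completion M) M T = M" using T by (simp add: distr_completion)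
  show "T \<in> measurable (completion M) (completion M)"
    using T by (intro completion.measurable_completion2 measurable_completion) (simp_all add: eq)
  show "distr (completion M) (completion M) T = completion M"
    using completion.completion_distr_eq[of T M M] T by (simp add: eq measurable_completion)
qed

context borel_automorphism
begin

lemma distr_S: "distr unit_borel unit_borel S = unit_borel"
proof -
  have "distr unit_borel unit_borel S = distr (distr unit_borel unit_borel T) unit_borel S"
    by (simp add: distr_T)
  also have "\<dots> = distr unit_borel unit_borel (S \<circ> T)"
    by (rule distr_distr[OF S_measurable T_measurable])
  also have "\<dots> = distr unit_borel unit_borel (\<lambda>x. x)"
    by (rule distr_cong) (auto simp: ST)
  finally show ?thesis by (simp add: distr_id2)
qed

lemma inverse_automorphism: "borel_automorphism S T"
  by unfold_locales (rule S_measurable T_measurable distr_S TS ST; assumption?)+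

lemma T_in: "x \<in> {0..<1} \<Longrightarrow> T x \<in> {0..<1}"
  and S_in: "x \<in> {0..<1} \<Longrightarrow> S x \<in> {0..<1}"
  using measurable_space[OF T_measurable] measurable_space[OF S_measurable] by auto

lemma T_invertible: "T \<in> invertible_mpt unit_lebesgue"
proof -
  have "AE x in unit_lebesgue. S (T x) = x" "AE x in unit_lebesgue. T (S x) = x"
    using AE_space[of unit_lebesgue] by (eventually_elim; simp add: ST TS)+
  then show ?thesis
    using measure_preserving_completion[OF T_measurable distr_T]
      measure_preserving_completion[OF S_measurable distr_S]
    unfolding invertible_mpt_def by (auto intro: iso_mod_nullI)
qed

end

lemma measurable_unit_borelI:
  assumes "f \<in> borel_measurable M" "\<And>x. x \<in> space M \<Longrightarrow> f x \<in> {0..<1}"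
  shows "f \<in> measurable M unit_borel"
  by (rule measurable_restrict_space2) (use assms in auto)

lemma measurable_unit_borelD:
  assumes "f \<in> measurable M unit_borel"
  shows "f \<in> borel_measurable M"
  using measurable_restrict_space2_iff[of f M lborel "{0..<1}"] assms by simp

lemma borel_version_exists:
  assumes T0: "T0 \<in> measurable unit_lebesgue unit_lebesgue" "distr unit_lebesgue unit_lebesgue T0 = unit_lebesgue"
  obtains T where "T \<in> measurable unit_borel unit_borel" "distr unit_borel unit_borel T = unit_borel"
    "AE x in unit_borel. T x = T0 x"
proof -
  have "(\<lambda>x. x) \<in> borel_measurable unit_lebesgue"
    by (intro measurable_completion measurable_id_unit_borel)
  then have "T0 \<in> borel_measurable unit_lebesgue"
    using measurable_compose[OF T0(1)] by blast
  then obtain T' where T': "T' \<in> borel_measurable unit_borel" "AE x in unit_borel. T0 x = T' x"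
    using completion_ex_borel_measurable_real by blast
  define T where "T x = (if T' x \<in> {0..<1} then T' x else 0)" for x
  have "T \<in> borel_measurable unit_borel" unfolding T_def using T'(1) by measurable
  then have T: "T \<in> measurable unit_borel unit_borel"
    by (rule measurable_unit_borelI) (auto simp: T_def)
  have ae: "AE x in unit_borel. T x = T0 x"
    using T'(2) AE_space
  proof eventually_elim
    case (elim x)
    then have "T0 x \<in> {0..<1}" using measurable_space[OF T0(1), of x] by simp
    with elim show ?case by (simp add: T_def)
  qed
  have "distr unit_borel unit_borel T = unit_borel"
  proof (rule measure_eqI)
    fix A assume "A \<in> sets (distr unit_borel unit_borel T)"
    then have A: "A \<in> sets unit_borel" by simp
    have "AE x in unit_lebesgue. T x = T0 x" using ae by (rule AE_completion)
    then have "AE x in unit_lebesgue. x \<in> T -` A \<inter> space unit_borel \<longleftrightarrow> x \<in> T0 -` A \<inter> space unit_borel"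
      by eventually_elim auto
    then have "emeasure unit_lebesgue (T -` A \<inter> space unit_borel) = emeasure unit_lebesgue (T0 -` A \<inter> space unit_borel)"
      using measurable_sets[OF T A] measurable_sets[OF T0(1), of A] A
      by (intro emeasure_eq_AE) auto
    also have "\<dots> = emeasure (distr unit_lebesgue unit_lebesgue T0) A"
      using A by (subst emeasure_distr[OF T0(1)]) auto
    also have "\<dots> = emeasure unit_borel A" using A T0(2) by simp
    finally show "emeasure (distr unit_borel unit_borel T) A = emeasure unit_borel A"
      using measurable_sets[OF T A] T A by (simp add: emeasure_distr)
  qed simp
  with T ae that show thesis by blast
qed

text \<open>Borel versions of a transformation and of its inverse are mutually inverse bijections of the
  conull set of points whose two half orbits avoid the exceptional null set; outside of it the
  transformation is replaced by the identity.\<close>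

lemma borel_automorphism_exists:
  assumes "T0 \<in> invertible_mpt unit_lebesgue"
  obtains T S where "borel_automorphism T S" "AE x in unit_lebesgue. T x = T0 x"
proof -
  obtain S0 where S0: "S0 \<in> invertible_mpt unit_lebesgue" "AE x in unit_lebesgue. S0 (T0 x) = x"
     "AE x in unit_lebesgue. T0 (S0 x) = x"
    using assms by (rule invertible_mptE)
  obtain T1 where T1: "T1 \<in> measurable unit_borel unit_borel" "distr unit_borel unit_borel T1 = unit_borel"
    "AE x in unit_borel. T1 x = T0 x"
    using borel_version_exists invertible_mptD[OF assms] by blast
  obtain S1 where S1: "S1 \<in> measurable unit_borel unit_borel" "distr unit_borel unit_borel S1 = unit_borel"
    "AE x in unit_borel. S1 x = S0 x"
    using borel_version_exists invertible_mptD[OF S0(1)] by blast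
  have [measurable]: "(T1 ^^ n) \<in> measurable unit_borel unit_borel" "(S1 ^^ n) \<in> measurable unit_borel unit_borel" for n
    using funpow_measure_preserving T1 S1 by blast+
  note [measurable] = T1(1) S1(1)
  define good where "good x \<longleftrightarrow> S1 (T1 x) = x \<and> T1 (S1 x) = x" for x
  have borel: "f \<in> borel_measurable unit_borel" if "f \<in> measurable unit_borel unit_borel" for f
    using that by (rule measurable_unit_borelD)
  have m: "(\<lambda>x. S1 (T1 x)) \<in> borel_measurable unit_borel" "(\<lambda>x. T1 (S1 x)) \<in> borel_measurable unit_borel"
    "(\<lambda>x. x) \<in> borel_measurable unit_borel"
    by (rule borel; measurable)+
  then have "Measurable.pred unit_borel (\<lambda>x. S1 (T1 x) = x)" "Measurable.pred unit_borel (\<lambda>x. T1 (S1 x) = x)"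
    unfolding pred_def using borel_measurable_eq[OF m(1,3)] borel_measurable_eq[OF m(2,3)] by auto
  then have [measurable]: "Measurable.pred unit_borel good"
    unfolding good_def by (rule pred_intros_logic)
  define W where "W = {x \<in> space unit_borel. \<forall>n. good ((T1 ^^ n) x) \<and> good ((S1 ^^ n) x)}"
  have W: "W \<in> sets unit_borel" unfolding W_def by measurable
  have "AE x in unit_borel. S1 (T1 x) = x"
    using T1(3) AE_measure_preserving[OF T1(1,2) S1(3)] S0(2) unfolding AE_completion_iff
    by eventually_elim simp
  moreover have "AE x in unit_borel. T1 (S1 x) = x"
    using S1(3) AE_measure_preserving[OF S1(1,2) T1(3)] S0(3) unfolding AE_completion_iff
    by eventually_elim simp
  ultimately have "AE x in unit_borel. good x" unfolding good_def by eventually_elim simp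
  then have "AE x in unit_borel. good ((T1 ^^ n) x)" "AE x in unit_borel. good ((S1 ^^ n) x)" for n
    using AE_measure_preserving[OF funpow_measure_preserving[of T1 unit_borel n]] T1
      AE_measure_preserving[OF funpow_measure_preserving[of S1 unit_borel n]] S1 by blast+
  then have "AE x in unit_borel. (\<forall>n. good ((T1 ^^ n) x)) \<and> (\<forall>n. good ((S1 ^^ n) x))"
    by (simp add: AE_all_countable)
  then have AE_W: "AE x in unit_borel. x \<in> W" using AE_space by eventually_elim (auto simp: W_def)
  have W_iff: "x \<in> W \<longleftrightarrow> x \<in> {0..<1} \<and> (\<forall>n. good ((T1 ^^ n) x)) \<and> (\<forall>n. good ((S1 ^^ n) x))" for x
    by (auto simp: W_def)
  have good0: "good x" if "x \<in> W" for x
    using that unfolding W_iff by (metis funpow_0)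
  have step: "P x \<in> W" if P: "P = T1 \<and> Q = S1 \<or> P = S1 \<and> Q = T1" and x: "x \<in> W" for P Q x
  proof -
    have P_good: "good ((P ^^ n) x)" and Q_good: "good ((Q ^^ n) x)" for n using P x unfolding W_iff by auto
    have "Q (P x) = x" using P good0[OF x] by (auto simp: good_def)
    then have "(Q ^^ n) (P x) = (case n of 0 \<Rightarrow> (P ^^ 1) x | Suc m \<Rightarrow> (Q ^^ m) x)" for n
      by (auto simp: funpow_swap1 split: nat.split)
    then have "good ((Q ^^ n) (P x))" for n using P_good[of 1] Q_good by (auto split: nat.split)
    moreover have "good ((P ^^ n) (P x))" for n using P_good[of "Suc n"] by (simp add: funpow_swap1)
    moreover have "P x \<in> {0..<1}"
      using P x measurable_space[OF T1(1), of x] measurable_space[OF S1(1), of x] by (auto simp: W_iff)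
    ultimately show ?thesis using P unfolding W_iff by auto
  qed
  have T1W: "T1 x \<in> W" and S1W: "S1 x \<in> W" if "x \<in> W" for x
    using step[of T1 S1] step[of S1 T1] that by auto
  define T where "T x = (if x \<in> W then T1 x else x)" for x
  define S where "S x = (if x \<in> W then S1 x else x)" for x
  have T: "T \<in> measurable unit_borel unit_borel" and S: "S \<in> measurable unit_borel unit_borel"
    unfolding T_def S_def using W by measurable
  have TT1: "AE x in unit_borel. T x = T1 x" using AE_W by eventually_elim (simp add: T_def)
  have "distr unit_borel unit_borel T = distr unit_borel unit_borel T1"
    using TT1 T T1(1) by (intro distr_cong_AE) auto
  then have distr: "distr unit_borel unit_borel T = unit_borel" using T1 by simp
  have "borel_automorphism T S"
  proof
    fix x :: real
    show "S (T x) = x" "T (S x) = x" using good0[of x] T1W[of x] S1W[of x] by (auto simp: T_def S_def good_def)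
  qed (rule T S distr)+
  moreover have "AE x in unit_lebesgue. T x = T0 x"
    unfolding AE_completion_iff using TT1 T1(3) by eventually_elim simp
  ultimately show thesis by (rule that)
qed



section \<open>The graphing of a Borel automorphism\<close>

text \<open>Fixed points of \<open>T\<close> become isolated vertices, so that the graph has no loops.\<close>

definition orbit_graphing :: "(real \<Rightarrow> real) \<Rightarrow> real graphing_data" where
  "orbit_graphing T =
     \<lparr>vborel = unit_borel,
      edges = {(x, y). x \<in> {0..<1} \<and> y \<in> {0..<1} \<and> x \<noteq> y \<and> (y = T x \<or> x = T y)}\<rparr>"

lemma vspace_orbit_graphing [simp]: "vspace (orbit_graphing T) = unit_lebesgue"
  by (simp add: vspace_def orbit_graphing_def)

lemma standard_borel_unit_borel: "standard_borel unit_borel"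
  unfolding standard_borel_def
proof (intro exI conjI)
  let ?\<tau> = "top_of_set {0..<1::real}"
  show "topspace ?\<tau> = space unit_borel" by simp
  show "second_countable ?\<tau>"
  proof (rule second_countable_subtopology)
    obtain B :: "real set set" where B: "countable B" "topological_basis B"
      using ex_countable_basis by blast
    show "second_countable (euclidean :: real topology)"
      unfolding second_countable_def open_openin[symmetric]
    proof (intro exI[of _ B] conjI ballI allI impI)
      show "open V" if "V \<in> B" for V using B(2) that by (rule topological_basis_open)
      show "\<exists>V\<in>B. x \<in> V \<and> V \<subseteq> U" if "open U \<and> x \<in> U" for U x
        using topological_basisE[OF B(2), of U x] that by metis
    qed (rule B(1))
  qed
  have "{0..<1::real} = {0..} \<inter> {..<1}" by auto
  moreover have "gdelta_in euclidean {0::real..}"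
    by (rule closed_imp_gdelta_in) (auto simp: metrizable_space_euclidean)
  moreover have "gdelta_in euclidean {..<1::real}"
    by (rule open_imp_gdelta_in) auto
  ultimately have "gdelta_in euclidean {0..<1::real}" using gdelta_in_Int by metis
  then show "completely_metrizable_space ?\<tau>"
    by (rule completely_metrizable_space_gdelta_in[OF completely_metrizable_space_euclidean])
  have "sets unit_borel = (\<inter>) {0..<1} ` sigma_sets UNIV {U. open U}"
    by (simp add: sets_restrict_space sets_borel)
  also have "\<dots> = sigma_sets {0..<1} ((\<inter>) {0..<1} ` {U. open U})"
    using atLeastLessThan_borel[of 0 "1::real"] by (intro sigma_sets_Int) (auto simp: sets_borel)
  also have "(\<inter>) {0..<1} ` {U. open U} = {U. openin ?\<tau> U}"
    by (auto simp: openin_open)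
  finally show "sets unit_borel = sigma_sets (space unit_borel) {U. openin ?\<tau> U}" by simp
qed

lemma (in prob_space) measure_rectangles_eqI:
  assumes sets: "sets M1 = sets (M \<Otimes>\<^sub>M M)" "sets M2 = sets (M \<Otimes>\<^sub>M M)"
    and fin: "emeasure M1 (space M \<times> space M) \<noteq> \<infinity>"
    and eq: "\<And>A B. A \<in> sets M \<Longrightarrow> B \<in> sets M \<Longrightarrow> emeasure M1 (A \<times> B) = emeasure M2 (A \<times> B)"
  shows "M1 = M2"
proof (rule measure_eqI_generator_eq[OF Int_stable_pair_measure_generator[of M M]])
  show "{a \<times> b |a b. a \<in> sets M \<and> b \<in> sets M} \<subseteq> Pow (space M \<times> space M)"
    by (rule pair_measure_closed)
  show "sets M1 = sigma_sets (space M \<times> space M) {a \<times> b |a b. a \<in> sets M \<and> b \<in> sets M}"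
    "sets M2 = sigma_sets (space M \<times> space M) {a \<times> b |a b. a \<in> sets M \<and> b \<in> sets M}"
    using sets by (simp_all add: sets_pair_measure)
  show "range (\<lambda>_::nat. space M \<times> space M) \<subseteq> {a \<times> b |a b. a \<in> sets M \<and> b \<in> sets M}" by auto
  show "(\<Union>i::nat. space M \<times> space M) = space M \<times> space M" by simp
  show "emeasure M1 (space M \<times> space M) \<noteq> \<infinity>" for i :: nat by (rule fin)
qed (auto simp: eq)

lemma sets_preimage_lebesgue:
  assumes "f \<in> measurable unit_lebesgue unit_lebesgue" "A \<in> sets unit_lebesgue" "B \<in> sets unit_lebesgue"
  shows "{x \<in> A. f x \<in> B} \<in> sets unit_lebesgue"
proof -
  have "{x \<in> A. f x \<in> B} = A \<inter> (f -` B \<inter> space unit_lebesgue)"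
    using sets.sets_into_space[OF assms(2)] by auto
  then show ?thesis using sets.Int[OF assms(2) measurable_sets[OF assms(1,3)]] by simp
qed

lemma edge_measure_eqI:
  assumes V: "prob_space (vspace \<Gamma>)"
    and sets: "sets \<eta> = sets (vspace \<Gamma> \<Otimes>\<^sub>M vspace \<Gamma>)"
    and fin: "emeasure \<eta> (space (vspace \<Gamma>) \<times> space (vspace \<Gamma>)) \<noteq> \<infinity>"
    and eq: "\<And>A B. A \<in> sets (vspace \<Gamma>) \<Longrightarrow> B \<in> sets (vspace \<Gamma>) \<Longrightarrow>
       emeasure \<eta> (A \<times> B) = (\<integral>\<^sup>+x\<in>A. of_nat (edges_to \<Gamma> x B) \<partial>vspace \<Gamma>)"
  shows "edge_measure \<Gamma> = \<eta>"
  unfolding edge_measure_def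
proof (rule the_equality)
  fix \<eta>' assume "sets \<eta>' = sets (vspace \<Gamma> \<Otimes>\<^sub>M vspace \<Gamma>) \<and>
    (\<forall>A\<in>sets (vspace \<Gamma>). \<forall>B\<in>sets (vspace \<Gamma>). emeasure \<eta>' (A \<times> B) = (\<integral>\<^sup>+x\<in>A. of_nat (edges_to \<Gamma> x B) \<partial>vspace \<Gamma>))"
  then show "\<eta>' = \<eta>"
    by (intro prob_space.measure_rectangles_eqI[OF V, symmetric] sets fin) (auto simp: eq)
qed (auto simp: sets eq)

context borel_automorphism
begin

lemma mem_edges_iff: "(x, y) \<in> edges (orbit_graphing T) \<longleftrightarrow> x \<in> {0..<1} \<and> x \<noteq> y \<and> (y = T x \<or> y = S x)"
  using T_in[of x] S_in[of x] TS[of x] ST[of y] unfolding orbit_graphing_def by auto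

lemma orbit_graphing_inverse: "orbit_graphing S = orbit_graphing T"
proof -
  interpret I: borel_automorphism S T by (rule inverse_automorphism)
  have "edges (orbit_graphing S) = edges (orbit_graphing T)"
    by (auto simp: mem_edges_iff I.mem_edges_iff)
  then show ?thesis by (simp add: orbit_graphing_def)
qed

lemmas [measurable] = measurable_id_unit_borel

lemma measurable_T_borel [measurable]: "T \<in> borel_measurable unit_borel"
  and measurable_S_borel [measurable]: "S \<in> borel_measurable unit_borel"
  using measurable_unit_borelD T_measurable S_measurable by auto

lemma T_lebesgue: "T \<in> measurable unit_lebesgue unit_lebesgue" "distr unit_lebesgue unit_lebesgue T = unit_lebesgue"
  and S_lebesgue: "S \<in> measurable unit_lebesgue unit_lebesgue" "distr unit_lebesgue unit_lebesgue S = unit_lebesgue"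
  using measure_preserving_completion[OF T_measurable distr_T]
    measure_preserving_completion[OF S_measurable distr_S] by auto

lemma sets_T_ne:
  "{x \<in> {0..<1}. T x \<noteq> x} \<in> sets unit_lebesgue"
  "{x \<in> {0..<1}. S x \<noteq> x \<and> S x \<noteq> T x} \<in> sets unit_lebesgue"
proof -
  have "{x \<in> space unit_borel. T x \<noteq> x} \<in> sets unit_borel"
    "{x \<in> space unit_borel. S x \<noteq> x \<and> S x \<noteq> T x} \<in> sets unit_borel" by measurable
  then show "{x \<in> {0..<1}. T x \<noteq> x} \<in> sets unit_lebesgue"
    "{x \<in> {0..<1}. S x \<noteq> x \<and> S x \<noteq> T x} \<in> sets unit_lebesgue" by auto
qed

text \<open>On a cycle of length two \<open>T x\<close> and \<open>S x\<close> are the same neighbor, which must be counted once.\<close>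

lemma edges_to_eq:
  assumes "x \<in> {0..<1}"
  shows "edges_to (orbit_graphing T) x B =
    of_bool (T x \<in> B \<and> T x \<noteq> x) + of_bool (S x \<in> B \<and> S x \<noteq> x \<and> S x \<noteq> T x)"
proof -
  define P where "P = (if T x \<in> B \<and> T x \<noteq> x then {T x} else {})"
  define Q where "Q = (if S x \<in> B \<and> S x \<noteq> x \<and> S x \<noteq> T x then {S x} else {})"
  have "{y \<in> B. (x, y) \<in> edges (orbit_graphing T)} = P \<union> Q"
    using assms by (auto simp: mem_edges_iff P_def Q_def)
  moreover have "card (P \<union> Q) = card P + card Q"
    by (rule card_Un_disjoint) (auto simp: P_def Q_def)
  ultimately show ?thesis unfolding edges_to_def by (simp add: P_def Q_def)
qed

lemma nn_integral_edges_to: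
  assumes A: "A \<in> sets unit_lebesgue" and B: "B \<in> sets unit_lebesgue"
  shows "(\<integral>\<^sup>+x\<in>A. of_nat (edges_to (orbit_graphing T) x B) \<partial>unit_lebesgue) =
    emeasure unit_lebesgue {x \<in> A. T x \<in> B \<and> T x \<noteq> x} +
    emeasure unit_lebesgue {x \<in> A. S x \<in> B \<and> S x \<noteq> x \<and> S x \<noteq> T x}"
    (is "_ = emeasure _ ?P + emeasure _ ?Q")
proof -
  have AV: "A \<subseteq> {0..<1}" using sets.sets_into_space[OF A] by simp
  have "?P = {x \<in> A. T x \<in> B} \<inter> {x \<in> {0..<1}. T x \<noteq> x}"
    "?Q = {x \<in> A. S x \<in> B} \<inter> {x \<in> {0..<1}. S x \<noteq> x \<and> S x \<noteq> T x}" using AV by auto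
  then have PQ: "?P \<in> sets unit_lebesgue" "?Q \<in> sets unit_lebesgue"
    using sets.Int[OF sets_preimage_lebesgue[OF T_lebesgue(1) A B] sets_T_ne(1)]
      sets.Int[OF sets_preimage_lebesgue[OF S_lebesgue(1) A B] sets_T_ne(2)] by simp_all
  have "(\<integral>\<^sup>+x\<in>A. of_nat (edges_to (orbit_graphing T) x B) \<partial>unit_lebesgue) =
     (\<integral>\<^sup>+x. indicator ?P x + indicator ?Q x \<partial>unit_lebesgue)"
    by (intro nn_integral_cong) (auto simp: edges_to_eq indicator_def)
  also have "\<dots> = emeasure unit_lebesgue ?P + emeasure unit_lebesgue ?Q"
    using PQ by (subst nn_integral_add) (auto simp del: emeasure_completion)
  finally show ?thesis .
qed

lemma emeasure_preimage_T:
  assumes "A \<in> sets unit_lebesgue"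
  shows "emeasure unit_lebesgue {x \<in> {0..<1}. T x \<in> A} = emeasure unit_lebesgue A"
proof -
  have "T -` A \<inter> space unit_lebesgue = {x \<in> {0..<1}. T x \<in> A}" by auto
  then show ?thesis using emeasure_distr[OF T_lebesgue(1) assms] T_lebesgue(2) by simp
qed

lemma graphing_orbit_graphing: "graphing (orbit_graphing T)"
  unfolding graphing_def vspace_orbit_graphing
proof (intro conjI ballI)
  interpret I: borel_automorphism S T by (rule inverse_automorphism)
  show "standard_borel (vborel (orbit_graphing T))"
    using standard_borel_unit_borel by (simp add: orbit_graphing_def)
  show "standard_probability_space unit_lebesgue" by (rule standard_probability_space_unit_lebesgue)
  have "edges (orbit_graphing T) = {z \<in> space (unit_borel \<Otimes>\<^sub>M unit_borel).
      fst z \<noteq> snd z \<and> (snd z = T (fst z) \<or> fst z = T (snd z))}"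
    by (auto simp: orbit_graphing_def space_pair_measure)
  also have "\<dots> \<in> sets (unit_borel \<Otimes>\<^sub>M unit_borel)"
  proof -
    have [measurable]: "fst \<in> borel_measurable (unit_borel \<Otimes>\<^sub>M unit_borel)" "snd \<in> borel_measurable (unit_borel \<Otimes>\<^sub>M unit_borel)"
      "(\<lambda>z. T (fst z)) \<in> borel_measurable (unit_borel \<Otimes>\<^sub>M unit_borel)"
      "(\<lambda>z. T (snd z)) \<in> borel_measurable (unit_borel \<Otimes>\<^sub>M unit_borel)"
      using measurable_compose[OF measurable_fst measurable_id_unit_borel]
        measurable_compose[OF measurable_snd measurable_id_unit_borel]
        measurable_compose[OF measurable_fst measurable_T_borel]
        measurable_compose[OF measurable_snd measurable_T_borel] by auto
    show ?thesis by measurable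
  qed
  finally show "edges (orbit_graphing T) \<in> sets (vborel (orbit_graphing T) \<Otimes>\<^sub>M vborel (orbit_graphing T))"
    by (simp add: orbit_graphing_def)
  show "sym (edges (orbit_graphing T))" "irrefl (edges (orbit_graphing T))"
    by (auto simp: sym_def irrefl_def orbit_graphing_def)
  have "{y. (x, y) \<in> edges (orbit_graphing T)} \<subseteq> {T x, S x}" for x by (auto simp: mem_edges_iff)
  moreover have "card {T x, S x} \<le> 2" for x by (simp add: card_insert_if)
  ultimately have "finite {y. (x, y) \<in> edges (orbit_graphing T)} \<and> card {y. (x, y) \<in> edges (orbit_graphing T)} \<le> 2" for x
    by (meson card_mono finite.emptyI finite.insertI finite_subset le_trans)
  then show "\<exists>D. \<forall>x\<in>space unit_lebesgue. finite {y. (x, y) \<in> edges (orbit_graphing T)} \<and>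
      card {y. (x, y) \<in> edges (orbit_graphing T)} \<le> D" by blast
  fix A B assume A: "A \<in> sets unit_lebesgue" and B: "B \<in> sets unit_lebesgue"
  have V: "A \<subseteq> {0..<1}" "B \<subseteq> {0..<1}" using sets.sets_into_space[OF A] sets.sets_into_space[OF B] by simp_all
  let ?P = "{y \<in> B. S y \<in> A \<and> S y \<noteq> y}"
  let ?Q = "{y \<in> B. T y \<in> A \<and> T y \<noteq> y \<and> T y \<noteq> S y}"
  \<comment> \<open>an edge from \<open>x\<close> to \<open>T x\<close> is an edge from \<open>y = T x\<close> to \<open>S y\<close>, seen from its other end\<close>
  have P: "{x \<in> A. T x \<in> B \<and> T x \<noteq> x} = {x \<in> {0..<1}. T x \<in> ?P}"
  proof (rule Collect_cong)
    fix x
    show "x \<in> A \<and> T x \<in> B \<and> T x \<noteq> x \<longleftrightarrow> x \<in> {0..<1} \<and> T x \<in> ?P"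
      using V ST[of x] by (cases "x \<in> {0..<1}") auto
  qed
  have Q: "{x \<in> A. S x \<in> B \<and> S x \<noteq> x \<and> S x \<noteq> T x} = {x \<in> {0..<1}. S x \<in> ?Q}"
  proof (rule Collect_cong)
    fix x
    have "S x \<noteq> T x \<longleftrightarrow> x \<noteq> S (S x)" if "x \<in> {0..<1}"
      using that TS[of "S x"] ST[of x] TS[of x] S_in[of x] by metis
    then show "x \<in> A \<and> S x \<in> B \<and> S x \<noteq> x \<and> S x \<noteq> T x \<longleftrightarrow> x \<in> {0..<1} \<and> S x \<in> ?Q"
      using V TS[of x] by (cases "x \<in> {0..<1}") auto
  qed
  have "?P = {y \<in> B. S y \<in> A} \<inter> {x \<in> {0..<1}. S x \<noteq> x}"
    "?Q = {y \<in> B. T y \<in> A} \<inter> {x \<in> {0..<1}. T x \<noteq> x \<and> T x \<noteq> S x}" using V by auto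
  then have s: "?P \<in> sets unit_lebesgue" "?Q \<in> sets unit_lebesgue"
    using sets.Int[OF sets_preimage_lebesgue[OF T_lebesgue(1) B A] I.sets_T_ne(2)]
      sets.Int[OF sets_preimage_lebesgue[OF S_lebesgue(1) B A] I.sets_T_ne(1)] by simp_all
  have "(\<integral>\<^sup>+x\<in>A. of_nat (edges_to (orbit_graphing T) x B) \<partial>unit_lebesgue) =
      emeasure unit_lebesgue ?P + emeasure unit_lebesgue ?Q"
    unfolding nn_integral_edges_to[OF A B] P Q emeasure_preimage_T[OF s(1)] I.emeasure_preimage_T[OF s(2)] ..
  also have "\<dots> = (\<integral>\<^sup>+y\<in>B. of_nat (edges_to (orbit_graphing T) y A) \<partial>unit_lebesgue)"
    using I.nn_integral_edges_to[OF B A] unfolding orbit_graphing_inverse by simp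
  finally show "(\<integral>\<^sup>+x\<in>A. of_nat (edges_to (orbit_graphing T) x B) \<partial>unit_lebesgue) =
      (\<integral>\<^sup>+y\<in>B. of_nat (edges_to (orbit_graphing T) y A) \<partial>unit_lebesgue)" .
qed

end



section \<open>Automorphisms of the graphing\<close>

lemma eq_if_rational_comparisons_eq:
  fixes p q t s :: real
  assumes "\<And>r. r \<in> \<rat> \<Longrightarrow> of_bool (p < r) + of_bool (q < r) = (of_bool (t < r) + of_bool (s < r) :: nat)"
  shows "(p = t \<and> q = s) \<or> (p = s \<and> q = t)"
proof -
  have less_iff: "(min p q < r \<longleftrightarrow> min t s < r) \<and> (max p q < r \<longleftrightarrow> max t s < r)" if "r \<in> \<rat>" for r
    using assms[OF that] by (auto simp: of_bool_def min_less_iff_disj split: if_splits)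
  have eq: "u = v" if "\<And>r. r \<in> \<rat> \<Longrightarrow> u < r \<longleftrightarrow> v < r" for u v :: real
  proof (rule ccontr)
    assume "u \<noteq> v"
    then have "min u v < max u v" by (auto simp: min_def max_def)
    then obtain r where "r \<in> \<rat>" "min u v < r" "r < max u v"
      using Rats_dense_in_real by blast
    then show False using that[of r] by (auto simp: min_def max_def split: if_splits)
  qed
  have "min p q = min t s" "max p q = max t s" using less_iff by (auto intro!: eq)
  then show ?thesis by (auto simp: min_def max_def split: if_splits)
qed

text \<open>The measure \<open>A \<times> B \<mapsto> \<mu>(A \<inter> P\<inverse> B) + \<mu>(A \<inter> Q\<inverse> B)\<close> determines the unordered pair of
  \<open>P x\<close> and \<open>Q x\<close> for almost every \<open>x\<close>: for fixed \<open>B\<close> it determines the number of its entries in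
  \<open>B\<close>, and countably many rays \<open>B\<close> separate points.\<close>

lemma AE_eq_pair:
  assumes meas: "\<And>f. f \<in> {P, Q, T, S} \<Longrightarrow> f \<in> measurable unit_lebesgue unit_lebesgue"
    and eq: "\<And>A B. A \<in> sets unit_lebesgue \<Longrightarrow> B \<in> sets unit_lebesgue \<Longrightarrow>
      emeasure unit_lebesgue {x \<in> A. P x \<in> B} + emeasure unit_lebesgue {x \<in> A. Q x \<in> B} =
      emeasure unit_lebesgue {x \<in> A. T x \<in> B} + emeasure unit_lebesgue {x \<in> A. S x \<in> B}"
  shows "AE x in unit_lebesgue. (P x = T x \<and> Q x = S x) \<or> (P x = S x \<and> Q x = T x)"
proof -
  interpret prob_space unit_lebesgue by (rule prob_space_unit_lebesgue)
  have "AE x in unit_lebesgue. of_bool (P x < r) + of_bool (Q x < r) = (of_bool (T x < r) + of_bool (S x < r) :: nat)" for r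
  proof -
    define B where "B = {0..<1} \<inter> {..<r}"
    have "B \<in> sets unit_borel" unfolding B_def by (auto simp: sets_unit_borel_iff)
    then have B: "B \<in> sets unit_lebesgue" by (rule sets_completionI_sets)
    have pre: "{x \<in> A. f x \<in> B} \<in> sets unit_lebesgue" if "f \<in> {P, Q, T, S}" "A \<in> sets unit_lebesgue" for f A
      by (rule sets_preimage_lebesgue[OF meas[OF that(1)] that(2) B])
    define d where "d f = (\<lambda>x. indicator {x \<in> {0..<1}. f x \<in> B} x :: ennreal)" for f :: "real \<Rightarrow> real"
    have dm [measurable]: "d f \<in> borel_measurable unit_lebesgue" if "f \<in> {P, Q, T, S}" for f
      unfolding d_def using pre[OF that, of "{0..<1}"] sets.top[of unit_lebesgue]
      by (intro borel_measurable_indicator) simp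
    have ddens: "(\<integral>\<^sup>+x\<in>A. (d f x + d g x) \<partial>unit_lebesgue) =
        emeasure unit_lebesgue {x \<in> A. f x \<in> B} + emeasure unit_lebesgue {x \<in> A. g x \<in> B}"
      if "f \<in> {P, Q, T, S}" "g \<in> {P, Q, T, S}" "A \<in> sets unit_lebesgue" for f g A
    proof -
      have "A \<subseteq> {0..<1}" using sets.sets_into_space[OF that(3)] by simp
      then have "(\<integral>\<^sup>+x\<in>A. (d f x + d g x) \<partial>unit_lebesgue) =
          (\<integral>\<^sup>+x. indicator {x \<in> A. f x \<in> B} x + indicator {x \<in> A. g x \<in> B} x \<partial>unit_lebesgue)"
        by (intro nn_integral_cong) (auto simp: d_def indicator_def)
      also have "\<dots> = emeasure unit_lebesgue {x \<in> A. f x \<in> B} + emeasure unit_lebesgue {x \<in> A. g x \<in> B}"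
        using pre that by (subst nn_integral_add) (auto simp del: emeasure_completion)
      finally show ?thesis .
    qed
    have "density unit_lebesgue (\<lambda>x. d P x + d Q x) = density unit_lebesgue (\<lambda>x. d T x + d S x)"
    proof (rule measure_eqI)
      fix A assume "A \<in> sets (density unit_lebesgue (\<lambda>x. d P x + d Q x))"
      then have A: "A \<in> sets unit_lebesgue" by simp
      have "emeasure (density unit_lebesgue (\<lambda>x. d P x + d Q x)) A = (\<integral>\<^sup>+x\<in>A. (d P x + d Q x) \<partial>unit_lebesgue)"
        by (rule emeasure_density[OF _ A]) (auto intro!: dm borel_measurable_add)
      also have "\<dots> = (\<integral>\<^sup>+x\<in>A. (d T x + d S x) \<partial>unit_lebesgue)"
        using ddens[OF _ _ A] eq[OF A B] by simp
      also have "\<dots> = emeasure (density unit_lebesgue (\<lambda>x. d T x + d S x)) A"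
        by (rule emeasure_density[OF _ A, symmetric]) (auto intro!: dm borel_measurable_add)
      finally show "emeasure (density unit_lebesgue (\<lambda>x. d P x + d Q x)) A =
          emeasure (density unit_lebesgue (\<lambda>x. d T x + d S x)) A" .
    qed simp
    then have "AE x in unit_lebesgue. d P x + d Q x = d T x + d S x"
      by (intro density_unique) (auto intro!: dm borel_measurable_add)
    then show ?thesis using AE_space
    proof eventually_elim
      case (elim x)
      have V: "f x \<in> {0..<1}" if "f \<in> {P, Q, T, S}" for f
        using measurable_space[OF meas[OF that] elim(2)] by simp
      have "d f x = of_bool (f x < r)" if "f \<in> {P, Q, T, S}" for f
        using V[OF that] elim(2) by (simp add: d_def B_def indicator_def)
      then show ?case using elim(1) by (auto simp: of_bool_def split: if_splits)
    qed
  qed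
  then have "AE x in unit_lebesgue. \<forall>r\<in>\<rat>. of_bool (P x < r) + of_bool (Q x < r) = (of_bool (T x < r) + of_bool (S x < r) :: nat)"
    using countable_rat by (subst AE_ball_countable) auto
  then show ?thesis by eventually_elim (rule eq_if_rational_comparisons_eq, blast)
qed

lemma (in borel_automorphism) edge_measure_orbit_graphing:
  assumes ne: "AE x in unit_lebesgue. T x \<noteq> x \<and> S x \<noteq> x \<and> S x \<noteq> T x"
  defines "\<eta> \<equiv> edge_measure (orbit_graphing T)"
  shows "sets \<eta> = sets (unit_lebesgue \<Otimes>\<^sub>M unit_lebesgue)"
    and "\<And>A B. A \<in> sets unit_lebesgue \<Longrightarrow> B \<in> sets unit_lebesgue \<Longrightarrow>
      emeasure \<eta> (A \<times> B) = emeasure unit_lebesgue {x \<in> A. T x \<in> B} + emeasure unit_lebesgue {x \<in> A. S x \<in> B}"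
proof -
  interpret prob_space unit_lebesgue by (rule prob_space_unit_lebesgue)
  let ?N = "unit_lebesgue"
  let ?G = "\<lambda>f. distr ?N (?N \<Otimes>\<^sub>M ?N) (\<lambda>x. (x, f x))"
  have G: "emeasure (?G f) (A \<times> B) = emeasure ?N {x \<in> A. f x \<in> B}"
    if "f \<in> measurable ?N ?N" "A \<in> sets ?N" "B \<in> sets ?N" for f A B
  proof -
    have "(\<lambda>x. (x, f x)) -` (A \<times> B) \<inter> space ?N = {x \<in> A. f x \<in> B}"
      using sets.sets_into_space[OF that(2)] by auto
    then show ?thesis using that
      by (subst emeasure_distr) (auto intro!: measurable_Pair simp del: emeasure_completion)
  qed
  define \<eta>' where "\<eta>' = sum_measure (?G T) (?G S)"
  have sets: "sets \<eta>' = sets (?N \<Otimes>\<^sub>M ?N)" by (simp add: \<eta>'_def sets_sum_measure)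
  have em: "emeasure \<eta>' (A \<times> B) = emeasure ?N {x \<in> A. T x \<in> B} + emeasure ?N {x \<in> A. S x \<in> B}"
    if "A \<in> sets ?N" "B \<in> sets ?N" for A B
    using that G[OF T_lebesgue(1)] G[OF S_lebesgue(1)]
    unfolding \<eta>'_def by (subst emeasure_sum_measure) (auto simp del: emeasure_completion)
  have "edge_measure (orbit_graphing T) = \<eta>'"
  proof (rule edge_measure_eqI)
    show "prob_space (vspace (orbit_graphing T))" by (simp add: prob_space_unit_lebesgue)
    show "sets \<eta>' = sets (vspace (orbit_graphing T) \<Otimes>\<^sub>M vspace (orbit_graphing T))" by (simp add: sets)
    show "emeasure \<eta>' (space (vspace (orbit_graphing T)) \<times> space (vspace (orbit_graphing T))) \<noteq> \<infinity>"
      using em[OF sets.top sets.top] emeasure_finite by (simp del: emeasure_completion)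
    fix A B assume "A \<in> sets (vspace (orbit_graphing T))" "B \<in> sets (vspace (orbit_graphing T))"
    then have A: "A \<in> sets ?N" and B: "B \<in> sets ?N" by auto
    have AV: "A \<subseteq> {0..<1}" using sets.sets_into_space[OF A] by simp
    have "{x \<in> A. T x \<in> B \<and> T x \<noteq> x} = {x \<in> A. T x \<in> B} \<inter> {x \<in> {0..<1}. T x \<noteq> x}"
      "{x \<in> A. S x \<in> B \<and> S x \<noteq> x \<and> S x \<noteq> T x} =
       {x \<in> A. S x \<in> B} \<inter> {x \<in> {0..<1}. S x \<noteq> x \<and> S x \<noteq> T x}" using AV by auto
    then have s: "{x \<in> A. T x \<in> B \<and> T x \<noteq> x} \<in> sets ?N" "{x \<in> A. S x \<in> B \<and> S x \<noteq> x \<and> S x \<noteq> T x} \<in> sets ?N"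
      using sets.Int[OF sets_preimage_lebesgue[OF T_lebesgue(1) A B] sets_T_ne(1)]
        sets.Int[OF sets_preimage_lebesgue[OF S_lebesgue(1) A B] sets_T_ne(2)] by simp_all
    have "emeasure ?N {x \<in> A. T x \<in> B \<and> T x \<noteq> x} = emeasure ?N {x \<in> A. T x \<in> B}"
      by (rule emeasure_eq_AE[OF _ s(1) sets_preimage_lebesgue[OF T_lebesgue(1) A B]])
        (use ne in eventually_elim, auto)
    moreover have "emeasure ?N {x \<in> A. S x \<in> B \<and> S x \<noteq> x \<and> S x \<noteq> T x} = emeasure ?N {x \<in> A. S x \<in> B}"
      by (rule emeasure_eq_AE[OF _ s(2) sets_preimage_lebesgue[OF S_lebesgue(1) A B]])
        (use ne in eventually_elim, auto)
    ultimately show "emeasure \<eta>' (A \<times> B) =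
        (\<integral>\<^sup>+x\<in>A. of_nat (edges_to (orbit_graphing T) x B) \<partial>vspace (orbit_graphing T))"
      using em[OF A B] nn_integral_edges_to[OF A B] by (simp del: emeasure_completion)
  qed
  with sets em show "sets \<eta> = sets (?N \<Otimes>\<^sub>M ?N)"
    "\<And>A B. A \<in> sets ?N \<Longrightarrow> B \<in> sets ?N \<Longrightarrow>
      emeasure \<eta> (A \<times> B) = emeasure ?N {x \<in> A. T x \<in> B} + emeasure ?N {x \<in> A. S x \<in> B}"
    unfolding \<eta>_def by auto
qed

text \<open>A map preserves the edge measure iff it conjugates \<open>T\<close> to a transformation \<open>P\<close> that moves
  every point along an edge. The set on which \<open>P\<close> agrees with \<open>T\<close> is then forward
  invariant, because \<open>P\<close> and \<open>T\<close> are bijections, so that by ergodicity \<open>P = T\<close> or \<open>P = T\<inverse>\<close>.\<close>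

lemma (in borel_automorphism) preserves_edge_measure_iff:
  assumes ne: "AE x in unit_lebesgue. T x \<noteq> x \<and> S x \<noteq> x \<and> S x \<noteq> T x"
    and erg: "ae_ergodic unit_lebesgue T"
    and \<phi>: "\<phi> \<in> invertible_mpt unit_lebesgue"
  shows "distr (edge_measure (orbit_graphing T)) (unit_lebesgue \<Otimes>\<^sub>M unit_lebesgue) (map_prod \<phi> \<phi>) =
      edge_measure (orbit_graphing T) \<longleftrightarrow>
    (AE x in unit_lebesgue. \<phi> (T x) = T (\<phi> x)) \<or> (AE x in unit_lebesgue. \<phi> (T x) = S (\<phi> x))"
    (is "?preserves \<longleftrightarrow> _")
proof -
  let ?N = "unit_lebesgue" and ?\<eta> = "edge_measure (orbit_graphing T)"
  interpret prob_space ?N by (rule prob_space_unit_lebesgue)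
  note \<eta> = edge_measure_orbit_graphing[OF ne]
  note \<phi>m = invertible_mptD[OF \<phi>]
  have inV: "AE x in ?N. x \<in> {0..<1}" using AE_space[of ?N] by simp
  have pull: "AE x in ?N. R (\<phi> x)" if "AE x in ?N. R x" for R by (rule AE_invertible[OF \<phi> that])
  have pre: "{x \<in> {0..<1}. \<phi> x \<in> A} \<in> sets ?N" if "A \<in> sets ?N" for A
    using sets_preimage_lebesgue[OF \<phi>m(1) sets.top that] by simp
  have mapm: "map_prod \<phi> \<phi> \<in> measurable ?\<eta> (?N \<Otimes>\<^sub>M ?N)"
    unfolding measurable_cong_sets[OF \<eta>(1) refl] map_prod_def split_beta'
    using \<phi>m(1) by measurable
  have space_\<eta>: "space ?\<eta> = {0..<1} \<times> {0..<1}"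
    using sets_eq_imp_space_eq[OF \<eta>(1)] by (simp add: space_pair_measure)
  have em_distr: "emeasure (distr ?\<eta> (?N \<Otimes>\<^sub>M ?N) (map_prod \<phi> \<phi>)) (A \<times> B) =
      emeasure ?N {x \<in> {0..<1}. \<phi> x \<in> A \<and> \<phi> (T x) \<in> B} + emeasure ?N {x \<in> {0..<1}. \<phi> x \<in> A \<and> \<phi> (S x) \<in> B}"
    if A: "A \<in> sets ?N" and B: "B \<in> sets ?N" for A B
  proof -
    have "emeasure (distr ?\<eta> (?N \<Otimes>\<^sub>M ?N) (map_prod \<phi> \<phi>)) (A \<times> B) =
        emeasure ?\<eta> (map_prod \<phi> \<phi> -` (A \<times> B) \<inter> space ?\<eta>)"
      by (rule emeasure_distr[OF mapm]) (use A B in auto)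
    also have "map_prod \<phi> \<phi> -` (A \<times> B) \<inter> space ?\<eta> = {x \<in> {0..<1}. \<phi> x \<in> A} \<times> {x \<in> {0..<1}. \<phi> x \<in> B}"
      by (auto simp: space_\<eta>)
    also have "emeasure ?\<eta> \<dots> = emeasure ?N {x \<in> {x \<in> {0..<1}. \<phi> x \<in> A}. T x \<in> {x \<in> {0..<1}. \<phi> x \<in> B}} +
        emeasure ?N {x \<in> {x \<in> {0..<1}. \<phi> x \<in> A}. S x \<in> {x \<in> {0..<1}. \<phi> x \<in> B}}"
      by (rule \<eta>(2)[OF pre[OF A] pre[OF B]])
    also have "{x \<in> {x \<in> {0..<1}. \<phi> x \<in> A}. T x \<in> {x \<in> {0..<1}. \<phi> x \<in> B}} = {x \<in> {0..<1}. \<phi> x \<in> A \<and> \<phi> (T x) \<in> B}"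
      using T_in by auto
    also have "{x \<in> {x \<in> {0..<1}. \<phi> x \<in> A}. S x \<in> {x \<in> {0..<1}. \<phi> x \<in> B}} = {x \<in> {0..<1}. \<phi> x \<in> A \<and> \<phi> (S x) \<in> B}"
      using S_in by auto
    finally show ?thesis .
  qed
  \<comment> \<open>up to a null set, the left-hand set is the preimage under \<open>\<phi>\<close> of the right-hand one\<close>
  have outer: "emeasure ?N {x \<in> {0..<1}. \<phi> x \<in> A \<and> \<phi> (U x) \<in> B} = emeasure ?N {x \<in> A. U' x \<in> B}"
    if A: "A \<in> sets ?N" and B: "B \<in> sets ?N" and U: "U \<in> measurable ?N ?N" "U' \<in> measurable ?N ?N"
      and ae: "AE x in ?N. \<phi> (U x) = U' (\<phi> x)" for A B U U'
  proof -
    have s: "{x \<in> A. U' x \<in> B} \<in> sets ?N" by (rule sets_preimage_lebesgue[OF U(2) A B])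
    have "emeasure ?N {x \<in> {0..<1}. \<phi> x \<in> A \<and> \<phi> (U x) \<in> B} = emeasure ?N (\<phi> -` {x \<in> A. U' x \<in> B} \<inter> space ?N)"
    proof (rule emeasure_eq_AE)
      show "AE x in ?N. x \<in> {x \<in> {0..<1}. \<phi> x \<in> A \<and> \<phi> (U x) \<in> B} \<longleftrightarrow> x \<in> \<phi> -` {x \<in> A. U' x \<in> B} \<inter> space ?N"
        using ae by eventually_elim auto
      show "\<phi> -` {x \<in> A. U' x \<in> B} \<inter> space ?N \<in> sets ?N" by (rule measurable_sets[OF \<phi>m(1) s])
      have "{x \<in> {0..<1}. \<phi> x \<in> A \<and> \<phi> (U x) \<in> B} = {x \<in> {x \<in> {0..<1}. \<phi> x \<in> A}. (\<phi> \<circ> U) x \<in> B}" by auto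
      also have "\<dots> \<in> sets ?N"
        by (rule sets_preimage_lebesgue[OF measurable_comp[OF U(1) \<phi>m(1)] pre[OF A] B])
      finally show "{x \<in> {0..<1}. \<phi> x \<in> A \<and> \<phi> (U x) \<in> B} \<in> sets ?N" .
    qed
    also have "\<dots> = emeasure ?N {x \<in> A. U' x \<in> B}"
      using emeasure_distr[OF \<phi>m(1) s] \<phi>m(2) by simp
    finally show ?thesis .
  qed
  have iff: "?preserves \<longleftrightarrow> (\<forall>A\<in>sets ?N. \<forall>B\<in>sets ?N.
      emeasure ?N {x \<in> {0..<1}. \<phi> x \<in> A \<and> \<phi> (T x) \<in> B} + emeasure ?N {x \<in> {0..<1}. \<phi> x \<in> A \<and> \<phi> (S x) \<in> B} =
      emeasure ?N {x \<in> A. T x \<in> B} + emeasure ?N {x \<in> A. S x \<in> B})" (is "_ \<longleftrightarrow> (\<forall>A\<in>_. \<forall>B\<in>_. ?rect' A B)" is "_ \<longleftrightarrow> ?rect")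
  proof
    assume ?preserves
    show ?rect
    proof (intro ballI)
      fix A B assume "A \<in> sets ?N" "B \<in> sets ?N"
      from em_distr[OF this] \<eta>(2)[OF this] \<open>?preserves\<close> show "?rect' A B" by (simp only:)
    qed
  next
    assume ?rect
    show ?preserves
    proof (rule measure_rectangles_eqI)
      show "emeasure (distr ?\<eta> (?N \<Otimes>\<^sub>M ?N) (map_prod \<phi> \<phi>)) (space ?N \<times> space ?N) \<noteq> \<infinity>"
        unfolding em_distr[OF sets.top sets.top] using emeasure_finite by (simp del: emeasure_completion)
    qed (use \<open>?rect\<close> \<eta> em_distr in simp_all)
  qed
  show ?thesis
  proof
    assume "(AE x in ?N. \<phi> (T x) = T (\<phi> x)) \<or> (AE x in ?N. \<phi> (T x) = S (\<phi> x))"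
    then obtain U U' where U: "U = T \<and> U' = S \<or> U = S \<and> U' = T"
      and *: "AE x in ?N. \<phi> (T x) = U (\<phi> x)"
    proof
      assume "AE x in ?N. \<phi> (T x) = T (\<phi> x)"
      then show thesis by (intro that[of T S]) simp_all
    next
      assume "AE x in ?N. \<phi> (T x) = S (\<phi> x)"
      then show thesis by (intro that[of S T]) simp_all
    qed
    have "AE x in ?N. \<phi> (T (S x)) = U (\<phi> (S x))" by (rule AE_measure_preserving[OF S_lebesgue *])
    moreover have "AE x in ?N. \<phi> (S x) \<in> {0..<1}"
      by (rule AE_measure_preserving[OF S_lebesgue pull[OF inV]])
    ultimately have **: "AE x in ?N. \<phi> (S x) = U' (\<phi> x)"
      using inV
    proof eventually_elim
      case (elim x)
      have "U' (U y) = y" if "y \<in> {0..<1}" for y using U ST TS that by auto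
      from this[of "\<phi> (S x)"] elim show ?case by (simp only: TS)
    qed
    have m: "U \<in> measurable ?N ?N" "U' \<in> measurable ?N ?N" using U T_lebesgue(1) S_lebesgue(1) by auto
    show ?preserves
      unfolding iff
    proof (intro ballI)
      fix A B assume AB: "A \<in> sets ?N" "B \<in> sets ?N"
      show "?rect' A B"
        unfolding outer[OF AB T_lebesgue(1) m(1) *] outer[OF AB S_lebesgue(1) m(2) **]
        using U by (auto simp del: emeasure_completion simp: add.commute)
    qed
  next
    assume ?preserves
    obtain \<psi> where \<psi>: "\<psi> \<in> invertible_mpt ?N" "AE x in ?N. \<psi> (\<phi> x) = x" "AE x in ?N. \<phi> (\<psi> x) = x"
      using invertible_mptE[OF \<phi>] by blast
    note \<psi>m = invertible_mptD[OF \<psi>(1)]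
    \<comment> \<open>the conjugates of \<open>T\<close> and of its inverse\<close>
    define P where "P = \<phi> \<circ> T \<circ> \<psi>"
    define Q where "Q = \<phi> \<circ> S \<circ> \<psi>"
    have Pm: "P \<in> measurable ?N ?N" and Qm: "Q \<in> measurable ?N ?N"
      unfolding P_def Q_def using \<phi>m(1) \<psi>m(1) T_lebesgue(1) S_lebesgue(1) by (auto intro!: measurable_comp)
    have Pc: "AE x in ?N. \<phi> (T x) = P (\<phi> x)" and Qc: "AE x in ?N. \<phi> (S x) = Q (\<phi> x)"
      using \<psi>(2) by (eventually_elim; simp add: P_def Q_def)+
    have pair: "AE x in ?N. (P x = T x \<and> Q x = S x) \<or> (P x = S x \<and> Q x = T x)"
    proof (rule AE_eq_pair)
      show "f \<in> measurable ?N ?N" if "f \<in> {P, Q, T, S}" for f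
        using that Pm Qm T_lebesgue(1) S_lebesgue(1) by auto
      fix A B assume A: "A \<in> sets ?N" and B: "B \<in> sets ?N"
      have "?rect' A B" using \<open>?preserves\<close> A B unfolding iff by blast
      then show "emeasure ?N {x \<in> A. P x \<in> B} + emeasure ?N {x \<in> A. Q x \<in> B} =
          emeasure ?N {x \<in> A. T x \<in> B} + emeasure ?N {x \<in> A. S x \<in> B}"
        by (simp only: outer[OF A B T_lebesgue(1) Pm Pc] outer[OF A B S_lebesgue(1) Qm Qc])
    qed
    have QP: "AE x in ?N. Q (P x) = x"
    proof -
      have "AE x in ?N. Q (\<phi> (T (\<psi> x))) = \<phi> (S (T (\<psi> x)))"
        using AE_measure_preserving[OF \<psi>m AE_measure_preserving[OF T_lebesgue Qc]] by (auto elim: AE_mp)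
      then show ?thesis using \<psi>(3) AE_measure_preserving[OF \<psi>m inV]
        by eventually_elim (simp add: P_def ST)
    qed
    define A where "A = {x \<in> space ?N. P x = T x}"
    have fwd: "AE x in ?N. x \<in> A \<longrightarrow> T x \<in> A"
      using QP AE_measure_preserving[OF T_lebesgue pair] AE_measure_preserving[OF T_lebesgue inV] inV
      by eventually_elim (auto simp: A_def ST)
    have "(\<lambda>x. x) \<in> borel_measurable ?N" by (intro measurable_completion measurable_id_unit_borel)
    then have "P \<in> borel_measurable ?N" "T \<in> borel_measurable ?N"
      using measurable_compose[OF Pm] measurable_compose[OF T_lebesgue(1)] by blast+
    then have A: "A \<in> sets ?N" unfolding A_def by (rule borel_measurable_eq)
    have "prob A = 0 \<or> prob A = 1"
      by (rule ae_ergodic_forward_invariant[OF T_lebesgue erg A fwd])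
    then show "(AE x in ?N. \<phi> (T x) = T (\<phi> x)) \<or> (AE x in ?N. \<phi> (T x) = S (\<phi> x))"
    proof
      assume "prob A = 1"
      then have "AE x in ?N. x \<in> A" using A by (simp add: prob_eq_1)
      from pull[OF this] have "AE x in ?N. \<phi> (T x) = T (\<phi> x)"
        using Pc by eventually_elim (auto simp: A_def)
      then show ?thesis ..
    next
      assume "prob A = 0"
      then have "AE x in ?N. x \<notin> A" using A by (simp add: prob_eq_0)
      then have "AE x in ?N. P x = S x" using pair AE_space by eventually_elim (auto simp: A_def)
      from pull[OF this] have "AE x in ?N. \<phi> (T x) = S (\<phi> x)" using Pc by eventually_elim simp
      then show ?thesis ..
    qed
  qed
qed

lemma (in borel_automorphism) Aut_graphing_orbit_graphing:
  assumes ne: "AE x in unit_lebesgue. T x \<noteq> x \<and> S x \<noteq> x \<and> S x \<noteq> T x"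
    and erg: "ae_ergodic unit_lebesgue T"
  shows "Aut_graphing (orbit_graphing T) = reversing_symmetry_group unit_lebesgue T"
proof -
  interpret I: borel_automorphism S T by (rule inverse_automorphism)
  let ?N = "unit_lebesgue"
  let ?rel = "\<lambda>\<phi>. (AE x in ?N. \<phi> (T x) = T (\<phi> x)) \<or> (AE x in ?N. \<phi> (T x) = S (\<phi> x))"
  have rel_cong: "?rel R" if R: "AE x in ?N. \<phi> x = R x" and "?rel \<phi>" for \<phi> R
  proof -
    have RT: "AE x in ?N. \<phi> (T x) = R (T x)" by (rule AE_measure_preserving[OF T_lebesgue R])
    have "AE x in ?N. R (T x) = U (R x)" if "AE x in ?N. \<phi> (T x) = U (\<phi> x)" for U
      using that R RT by eventually_elim simp
    then show ?thesis using \<open>?rel \<phi>\<close> by blast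
  qed
  have "{c \<in> carrier (Aut_space ?N). \<forall>\<phi>\<in>c.
      distr (edge_measure (orbit_graphing T)) (?N \<Otimes>\<^sub>M ?N) (map_prod \<phi> \<phi>) = edge_measure (orbit_graphing T)} =
      ae_class ?N ` {R \<in> invertible_mpt ?N. ?rel R}"
  proof -
    have "(\<forall>\<phi>\<in>ae_class ?N R. distr (edge_measure (orbit_graphing T)) (?N \<Otimes>\<^sub>M ?N) (map_prod \<phi> \<phi>) =
        edge_measure (orbit_graphing T)) \<longleftrightarrow> ?rel R" if R: "R \<in> invertible_mpt ?N" for R
    proof -
      have "(\<forall>\<phi>\<in>ae_class ?N R. ?rel \<phi>) \<longleftrightarrow> ?rel R"
      proof
        assume "\<forall>\<phi>\<in>ae_class ?N R. ?rel \<phi>"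
        moreover have "R \<in> ae_class ?N R" using R by (simp add: ae_class_def)
        ultimately show "?rel R" by blast
      next
        assume "?rel R"
        show "\<forall>\<phi>\<in>ae_class ?N R. ?rel \<phi>"
        proof
          fix \<phi> assume "\<phi> \<in> ae_class ?N R"
          then have "AE x in ?N. R x = \<phi> x" by (auto simp: ae_class_def elim: AE_mp)
          then show "?rel \<phi>" using \<open>?rel R\<close> by (rule rel_cong)
        qed
      qed
      then show ?thesis
        using preserves_edge_measure_iff[OF ne erg] by (auto simp: ae_class_def)
    qed
    then show ?thesis unfolding carrier_Aut_space by blast
  qed
  moreover have "AE x in ?N. S (T x) = x" using AE_space[of ?N] by eventually_elim (simp add: ST)
  ultimately show ?thesis
    unfolding Aut_graphing_def vspace_orbit_graphing
    using reversing_symmetry_group_eq[OF T_invertible I.T_invertible] by simp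
qed



section \<open>Sweeping sets and the Rokhlin lemma\<close>

context borel_automorphism
begin

lemma funpow_T_in: "x \<in> {0..<1} \<Longrightarrow> (T ^^ n) x \<in> {0..<1}"
  by (induction n) (use T_in in auto)

lemma funpow_S_in: "x \<in> {0..<1} \<Longrightarrow> (S ^^ n) x \<in> {0..<1}"
  by (induction n) (use S_in in auto)

lemma funpow_ST: "x \<in> {0..<1} \<Longrightarrow> m \<le> n \<Longrightarrow> (S ^^ m) ((T ^^ n) x) = (T ^^ (n - m)) x"
proof (induction m)
  case (Suc m)
  then have "n - m = Suc (n - Suc m)" by simp
  then have "(T ^^ (n - m)) x = T ((T ^^ (n - Suc m)) x)" by simp
  with Suc show ?case using ST[OF funpow_T_in] by simp
qed simp

lemma funpow_TS: "x \<in> {0..<1} \<Longrightarrow> m \<le> n \<Longrightarrow> (T ^^ m) ((S ^^ n) x) = (S ^^ (n - m)) x"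
proof (induction m)
  case (Suc m)
  then have "n - m = Suc (n - Suc m)" by simp
  then have "(S ^^ (n - m)) x = S ((S ^^ (n - Suc m)) x)" by simp
  with Suc show ?case using TS[OF funpow_S_in] by simp
qed simp

lemma measurable_funpow [measurable]:
  "(T ^^ n) \<in> measurable unit_borel unit_borel" "(S ^^ n) \<in> measurable unit_borel unit_borel"
  using funpow_measure_preserving[OF T_measurable distr_T] funpow_measure_preserving[OF S_measurable distr_S] by auto

lemma measure_funpow_vimage:
  assumes "A \<in> sets unit_borel"
  shows "measure unit_borel {x \<in> {0..<1}. (T ^^ n) x \<in> A} = measure unit_borel A"
    and "measure unit_borel {x \<in> {0..<1}. (S ^^ n) x \<in> A} = measure unit_borel A"
proof -
  have "(f -` A \<inter> space unit_borel) = {x \<in> {0..<1}. f x \<in> A}" for f by auto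
  then show "measure unit_borel {x \<in> {0..<1}. (T ^^ n) x \<in> A} = measure unit_borel A"
    "measure unit_borel {x \<in> {0..<1}. (S ^^ n) x \<in> A} = measure unit_borel A"
    using measure_vimage[OF funpow_measure_preserving[OF T_measurable distr_T] assms]
      measure_vimage[OF funpow_measure_preserving[OF S_measurable distr_S] assms] by auto
qed

end

text \<open>Ergodic transformations and irrational rotations share the following property, and it implies
  both aperiodicity and the Rokhlin lemma.\<close>

locale sweeping_automorphism = borel_automorphism +
  assumes sweeping: "\<And>c. c > 0 \<Longrightarrow> \<exists>C\<in>sets unit_borel. measure unit_borel C < c \<and>
    (AE x in unit_borel. \<exists>k. (S ^^ k) x \<in> C)"
begin

text \<open>A point of period \<open>n\<close> has to meet a sweeping set \<open>C\<close> within \<open>n\<close> steps, so these points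
  have measure at most \<open>n\<close> times that of \<open>C\<close>.\<close>

lemma aperiodic: "AE x in unit_borel. \<forall>n>0. (T ^^ n) x \<noteq> x"
proof -
  interpret prob_space unit_borel by (rule prob_space_unit_borel)
  have "AE x in unit_borel. n > 0 \<longrightarrow> (T ^^ n) x \<noteq> x" for n
  proof (cases "n = 0")
    case False
    define P where "P = {x \<in> space unit_borel. (T ^^ n) x = x}"
    have "(T ^^ n) \<in> borel_measurable unit_borel" by (rule measurable_unit_borelD) measurable
    then have P: "P \<in> sets unit_borel" unfolding P_def using measurable_id_unit_borel by (rule borel_measurable_eq)
    have bound: "prob P \<le> real n * c" if c: "c > 0" for c
    proof -
      obtain C where C: "C \<in> sets unit_borel" "prob C < c" "AE x in unit_borel. \<exists>k. (S ^^ k) x \<in> C"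
        using sweeping[OF c] by blast
      let ?U = "\<lambda>k. {x \<in> {0..<1}. (S ^^ k) x \<in> C}"
      have U: "?U k \<in> sets unit_borel" for k
        by (rule sets_unit_borel_preimage[OF measurable_funpow(2) C(1)])
      have "x \<in> (\<Union>k<n. ?U k)" if "x \<in> P" "(S ^^ k) x \<in> C" for x k
      proof -
        have x: "x \<in> {0..<1}" "(T ^^ n) x = x" using that(1) by (auto simp: P_def)
        have "(S ^^ n) x = x" using funpow_ST[OF x(1), of n n] x(2) by simp
        then have "(S ^^ (k mod n)) x = (S ^^ k) x" by (rule funpow_mod_eq)
        then show ?thesis using that(2) x(1) False by (intro UN_I[of "k mod n"]) auto
      qed
      then have "AE x in unit_borel. x \<in> P \<longrightarrow> x \<in> (\<Union>k<n. ?U k)" using C(3) by (auto elim: AE_mp)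
      then have "prob P \<le> prob (\<Union>k<n. ?U k)" using U by (intro finite_measure_mono_AE) auto
      also have "\<dots> \<le> (\<Sum>k<n. prob (?U k))" using U by (intro finite_measure_subadditive_finite) auto
      also have "\<dots> = real n * prob C" by (simp add: measure_funpow_vimage(2)[OF C(1)] del: atLeastLessThan_iff)
      also have "\<dots> \<le> real n * c" using C(2) by (intro mult_left_mono) auto
      finally show ?thesis .
    qed
    have "prob P = 0"
    proof (rule ccontr)
      assume "prob P \<noteq> 0"
      then have "prob P > 0" using measure_nonneg[of unit_borel P] by linarith
      then show False using bound[of "prob P / (2 * real n)"] False by (simp add: field_simps)
    qed
    then have "AE x in unit_borel. x \<notin> P" using P by (simp add: prob_eq_0)
    then show ?thesis using AE_space by eventually_elim (simp add: P_def)
  qed simp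
  then show ?thesis by (simp add: AE_all_countable)
qed

lemma AE_neighbours_distinct: "AE x in unit_lebesgue. T x \<noteq> x \<and> S x \<noteq> x \<and> S x \<noteq> T x"
  unfolding AE_completion_iff using aperiodic AE_space
proof eventually_elim
  case (elim x)
  have "T x \<noteq> x" "T (T x) \<noteq> x" using elim(1)[rule_format, of 1] elim(1)[rule_format, of 2]
    by (simp_all add: numeral_2_eq_2)
  with elim(2) show ?case using TS[of x] by auto
qed

text \<open>Cut each orbit at its visits to a sweeping set \<open>C\<close> of measure below \<open>\<delta> / N\<close> and
  divide the pieces into blocks of length \<open>N\<close>, beginning at each visit; \<open>B\<close> consists of the first points of the
  complete blocks. A point outside of all blocks enters \<open>C\<close> within \<open>N\<close> steps.\<close>

lemma rokhlin_tower:
  assumes N: "N > 0" and \<delta>: "\<delta> > 0"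
  obtains B where "B \<in> sets unit_borel"
    "\<And>x i j. x \<in> {0..<1} \<Longrightarrow> i < N \<Longrightarrow> j < N \<Longrightarrow> (S ^^ i) x \<in> B \<Longrightarrow> (S ^^ j) x \<in> B \<Longrightarrow> i = j"
    "real N * measure unit_borel B \<ge> 1 - \<delta>"
proof -
  interpret prob_space unit_borel by (rule prob_space_unit_borel)
  obtain C where C [measurable]: "C \<in> sets unit_borel" and C_small: "prob C < \<delta> / real N"
    and C_sweep: "AE x in unit_borel. \<exists>k. (S ^^ k) x \<in> C"
    using sweeping[of "\<delta> / real N"] N \<delta> by auto
  \<comment> \<open>the time since the last visit to \<open>C\<close>\<close>
  define r where "r x = (LEAST k. (S ^^ k) x \<in> C)" for x
  have [measurable]: "r \<in> measurable unit_borel (count_space UNIV)"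
    unfolding r_def by measurable
  define B where "B = {x \<in> space unit_borel. (\<exists>k. (S ^^ k) x \<in> C) \<and> N dvd r x \<and> (\<forall>i\<in>{1..<N}. (T ^^ i) x \<notin> C)}"
  have B: "B \<in> sets unit_borel" unfolding B_def by measurable
  have r_mod: "r x mod N = i" if x: "x \<in> {0..<1}" and i: "i < N" and b: "(S ^^ i) x \<in> B" for x i
  proof -
    have ex: "\<exists>k. (S ^^ k) ((S ^^ i) x) \<in> C" using b by (simp add: B_def)
    have "r x = i + r ((S ^^ i) x)"
      unfolding r_def[of x]
    proof (rule Least_equality)
      have "(S ^^ r ((S ^^ i) x)) ((S ^^ i) x) \<in> C" unfolding r_def using ex by (rule LeastI_ex)
      then show "(S ^^ (i + r ((S ^^ i) x))) x \<in> C"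
        by (simp add: add.commute[of i] funpow_add)
    next
      fix k assume k: "(S ^^ k) x \<in> C"
      show "i + r ((S ^^ i) x) \<le> k"
      proof (cases "k < i")
        case True
        have "(T ^^ (i - k)) ((S ^^ i) x) = (S ^^ k) x" using funpow_TS[OF x, of "i - k" i] True by simp
        moreover have "(T ^^ (i - k)) ((S ^^ i) x) \<notin> C"
          using b True i unfolding B_def by (auto dest!: bspec[where x = "i - k"])
        ultimately show ?thesis using k by simp
      next
        case False
        then have "(S ^^ (k - i)) ((S ^^ i) x) = (S ^^ k) x" by (metis add_diff_inverse_nat add.commute funpow_add comp_apply)
        then have "r ((S ^^ i) x) \<le> k - i" unfolding r_def using k by (intro Least_le) simp
        then show ?thesis using False by simp
      qed
    qed
    moreover have "N dvd r ((S ^^ i) x)" using b by (simp add: B_def)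
    ultimately show ?thesis using i by auto
  qed
  let ?L = "\<lambda>i. {x \<in> {0..<1}. (S ^^ i) x \<in> B}" and ?E = "\<lambda>k. {x \<in> {0..<1}. (T ^^ k) x \<in> C}"
  have LE: "?L i \<in> sets unit_borel" "?E i \<in> sets unit_borel" for i
    by (rule sets_unit_borel_preimage[OF measurable_funpow(2) B]
      sets_unit_borel_preimage[OF measurable_funpow(1) C])+
  have cover: "x \<in> (\<Union>i<N. ?L i) \<union> (\<Union>k\<in>{1..<N}. ?E k)" if x: "x \<in> {0..<1}" and ex: "\<exists>k. (S ^^ k) x \<in> C" for x
  proof (cases "\<exists>k\<in>{1..<N}. (T ^^ k) x \<in> C")
    case True then show ?thesis using x by auto
  next
    case False
    define i where "i = r x mod N"
    define b where "b = (S ^^ i) x"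
    have i: "i < N" "i \<le> r x" unfolding i_def using N by auto
    have rC: "(S ^^ r x) x \<in> C" unfolding r_def using ex by (rule LeastI_ex)
    have before: "(S ^^ k) x \<notin> C" if "k < r x" for k using not_less_Least[of k] that unfolding r_def by blast
    have shift: "(S ^^ k) b = (S ^^ (k + i)) x" for k by (simp add: b_def funpow_add)
    have "r b = r x - i" unfolding r_def[of b]
    proof (rule Least_equality)
      show "(S ^^ (r x - i)) b \<in> C" using rC i by (simp add: shift)
      show "r x - i \<le> k" if "(S ^^ k) b \<in> C" for k
        using that before[of "k + i"] by (force simp: shift)
    qed
    then have "N dvd r b" unfolding i_def by (simp add: minus_mod_eq_mult_div)
    moreover have "(T ^^ j) b \<notin> C" if "j \<in> {1..<N}" for j
    proof (cases "j \<le> i")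
      case True
      then have "(T ^^ j) b = (S ^^ (i - j)) x" unfolding b_def by (rule funpow_TS[OF x])
      then show ?thesis using before[of "i - j"] that i True by auto
    next
      case f: False
      have "(T ^^ i) b = x" unfolding b_def using funpow_TS[OF x, of i i] by simp
      moreover obtain d where d: "j = d + i" "d > 0" using f less_imp_add_positive[of i j] by (auto simp: add.commute)
      ultimately have "(T ^^ j) b = (T ^^ d) x" by (simp add: funpow_add)
      then show ?thesis using False that d by auto
    qed
    moreover have "\<exists>k. (S ^^ k) b \<in> C" using rC i by (intro exI[of _ "r x - i"]) (simp add: shift)
    ultimately have "b \<in> B" using funpow_S_in[OF x, of i] by (simp add: B_def b_def)
    then show ?thesis using x i unfolding b_def by auto
  qed
  have AE_cover: "AE x in unit_borel. x \<in> space unit_borel \<longrightarrow> x \<in> (\<Union>i<N. ?L i) \<union> (\<Union>k\<in>{1..<N}. ?E k)"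
    using C_sweep AE_space[of unit_borel] by eventually_elim (use cover in simp)
  have "1 = prob (space unit_borel)" by (simp only: prob_space)
  also have "\<dots> \<le> prob ((\<Union>i<N. ?L i) \<union> (\<Union>k\<in>{1..<N}. ?E k))"
    using LE AE_cover by (intro finite_measure_mono_AE) auto
  also have "\<dots> \<le> prob (\<Union>i<N. ?L i) + prob (\<Union>k\<in>{1..<N}. ?E k)"
    using LE by (intro measure_Un_le) auto
  also have "prob (\<Union>i<N. ?L i) \<le> (\<Sum>i<N. prob (?L i))"
    using LE by (intro finite_measure_subadditive_finite) auto
  also have "prob (\<Union>k\<in>{1..<N}. ?E k) \<le> (\<Sum>k\<in>{1..<N}. prob (?E k))"
    using LE by (intro finite_measure_subadditive_finite) auto
  also have "(\<Sum>i<N. prob (?L i)) = real N * prob B" by (simp add: measure_funpow_vimage(2)[OF B] del: atLeastLessThan_iff)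
  also have "(\<Sum>k\<in>{1..<N}. prob (?E k)) = real (N - 1) * prob C" by (simp add: measure_funpow_vimage(1)[OF C] del: atLeastLessThan_iff)
  also have "real (N - 1) * prob C \<le> real N * (\<delta> / real N)"
    using C_small by (intro mult_mono) auto
  finally have "real N * prob B \<ge> 1 - \<delta>" using N by simp
  moreover have "i = j" if "x \<in> {0..<1}" "i < N" "j < N" "(S ^^ i) x \<in> B" "(S ^^ j) x \<in> B" for x i j
    using r_mod[OF that(1,2,4)] r_mod[OF that(1,3,5)] by simp
  ultimately show thesis using B by (intro that)
qed

end

text \<open>The points whose past meets a given short interval form a forward invariant set of
  positive measure.\<close>

lemma (in borel_automorphism) ergodic_imp_sweeping:
  assumes erg: "ae_ergodic unit_lebesgue T"
  shows "sweeping_automorphism T S"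
proof
  fix c :: real assume "c > 0"
  define d where "d = min (c / 2) (1 / 2)"
  have d: "d > 0" "d < 1" "d < c" using \<open>c > 0\<close> by (auto simp: d_def)
  define C where "C = {0..<d}"
  have C [measurable]: "C \<in> sets unit_borel" using d by (auto simp: sets_unit_borel_iff C_def)
  have mC: "measure unit_borel C = d" using d C by (simp add: measure_unit_borel C_def)
  define A where "A = {x \<in> space unit_borel. \<exists>k. (S ^^ k) x \<in> C}"
  have A: "A \<in> sets unit_borel" unfolding A_def by measurable
  interpret L: prob_space unit_lebesgue by (rule prob_space_unit_lebesgue)
  have "T x \<in> A" if x: "x \<in> A" for x
  proof -
    obtain k where k: "x \<in> {0..<1}" "(S ^^ k) x \<in> C" using x by (auto simp: A_def)
    have "(S ^^ Suc k) (T x) = (S ^^ k) x" using ST[OF k(1)] by (simp add: funpow_swap1)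
    then have "\<exists>k. (S ^^ k) (T x) \<in> C" using k(2) by (intro exI[of _ "Suc k"]) simp
    then show ?thesis using T_in[OF k(1)] by (simp add: A_def)
  qed
  then have "L.prob A = 0 \<or> L.prob A = 1"
    using A by (intro L.ae_ergodic_forward_invariant[OF T_lebesgue erg]) auto
  moreover have "L.prob C \<le> L.prob A"
  proof (rule L.finite_measure_mono)
    show "C \<subseteq> A"
    proof
      fix x assume "x \<in> C"
      then show "x \<in> A" using d by (auto simp: A_def C_def intro!: exI[of _ 0])
    qed
  qed (use A in auto)
  ultimately have "L.prob A = 1" using mC d C by simp
  then have "AE x in unit_lebesgue. x \<in> A" using L.prob_eq_1[OF sets_completionI_sets[OF A]] by blast
  then have "AE x in unit_borel. \<exists>k. (S ^^ k) x \<in> C"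
    unfolding AE_completion_iff by eventually_elim (simp add: A_def)
  then show "\<exists>C\<in>sets unit_borel. measure unit_borel C < c \<and> (AE x in unit_borel. \<exists>k. (S ^^ k) x \<in> C)"
    using C mC d by auto
qed



section \<open>Piecewise translations and irrational rotations\<close>

text \<open>The interval is cut into countably many pieces on each of which \<open>\<phi>\<close> is a translation, and the
  images of the pieces are again disjoint.\<close>

lemma distr_piecewise_translation:
  assumes \<phi>: "\<phi> \<in> measurable unit_borel unit_borel" and \<psi>: "\<psi> \<in> measurable unit_borel unit_borel"
    and inv: "\<And>x. x \<in> {0..<1} \<Longrightarrow> \<psi> (\<phi> x) = x" "\<And>x. x \<in> {0..<1} \<Longrightarrow> \<phi> (\<psi> x) = x"
    and D: "countable D" "\<And>x. x \<in> {0..<1} \<Longrightarrow> \<phi> x - x \<in> D"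
  shows "distr unit_borel unit_borel \<phi> = unit_borel"
proof (rule measure_eqI)
  fix A assume "A \<in> sets (distr unit_borel unit_borel \<phi>)"
  then have A [measurable]: "A \<in> sets unit_borel" by simp
  have V: "\<phi> x \<in> {0..<1}" "\<psi> x \<in> {0..<1}" if "x \<in> {0..<1}" for x
    using measurable_space[OF \<phi>, of x] measurable_space[OF \<psi>, of x] that by auto
  have AV: "A \<subseteq> {0..<1}" using A by (simp add: sets_unit_borel_iff)
  note id_m = measurable_id_unit_borel
  define P where "P d = {x \<in> {0..<1}. \<phi> x \<in> A \<and> \<phi> x - x = d}" for d
  define Q where "Q d = {y \<in> A. y - \<psi> y = d}" for d
  have P: "P d \<in> sets unit_borel" for d
  proof -
    have "P d = (\<phi> -` A \<inter> space unit_borel) \<inter> {x \<in> space unit_borel. \<phi> x - x = d}" by (auto simp: P_def)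
    also have "\<dots> \<in> sets unit_borel"
      by (rule sets.Int[OF measurable_sets[OF \<phi> A] borel_measurable_eq])
        (use measurable_unit_borelD[OF \<phi>] id_m in \<open>auto intro!: borel_measurable_diff\<close>)
    finally show ?thesis .
  qed
  have Q: "Q d \<in> sets unit_borel" for d
  proof -
    have "Q d = A \<inter> {x \<in> space unit_borel. x - \<psi> x = d}" using AV by (auto simp: Q_def)
    also have "\<dots> \<in> sets unit_borel"
      by (rule sets.Int[OF A borel_measurable_eq])
        (use measurable_unit_borelD[OF \<psi>] id_m in \<open>auto intro!: borel_measurable_diff\<close>)
    finally show ?thesis .
  qed
  have PQ: "emeasure unit_borel (P d) = emeasure unit_borel (Q d)" for d
  proof -
    have "P d = (+) d -` Q d"
    proof (intro equalityI subsetI)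
      fix x assume x: "x \<in> P d"
      then have "d + x = \<phi> x" "\<psi> (\<phi> x) = x" using inv by (auto simp: P_def)
      then show "x \<in> (+) d -` Q d" using x by (simp add: P_def Q_def)
    next
      fix x assume x: "x \<in> (+) d -` Q d"
      then have "d + x \<in> {0..<1}" "x = \<psi> (d + x)" using AV by (auto simp: Q_def)
      then have "x \<in> {0..<1}" "\<phi> x = d + x" using V inv by metis+
      then show "x \<in> P d" using x by (simp add: P_def Q_def)
    qed
    then have "emeasure lborel (P d) = emeasure (distr lborel borel ((+) d)) (Q d)"
      using Q[of d] by (subst emeasure_distr) (auto simp: sets_unit_borel_iff)
    then show ?thesis using P[of d] Q[of d] by (simp add: emeasure_unit_borel lborel_distr_plus)
  qed
  have "\<phi> -` A \<inter> space unit_borel = \<Union>(P ` D)" using D(2) by (auto simp: P_def)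
  moreover have "A = \<Union>(Q ` D)"
  proof -
    have "y - \<psi> y \<in> D" if "y \<in> A" for y
      using D(2)[of "\<psi> y"] inv(2)[of y] V(2)[of y] AV that by auto
    then show ?thesis by (auto simp: Q_def)
  qed
  moreover have "emeasure unit_borel (\<Union>(P ` D)) = (\<integral>\<^sup>+d. emeasure unit_borel (P d) \<partial>count_space D)"
    using P D(1) by (intro emeasure_UN_countable) (auto simp: disjoint_family_on_def P_def)
  moreover have "emeasure unit_borel (\<Union>(Q ` D)) = (\<integral>\<^sup>+d. emeasure unit_borel (Q d) \<partial>count_space D)"
    using Q D(1) by (intro emeasure_UN_countable) (auto simp: disjoint_family_on_def Q_def)
  ultimately show "emeasure (distr unit_borel unit_borel \<phi>) A = emeasure unit_borel A"
    using \<phi> A PQ by (simp add: emeasure_distr)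
qed simp

lemma frac_rotation:
  fixes a x y :: real
  assumes "y \<in> {0..<1}"
  shows "y = frac (x + a) \<longleftrightarrow> x + a - y \<in> \<int>"
  using assms frac_unique_iff[of "x + a" y] by auto

text \<open>By Kronecker's theorem some multiple of \<open>a\<close> lies just below \<open>x\<close> modulo \<open>1\<close>, so that the backward
  orbit of \<open>x\<close> enters any given interval \<open>[0, d)\<close>.\<close>

lemma sweeping_rotation:
  assumes a: "a \<notin> \<rat>"
  shows "sweeping_automorphism (\<lambda>x. frac (x + a)) (\<lambda>x. frac (x - a))" (is "sweeping_automorphism ?T ?S")
proof -
  have meas: "(\<lambda>x. frac (x + b)) \<in> measurable unit_borel unit_borel" for b :: real
  proof (rule measurable_unit_borelI)
    have "(\<lambda>x::real. frac (x + b)) \<in> borel_measurable borel" unfolding frac_def by measurable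
    then show "(\<lambda>x. frac (x + b)) \<in> borel_measurable unit_borel" by (intro measurable_restrict_space1) simp
  qed (simp add: frac_lt_1)
  have inv: "frac (frac (x + b) - b) = x" if "x \<in> {0..<1}" for x b :: real
  proof -
    have "frac (x + b) - b - x = - of_int \<lfloor>x + b\<rfloor>" by (simp add: frac_def)
    then have "frac (x + b) - b - x \<in> \<int>" by (metis Ints_minus Ints_of_int)
    then show ?thesis using that by (subst frac_unique_iff) auto
  qed
  have ST: "?S (?T x) = x" "?T (?S x) = x" if "x \<in> {0..<1}" for x
    using inv[OF that, of a] inv[OF that, of "- a"] by simp_all
  have "distr unit_borel unit_borel ?T = unit_borel"
  proof (rule distr_piecewise_translation[where \<psi> = ?S and D = "range (\<lambda>n::int. a - of_int n)"])
    show "?T \<in> measurable unit_borel unit_borel" "?S \<in> measurable unit_borel unit_borel"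
      using meas[of a] meas[of "- a"] by simp_all
    show "frac (x + a) - x \<in> range (\<lambda>n::int. a - of_int n)" for x :: real
      by (auto simp: frac_def)
  qed (use ST in auto)
  then interpret borel_automorphism ?T ?S
    using meas[of a] meas[of "- a"] ST by unfold_locales auto
  show ?thesis
  proof
    fix c :: real assume "c > 0"
    define d where "d = min (c / 2) (1 / 2)"
    have d: "d > 0" "d < 1" "d < c" using \<open>c > 0\<close> by (auto simp: d_def)
    define C where "C = {0..<d}"
    have C: "C \<in> sets unit_borel" using d by (auto simp: sets_unit_borel_iff C_def)
    have mC: "measure unit_borel C = d" using d C by (simp add: measure_unit_borel C_def)
    have iter: "(?S ^^ k) x - (x - real k * a) \<in> \<int>" for k x
    proof (induction k)
      case (Suc k)
      have "(?S ^^ Suc k) x - (x - real (Suc k) * a) =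
          ((?S ^^ k) x - (x - real k * a)) - of_int \<lfloor>(?S ^^ k) x - a\<rfloor>"
        by (simp add: frac_def algebra_simps)
      then show ?case using Suc by (metis Ints_diff Ints_of_int)
    qed simp
    have "\<exists>k. (?S ^^ k) x \<in> C" if x: "x \<in> {0..<1}" for x
    proof (cases "x = 0")
      case True
      then show ?thesis using d by (intro exI[of _ 0]) (auto simp: C_def)
    next
      case False
      define e where "e = min d x / 2"
      have e: "e > 0" "2 * e \<le> d" "2 * e \<le> x" using x False d by (auto simp: e_def)
      obtain k where k: "\<bar>frac (real k * a) - (x - e)\<bar> < e"
        using Kronecker_approx_1_explicit[OF a, of "x - e" e] x e by auto
      define u where "u = x - frac (real k * a)"
      have u: "0 \<le> u" "u < d" using k e unfolding u_def by linarith+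
      have "(x - real k * a) - u \<in> \<int>" unfolding u_def by (simp add: frac_def)
      then have "((?S ^^ k) x - (x - real k * a)) + ((x - real k * a) - u) \<in> \<int>" using iter by (intro Ints_add)
      then have "frac ((?S ^^ k) x) = u" using u d by (subst frac_unique_iff) auto
      moreover have "frac ((?S ^^ k) x) = (?S ^^ k) x"
        using funpow_S_in[OF x, of k] by (simp add: frac_eq)
      ultimately show ?thesis using u by (intro exI[of _ k]) (auto simp: C_def)
    qed
    then have "AE x in unit_borel. \<exists>k. (?S ^^ k) x \<in> C" by (intro AE_I2) simp
    then show "\<exists>C\<in>sets unit_borel. measure unit_borel C < c \<and> (AE x in unit_borel. \<exists>k. (?S ^^ k) x \<in> C)"
      using C mC d by auto
  qed
qed

lemma cyclic_graphing_eq_orbit_graphing: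
  assumes "a \<notin> \<rat>"
  shows "cyclic_graphing a = orbit_graphing (\<lambda>x. frac (x + a))"
proof -
  have a: "a \<notin> \<int>" "- a \<notin> \<int>" using assms Ints_subset_Rats by (auto simp: minus_in_Ints_iff)
  have "x - y - a \<in> \<int> \<or> x - y + a \<in> \<int> \<longleftrightarrow> x \<noteq> y \<and> (y = frac (x + a) \<or> x = frac (y + a))"
    if "x \<in> {0..<1}" "y \<in> {0..<1}" for x y :: real
  proof -
    have "y + a - x \<in> \<int> \<longleftrightarrow> x - y - a \<in> \<int>"
      using minus_in_Ints_iff[of "y + a - x"] by (simp add: algebra_simps)
    moreover have "x + a - y \<in> \<int> \<longleftrightarrow> x - y + a \<in> \<int>" by (simp add: algebra_simps)
    ultimately show ?thesis using frac_rotation[OF that(2), of x a] frac_rotation[OF that(1), of y a] a by auto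
  qed
  then show ?thesis unfolding cyclic_graphing_def orbit_graphing_def by auto
qed



section \<open>Colored neighborhoods are colored words\<close>

lemma rooted_colored_iso_sym:
  assumes "rooted_colored_iso G H" "rroot G \<in> rverts G"
  shows "rooted_colored_iso H G"
proof -
  obtain h where h: "bij_betw h (rverts G) (rverts H)" "h (rroot G) = rroot H"
    "\<And>x y. x \<in> rverts G \<Longrightarrow> y \<in> rverts G \<Longrightarrow> (x, y) \<in> redges G \<longleftrightarrow> (h x, h y) \<in> redges H"
    "\<And>x. x \<in> rverts G \<Longrightarrow> rcolor H (h x) = rcolor G x"
    using assms(1) unfolding rooted_colored_iso_def by auto
  let ?k = "the_inv_into (rverts G) h"
  have inj: "inj_on h (rverts G)" and img: "h ` rverts G = rverts H" using h(1) by (auto simp: bij_betw_def)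
  have k: "?k x \<in> rverts G" "h (?k x) = x" if "x \<in> rverts H" for x
    using that the_inv_into_into[OF inj, of x "rverts G"] f_the_inv_into_f[OF inj] img by auto
  show ?thesis unfolding rooted_colored_iso_def
  proof (intro exI[of _ ?k] conjI ballI)
    show "bij_betw ?k (rverts H) (rverts G)" by (rule bij_betw_the_inv_into[OF h(1)])
    show "?k (rroot H) = rroot G" using the_inv_into_f_f[OF inj assms(2)] h(2) by simp
    show "(x, y) \<in> redges H \<longleftrightarrow> (?k x, ?k y) \<in> redges G" if "x \<in> rverts H" "y \<in> rverts H" for x y
      using h(3)[of "?k x" "?k y"] k that by simp
    show "rcolor G (?k x) = rcolor H x" if "x \<in> rverts H" for x
      using h(4)[of "?k x"] k that by simp
  qed
qed

lemma rooted_colored_iso_trans: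
  assumes "rooted_colored_iso G H" "rooted_colored_iso H K"
  shows "rooted_colored_iso G K"
proof -
  obtain h where h: "bij_betw h (rverts G) (rverts H)" "h (rroot G) = rroot H"
    "\<And>x y. x \<in> rverts G \<Longrightarrow> y \<in> rverts G \<Longrightarrow> (x, y) \<in> redges G \<longleftrightarrow> (h x, h y) \<in> redges H"
    "\<And>x. x \<in> rverts G \<Longrightarrow> rcolor H (h x) = rcolor G x"
    using assms(1) unfolding rooted_colored_iso_def by auto
  obtain k where k: "bij_betw k (rverts H) (rverts K)" "k (rroot H) = rroot K"
    "\<And>x y. x \<in> rverts H \<Longrightarrow> y \<in> rverts H \<Longrightarrow> (x, y) \<in> redges H \<longleftrightarrow> (k x, k y) \<in> redges K"
    "\<And>x. x \<in> rverts H \<Longrightarrow> rcolor K (k x) = rcolor H x"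
    using assms(2) unfolding rooted_colored_iso_def by auto
  have "h x \<in> rverts H" if "x \<in> rverts G" for x using h(1) that by (auto simp: bij_betw_def)
  then show ?thesis unfolding rooted_colored_iso_def
    using h k by (intro exI[of _ "k \<circ> h"]) (auto intro: bij_betw_trans)
qed

definition orbit_word :: "('a \<Rightarrow> 'a) \<Rightarrow> nat \<Rightarrow> ('a \<Rightarrow> 'c) \<Rightarrow> 'a \<Rightarrow> 'c list" where
  "orbit_word T n f z = map (\<lambda>j. f ((T ^^ j) z)) [0..<n]"

text \<open>The neighborhood of \<open>T\<^sup>r z\<close> of radius \<open>r\<close> for aperiodic \<open>z\<close>, with \<open>T\<^sup>j z\<close> represented by \<open>j\<close>.\<close>

definition path_ball :: "nat \<Rightarrow> nat list \<Rightarrow> nat rooted_colored_graph" where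
  "path_ball r w = \<lparr>rverts = {..2 * r},
     redges = {(i, j). i \<le> 2 * r \<and> j \<le> 2 * r \<and> (j = Suc i \<or> i = Suc j)},
     rroot = r, rcolor = (\<lambda>i. w ! i)\<rparr>"

definition path_class :: "nat \<Rightarrow> nat list \<Rightarrow> nat rooted_colored_graph set" where
  "path_class r w = {H. redges H \<subseteq> rverts H \<times> rverts H \<and> rooted_colored_iso (path_ball r w) H}"

context borel_automorphism
begin

lemma inj_orbit:
  assumes z: "z \<in> {0..<1}" and ap: "\<forall>n>0. (T ^^ n) z \<noteq> z"
  shows "(T ^^ i) z = (T ^^ j) z \<longleftrightarrow> i = j"
proof -
  have "(T ^^ i) z \<noteq> (T ^^ j) z" if "i < j" for i j
  proof
    assume "(T ^^ i) z = (T ^^ j) z"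
    then have "(S ^^ i) ((T ^^ i) z) = (S ^^ i) ((T ^^ j) z)" by simp
    then have "z = (T ^^ (j - i)) z" using funpow_ST[OF z, of i i] funpow_ST[OF z, of i j] that by simp
    then show False using ap that by (metis zero_less_diff)
  qed
  then show ?thesis by (metis nat_neq_iff)
qed

lemma orbit_edge_iff:
  assumes z: "z \<in> {0..<1}" and ap: "\<forall>n>0. (T ^^ n) z \<noteq> z"
  shows "((T ^^ i) z, (T ^^ j) z) \<in> edges (orbit_graphing T) \<longleftrightarrow> j = Suc i \<or> i = Suc j"
proof -
  have V: "(T ^^ k) z \<in> {0..<1}" for k by (rule funpow_T_in[OF z])
  have "(T ^^ j) z = S ((T ^^ i) z) \<longleftrightarrow> (T ^^ Suc j) z = (T ^^ i) z"
    using ST[OF V, of j] TS[OF V, of i] by auto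
  then have S: "(T ^^ j) z = S ((T ^^ i) z) \<longleftrightarrow> Suc j = i" by (simp only: inj_orbit[OF z ap])
  have T: "(T ^^ j) z = T ((T ^^ i) z) \<longleftrightarrow> j = Suc i"
    using inj_orbit[OF z ap, of j "Suc i"] by simp
  show ?thesis
    by (simp only: mem_edges_iff S T inj_orbit[OF z ap, of i j] V) auto
qed

text \<open>Centering the ball at \<open>T\<^sup>r z\<close> keeps all exponents nonnegative.\<close>

lemma ball_orbit_graphing:
  assumes z: "z \<in> {0..<1}" and ap: "\<forall>n>0. (T ^^ n) z \<noteq> z"
  shows "{y. \<exists>k\<le>r. ((T ^^ r) z, y) \<in> edges (orbit_graphing T) ^^ k} = (\<lambda>j. (T ^^ j) z) ` {..2 * r}"
proof (intro equalityI subsetI)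
  have "k \<le> r \<Longrightarrow> \<exists>j. r \<le> j + k \<and> j \<le> r + k \<and> y = (T ^^ j) z"
    if "((T ^^ r) z, y) \<in> edges (orbit_graphing T) ^^ k" for k y
    using that
  proof (induction k arbitrary: y)
    case 0 then show ?case by (intro exI[of _ r]) auto
  next
    case (Suc k)
    obtain u where u: "((T ^^ r) z, u) \<in> edges (orbit_graphing T) ^^ k" "(u, y) \<in> edges (orbit_graphing T)"
      using Suc.prems(2) by (rule relpow_Suc_E)
    obtain j where j: "r \<le> j + k" "j \<le> r + k" "u = (T ^^ j) z" using Suc.IH[OF _ u(1)] Suc.prems(1) by auto
    have S: "S ((T ^^ j) z) = (T ^^ (j - 1)) z"
      using j(1) Suc.prems(1) funpow_ST[OF z, of 1 j] by simp
    have "y = (T ^^ Suc j) z \<or> y = S ((T ^^ j) z)" using u(2) j(3) by (auto simp: mem_edges_iff)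
    then show ?case
    proof
      assume "y = (T ^^ Suc j) z"
      then show ?thesis using j by (intro exI[of _ "Suc j"]) simp
    next
      assume "y = S ((T ^^ j) z)"
      then show ?thesis using j S Suc.prems(1) by (intro exI[of _ "j - 1"]) auto
    qed
  qed
  then show "y \<in> (\<lambda>j. (T ^^ j) z) ` {..2 * r}"
    if "y \<in> {y. \<exists>k\<le>r. ((T ^^ r) z, y) \<in> edges (orbit_graphing T) ^^ k}" for y
    using that by fastforce
next
  have fwd: "((T ^^ r) z, (T ^^ (r + k)) z) \<in> edges (orbit_graphing T) ^^ k" for k
  proof (induction k)
    case (Suc k)
    show ?case by (rule relpow_Suc_I[OF Suc]) (simp only: orbit_edge_iff[OF z ap], simp)
  qed simp
  have bwd: "k \<le> r \<Longrightarrow> ((T ^^ r) z, (T ^^ (r - k)) z) \<in> edges (orbit_graphing T) ^^ k" for k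
  proof (induction k)
    case (Suc k)
    show ?case by (rule relpow_Suc_I[OF Suc.IH]) (use Suc.prems in \<open>simp_all only: orbit_edge_iff[OF z ap], auto\<close>)
  qed simp
  fix y assume "y \<in> (\<lambda>j. (T ^^ j) z) ` {..2 * r}"
  then obtain j where j: "j \<le> 2 * r" "y = (T ^^ j) z" by auto
  show "y \<in> {y. \<exists>k\<le>r. ((T ^^ r) z, y) \<in> edges (orbit_graphing T) ^^ k}"
  proof (cases "r \<le> j")
    case True
    then show ?thesis using fwd[of "j - r"] j by (auto intro!: exI[of _ "j - r"])
  next
    case False
    then show ?thesis using bwd[of "r - j"] j by (auto intro!: exI[of _ "r - j"])
  qed
qed

lemma nbhd_class_orbit_graphing:
  assumes z: "z \<in> {0..<1}" and ap: "\<forall>n>0. (T ^^ n) z \<noteq> z"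
  shows "nbhd_class (orbit_graphing T) r f ((T ^^ r) z) = path_class r (orbit_word T (2 * r + 1) f z)"
proof -
  let ?G = "path_ball r (orbit_word T (2 * r + 1) f z)" and ?H = "nbhd (orbit_graphing T) r f ((T ^^ r) z)"
  have W: "rverts ?H = (\<lambda>j. (T ^^ j) z) ` {..2 * r}"
    "redges ?H = edges (orbit_graphing T) \<inter> (rverts ?H \<times> rverts ?H)" "rroot ?H = (T ^^ r) z" "rcolor ?H = f"
    using ball_orbit_graphing[OF z ap, of r] by (simp_all add: nbhd_def Let_def)
  have word: "orbit_word T (2 * r + 1) f z ! i = f ((T ^^ i) z)" if "i \<le> 2 * r" for i
    unfolding orbit_word_def using that by (subst nth_map) (auto simp del: upt_Suc)
  have GH: "rooted_colored_iso ?G ?H"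
    unfolding rooted_colored_iso_def
  proof (intro exI[of _ "\<lambda>j. (T ^^ j) z"] conjI ballI)
    show "bij_betw (\<lambda>j. (T ^^ j) z) (rverts ?G) (rverts ?H)"
      unfolding bij_betw_def W(1) by (auto simp: path_ball_def inj_on_def inj_orbit[OF z ap])
    show "(T ^^ rroot ?G) z = rroot ?H" by (simp add: path_ball_def W)
    show "(x, y) \<in> redges ?G \<longleftrightarrow> ((T ^^ x) z, (T ^^ y) z) \<in> redges ?H" if "x \<in> rverts ?G" "y \<in> rverts ?G" for x y
      using that unfolding W(1,2) by (auto simp: path_ball_def orbit_edge_iff[OF z ap])
    show "rcolor ?H ((T ^^ x) z) = rcolor ?G x" if "x \<in> rverts ?G" for x
      using that word[of x] by (simp add: W path_ball_def)
  qed
  have HG: "rooted_colored_iso ?H ?G" by (rule rooted_colored_iso_sym[OF GH]) (simp add: path_ball_def)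
  have "rooted_colored_iso ?H K \<longleftrightarrow> rooted_colored_iso ?G K" for K :: "nat rooted_colored_graph"
    using rooted_colored_iso_trans[OF GH] rooted_colored_iso_trans[OF HG] by blast
  then show ?thesis unfolding nbhd_class_def path_class_def by simp
qed

end

lemma measurable_orbit_word:
  assumes T: "T \<in> measurable M M" and f: "f \<in> measurable M (count_space UNIV)"
  shows "orbit_word T n f \<in> measurable M (count_space (UNIV :: nat list set))"
proof (induction n)
  case (Suc n)
  have Tn: "(T ^^ n) \<in> measurable M M" for n
  proof (induction n)
    case (Suc n)
    show ?case unfolding funpow.simps(2) by (rule measurable_comp[OF Suc T])
  qed (simp add: id_def)
  have "(\<lambda>z. w @ [f ((T ^^ n) z)]) \<in> measurable M (count_space UNIV)" for w
    by (rule measurable_compose[OF measurable_compose[OF Tn f]]) simp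
  from measurable_compose_countable[OF this Suc] show ?case
    by (simp add: orbit_word_def[abs_def])
qed (simp add: orbit_word_def)

lemma orbit_word_AE_cong:
  assumes "T \<in> measurable M M" "distr M M T = M" "AE x in M. f x = g x"
  shows "AE x in M. orbit_word T n f x = orbit_word T n g x"
proof -
  have "AE x in M. f ((T ^^ j) x) = g ((T ^^ j) x)" for j
    by (rule AE_measure_preserving[OF funpow_measure_preserving[OF assms(1,2)] assms(3)])
  then have "AE x in M. \<forall>j. f ((T ^^ j) x) = g ((T ^^ j) x)" by (simp add: AE_all_countable)
  then show ?thesis by eventually_elim (simp add: orbit_word_def)
qed

text \<open>Since \<open>T\<^sup>r\<close> preserves the measure, the neighborhood of a random vertex may be taken around \<open>T\<^sup>r z\<close>
  for random \<open>z\<close>; there it is almost surely determined by the colored word along the orbit of \<open>z\<close>.\<close>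

lemma (in sweeping_automorphism) nbhd_law_orbit_graphing:
  assumes f: "f \<in> measurable unit_borel (count_space UNIV)" and fg: "AE x in unit_borel. g x = f x"
  shows "nbhd_law (orbit_graphing T) r g C =
    measure unit_borel {z \<in> {0..<1}. path_class r (orbit_word T (2 * r + 1) f z) = C}"
proof -
  let ?N = unit_lebesgue
  let ?w = "\<lambda>f. orbit_word T (2 * r + 1) f"
  let ?Z = "{z \<in> {0..<1}. path_class r (?w f z) = C}"
  have Z: "?Z \<in> sets unit_borel"
    using sets_unit_borel_preimage[OF measurable_orbit_word[OF T_measurable f], of "{w. path_class r w = C}"]
    by simp
  have "AE z in unit_borel. nbhd_class (orbit_graphing T) r g ((T ^^ r) z) = path_class r (?w f z)"
    using aperiodic orbit_word_AE_cong[OF T_measurable distr_T fg, of "2 * r + 1"] AE_space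
    by eventually_elim (simp add: nbhd_class_orbit_graphing)
  then have "AE x in unit_borel. nbhd_class (orbit_graphing T) r g ((T ^^ r) ((S ^^ r) x)) = path_class r (?w f ((S ^^ r) x))"
    by (rule AE_measure_preserving[OF funpow_measure_preserving[OF S_measurable distr_S]])
  then have eq: "AE x in unit_borel. nbhd_class (orbit_graphing T) r g x = path_class r (?w f ((S ^^ r) x))"
    using AE_space by eventually_elim (use funpow_TS[of _ r r] in simp)
  let ?X = "{x \<in> space ?N. nbhd_class (orbit_graphing T) r g x = C}"
  let ?Y = "{x \<in> {0..<1}. (S ^^ r) x \<in> ?Z}"
  have Y: "?Y \<in> sets unit_borel" by (rule sets_unit_borel_preimage[OF measurable_funpow(2) Z])
  have "AE x in ?N. x \<in> ?Y \<longleftrightarrow> x \<in> ?X"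
    unfolding AE_completion_iff using eq AE_space
    by eventually_elim (use funpow_S_in in auto)
  then have "measure ?N ?Y = measure ?N ?X"
    using Y by (intro measure_eq_AE completion.in_sets_AE[where A = ?Y and B = ?X]) auto
  moreover have "measure ?N ?Y = measure unit_borel ?Z"
    using Y measure_funpow_vimage(2)[OF Z, of r] by simp
  ultimately show ?thesis unfolding nbhd_law_def by simp
qed

lemma borel_coloring_exists:
  assumes f: "f \<in> measurable unit_lebesgue (count_space {1..m::nat})" and m: "m \<ge> 1"
  obtains g where "g \<in> measurable unit_borel (count_space {1..m})" "AE x in unit_borel. f x = g x"
proof -
  have "(\<lambda>x. real (f x)) \<in> borel_measurable unit_lebesgue"
    by (rule measurable_compose[OF f]) simp
  then obtain h where h: "h \<in> borel_measurable unit_borel" "AE x in unit_borel. real (f x) = h x"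
    using completion_ex_borel_measurable_real by blast
  define g where "g x = (let k = nat \<lfloor>h x\<rfloor> in if k \<in> {1..m} then k else 1)" for x
  have "(\<lambda>x. nat \<lfloor>h x\<rfloor>) \<in> measurable unit_borel (count_space UNIV)" using h(1) by measurable
  then have "g \<in> measurable unit_borel (count_space {1..m})"
    unfolding g_def by (rule measurable_compose) (use m in \<open>auto simp: Let_def\<close>)
  moreover have "AE x in unit_borel. f x = g x"
    using h(2) AE_space
  proof eventually_elim
    case (elim x)
    then have "f x \<in> {1..m}" using measurable_space[OF f, of x] by simp
    then show ?case using elim(1)[symmetric] by (simp add: g_def)
  qed
  ultimately show thesis by (rule that)
qed

section \<open>Transferring colorings between graphings\<close>

lemma uniform_distribution_on:
  assumes B: "B \<in> sets unit_borel" "measure unit_borel B > 0"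
  defines "M \<equiv> distr (uniform_measure unit_borel B) borel (\<lambda>x. x)"
  shows "real_distribution M"
    and "\<And>A. A \<in> sets borel \<Longrightarrow> measure M A = measure unit_borel (B \<inter> A) / measure unit_borel B"
proof -
  interpret prob_space unit_borel by (rule prob_space_unit_borel)
  note [measurable] = measurable_id_unit_borel
  have BV: "B \<subseteq> {0..<1}" "B \<in> sets borel" using B by (auto simp: sets_unit_borel_iff)
  have B0: "emeasure unit_borel B \<noteq> 0" "emeasure unit_borel B \<noteq> \<infinity>"
    using B by (auto simp: emeasure_eq_measure)
  have "prob_space (uniform_measure unit_borel B)" by (rule prob_space_uniform_measure[OF B0])
  then show "real_distribution M" unfolding M_def by (rule prob_space.real_distribution_distr) simp
  show "measure M A = prob (B \<inter> A) / prob B" if "A \<in> sets borel" for A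
  proof -
    have "measure M A = measure (uniform_measure unit_borel B) (A \<inter> {0..<1})"
      unfolding M_def using that by (subst measure_distr) (auto simp: Int_commute)
    also have "\<dots> = prob (B \<inter> (A \<inter> {0..<1})) / prob B"
      by (rule measure_uniform_measure[OF B0]) (use that in \<open>auto simp: sets_unit_borel_iff\<close>)
    also have "B \<inter> (A \<inter> {0..<1}) = B \<inter> A" using BV by auto
    finally show ?thesis .
  qed
qed

lemma uniform_distribution_unit_interval:
  defines "U \<equiv> distr unit_borel borel (\<lambda>x. x)"
  shows "real_distribution U"
    and "cdf U t = (if t < 0 then 0 else if t < 1 then t else 1)"
    and "A \<in> sets unit_borel \<Longrightarrow> measure U A = measure unit_borel A"
proof -
  interpret prob_space unit_borel by (rule prob_space_unit_borel)
  note [measurable] = measurable_id_unit_borel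
  show "real_distribution U" unfolding U_def by (rule real_distribution_distr) simp
  show "measure U A = prob A" if "A \<in> sets unit_borel"
    using that unfolding U_def by (subst measure_distr) (auto simp: sets_unit_borel_iff Int_absorb2)
  have "cdf U t = prob ({..t} \<inter> {0..<1})"
    unfolding cdf_def U_def by (subst measure_distr) auto
  also have "\<dots> = (if t < 0 then 0 else if t < 1 then t else 1)"
  proof -
    consider "t < 0" | "0 \<le> t" "t < 1" | "1 \<le> t" by linarith
    then show ?thesis
    proof cases
      case 1
      then have "{..t} \<inter> {0..<1} = {}" by auto
      then show ?thesis using 1 by simp
    next
      case 2
      then have "{..t} \<inter> {0..<1} = {0..t}" by auto
      moreover have "{0..t} \<in> sets unit_borel" using 2 by (auto simp: sets_unit_borel_iff)
      ultimately show ?thesis using 2 by (simp add: measure_unit_borel)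
    next
      case 3
      then have "{..t} \<inter> {0..<1} = space unit_borel" by auto
      then show ?thesis using 3 prob_space by simp
    qed
  qed
  finally show "cdf U t = (if t < 0 then 0 else if t < 1 then t else 1)" .
qed

text \<open>The cumulative distribution function of the uniform distribution on \<open>B\<close> is continuous, and
  therefore maps this distribution to the uniform distribution on the unit interval.\<close>

lemma uniform_rescaling:
  assumes B: "B \<in> sets unit_borel" "measure unit_borel B > 0"
  obtains \<theta> where "\<theta> \<in> measurable unit_borel unit_borel"
    "\<And>E. E \<in> sets unit_borel \<Longrightarrow> measure unit_borel {x \<in> B. \<theta> x \<in> E} = measure unit_borel B * measure unit_borel E"
proof -
  interpret prob_space unit_borel by (rule prob_space_unit_borel)
  have BV: "B \<subseteq> {0..<1}" "B \<in> sets borel" using B by (auto simp: sets_unit_borel_iff)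
  define M where "M = distr (uniform_measure unit_borel B) borel (\<lambda>x. x)"
  interpret M: real_distribution M unfolding M_def by (rule uniform_distribution_on(1)[OF B])
  have M: "measure M A = prob (B \<inter> A) / prob B" if "A \<in> sets borel" for A
    unfolding M_def by (rule uniform_distribution_on(2)[OF B that])
  define F where "F = cdf M"
  have "measure M {x} = 0" for x
  proof -
    have "B \<inter> {x} \<in> sets unit_borel" using BV by (auto simp: sets_unit_borel_iff)
    moreover have "emeasure lborel (B \<inter> {x}) \<le> emeasure lborel {x}" by (rule emeasure_mono) auto
    ultimately have "prob (B \<inter> {x}) = 0" by (simp add: measure_def emeasure_unit_borel)
    then show ?thesis by (simp add: M)
  qed
  then have F_cont: "isCont F x" for x unfolding F_def by (simp add: M.isCont_cdf)
  have F_mono: "F x \<le> F y" if "x \<le> y" for x y unfolding F_def using that by (rule M.cdf_nondecreasing)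
  have F0: "F 0 = 0"
  proof -
    have "B \<inter> {..0} \<subseteq> {0}" using BV by auto
    then have "emeasure lborel (B \<inter> {..0}) \<le> emeasure lborel {0::real}" by (intro emeasure_mono) auto
    moreover have "B \<inter> {..0} \<in> sets unit_borel" using BV by (auto simp: sets_unit_borel_iff)
    ultimately have "prob (B \<inter> {..0}) = 0" by (simp add: measure_def emeasure_unit_borel)
    then show ?thesis by (simp add: F_def cdf_def M)
  qed
  have F1: "F 1 = 1"
  proof -
    have "B \<inter> {..1} = B" using BV by auto
    then show ?thesis using B(2) by (simp add: F_def cdf_def M)
  qed
  have F_m [measurable]: "F \<in> borel_measurable borel"
    using F_cont by (intro borel_measurable_continuous_onI continuous_at_imp_continuous_on) auto
  have F_le: "measure M {x. F x \<le> t} = t" if t: "0 \<le> t" "t < 1" for t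
  proof -
    have cont: "continuous_on A F" for A using F_cont by (intro continuous_at_imp_continuous_on) auto
    define K where "K = {0..1} \<inter> F -` {..t}"
    have "closed K" unfolding K_def by (rule continuous_closed_preimage[OF cont]) auto
    then have "compact K" using compact_Int_closed[of "{0..1}" K] by (simp add: K_def Int_absorb1 Int_assoc[symmetric])
    moreover have "0 \<in> K" using F0 t by (simp add: K_def)
    \<comment> \<open>the right end of the sublevel set, which is a ray since \<open>F\<close> is monotone\<close>
    ultimately obtain s where s: "s \<in> K" "\<And>x. x \<in> K \<Longrightarrow> x \<le> s"
      using compact_attains_sup[of K] by blast
    have "s \<le> 1" "0 \<le> s" "F s \<le> t" using s(1) by (auto simp: K_def)
    then obtain s' where s': "s \<le> s'" "s' \<le> 1" "F s' = t"
      using IVT'[of F s t 1] F1 t cont by auto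
    then have "F s = t" using s(2)[of s'] \<open>0 \<le> s\<close> by (auto simp: K_def)
    moreover have "{x. F x \<le> t} = {..s}"
    proof (intro equalityI subsetI)
      fix x assume "x \<in> {..s}"
      then show "x \<in> {x. F x \<le> t}" using F_mono[of x s] \<open>F s = t\<close> by simp
    next
      fix x assume x: "x \<in> {x. F x \<le> t}"
      then have "x < 1" using F_mono[of 1 x] F1 t by (cases "x < 1") auto
      then show "x \<in> {..s}" using s(2)[of x] \<open>0 \<le> s\<close> x by (cases "x < 0") (auto simp: K_def)
    qed
    ultimately show ?thesis by (simp add: F_def cdf_def)
  qed
  define U where "U = distr unit_borel borel (\<lambda>x. x :: real)"
  note U = uniform_distribution_unit_interval[folded U_def]
  have FM: "F \<in> measurable M borel" by (simp add: measurable_cong_sets[OF M.events_eq_borel refl])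
  have "distr M borel F = U"
  proof (rule cdf_unique[OF M.real_distribution_distr[OF FM] U(1)], rule ext)
    fix t :: real
    have "cdf (distr M borel F) t = measure M {x. F x \<le> t}"
      unfolding cdf_def by (subst measure_distr[OF FM]) (auto simp: vimage_def)
    moreover have "{x. F x \<le> t} = {}" if "t < 0"
    proof -
      have "\<not> F x \<le> t" for x using M.cdf_nonneg[of x] that unfolding F_def by linarith
      then show ?thesis by simp
    qed
    moreover have "{x. F x \<le> t} = space M" if "1 \<le> t"
    proof -
      have "F x \<le> t" for x using M.cdf_bounded_prob[of x] that unfolding F_def by linarith
      then show ?thesis by simp
    qed
    ultimately show "cdf (distr M borel F) t = cdf U t"
      unfolding U(2) using F_le[of t] M.prob_space by auto
  qed
  then have push: "measure M {x. F x \<in> E} = prob E" if "E \<in> sets unit_borel" for E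
    using U(3)[OF that] measure_distr[OF FM, of E] that by (simp add: vimage_def sets_unit_borel_iff)
  define \<theta> where "\<theta> x = (if F x \<in> {0..<1} then F x else 0)" for x
  have \<theta>_b [measurable]: "\<theta> \<in> borel_measurable borel" unfolding \<theta>_def by measurable
  then have "\<theta> \<in> borel_measurable unit_borel" by (intro measurable_restrict_space1) simp
  then have \<theta>: "\<theta> \<in> measurable unit_borel unit_borel"
    by (rule measurable_unit_borelI) (auto simp: \<theta>_def)
  have "prob {0..<1} = 1" using prob_space by simp
  then have "measure M {x. F x \<in> {0..<1}} = 1" using push[of "{0..<1}"] by (simp add: sets_unit_borel_iff)
  moreover have "{x. F x \<in> {0..<1}} \<in> sets M" by measurable
  ultimately have "AE x in M. x \<in> {x. F x \<in> {0..<1}}" by (subst (asm) M.prob_eq_1)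
  then have AE_F: "AE x in M. \<theta> x = F x" by eventually_elim (simp add: \<theta>_def)
  have "measure unit_borel {x \<in> B. \<theta> x \<in> E} = prob B * prob E" if E: "E \<in> sets unit_borel" for E
  proof -
    have Eb [measurable]: "E \<in> sets borel" using E by (simp add: sets_unit_borel_iff)
    have "measure M {x. \<theta> x \<in> E} = measure M {x. F x \<in> E}"
      by (rule measure_eq_AE) (use AE_F in \<open>auto elim: AE_mp\<close>)
    also have "\<dots> = prob E" by (rule push[OF E])
    finally have "prob (B \<inter> {x. \<theta> x \<in> E}) / prob B = prob E" by (subst (asm) M) measurable
    then show ?thesis using B(2) by (simp add: field_simps Collect_conj_eq)
  qed
  with \<theta> show thesis by (rule that)
qed



text \<open>Over a Rokhlin tower of height \<open>N\<close> with base \<open>B\<close> the coloring of the second system copies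
  the colors that the first system shows along the first \<open>N\<close> steps from the point \<open>\<theta> b\<close>, whose
  distribution is uniform. So words of length \<open>n\<close> have the right frequencies, except near the top of
  the tower and outside of it. It suffices to bound the frequency of every set of words from below,
  since the complement then yields the upper bound.\<close>

lemma coloring_transfer:
  assumes source: "borel_automorphism T\<^sub>1 S\<^sub>1" and target: "sweeping_automorphism T\<^sub>2 S\<^sub>2"
    and f: "f \<in> measurable unit_borel (count_space {1..m::nat})" and m: "m \<ge> 1" and \<epsilon>: "\<epsilon> > 0"
  obtains g where "g \<in> measurable unit_borel (count_space {1..m})"
    "\<And>A. \<bar>measure unit_borel {z \<in> {0..<1}. orbit_word T\<^sub>2 n g z \<in> A} -
          measure unit_borel {z \<in> {0..<1}. orbit_word T\<^sub>1 n f z \<in> A}\<bar> \<le> \<epsilon>"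
proof -
  interpret prob_space unit_borel by (rule prob_space_unit_borel)
  interpret A1: borel_automorphism T\<^sub>1 S\<^sub>1 by (rule source)
  interpret A2: sweeping_automorphism T\<^sub>2 S\<^sub>2 by (rule target)
  obtain N0 :: nat where N0: "2 * real n / \<epsilon> < real N0" using reals_Archimedean2 by blast
  \<comment> \<open>the top \<open>n\<close> levels of a tower of height \<open>N\<close> then have measure at most \<open>\<epsilon> / 2\<close>\<close>
  define N where "N = N0 + n + 1"
  have N: "N > 0" "n \<le> N" by (auto simp: N_def)
  have nN: "real n / real N \<le> \<epsilon> / 2"
  proof -
    have "2 * real n / \<epsilon> < real N" using N0 by (simp add: N_def)
    then have "2 * real n < real N * \<epsilon>" using \<epsilon> by (simp add: field_simps)
    then show ?thesis using N by (simp add: field_simps)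
  qed
  define \<delta> where "\<delta> = min (\<epsilon> / 2) (1 / 2)"
  have \<delta>: "\<delta> > 0" "\<delta> < 1" "\<delta> \<le> \<epsilon> / 2" using \<epsilon> by (auto simp: \<delta>_def)
  obtain B where B: "B \<in> sets unit_borel"
    and uniq: "\<And>x i j. x \<in> {0..<1} \<Longrightarrow> i < N \<Longrightarrow> j < N \<Longrightarrow> (S\<^sub>2 ^^ i) x \<in> B \<Longrightarrow> (S\<^sub>2 ^^ j) x \<in> B \<Longrightarrow> i = j"
    and tower: "real N * prob B \<ge> 1 - \<delta>"
    by (rule A2.rokhlin_tower[OF N(1) \<delta>(1)]) (rule that)
  have "real N * prob B > 0" using tower \<delta> by linarith
  then have B_pos: "prob B > 0" using N by (simp add: zero_less_mult_iff)
  obtain \<theta> where \<theta>: "\<theta> \<in> measurable unit_borel unit_borel"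
    and \<theta>_unif: "\<And>E. E \<in> sets unit_borel \<Longrightarrow> prob {x \<in> B. \<theta> x \<in> E} = prob B * prob E"
    by (rule uniform_rescaling[OF B B_pos]) (rule that)
  have \<theta>V: "\<theta> x \<in> {0..<1}" if "x \<in> {0..<1}" for x using measurable_space[OF \<theta>, of x] that by simp
  note sets_vimage = sets_unit_borel_preimage
  \<comment> \<open>the level of a point \<open>x\<close> of the tower\<close>
  define J where "J x = (LEAST j. (S\<^sub>2 ^^ j) x \<in> B)" for x
  define g where "g x = (if \<exists>j<N. (S\<^sub>2 ^^ j) x \<in> B then f ((T\<^sub>1 ^^ J x) (\<theta> ((S\<^sub>2 ^^ J x) x))) else 1)" for x
  have pred [measurable]: "Measurable.pred unit_borel (\<lambda>x. (S\<^sub>2 ^^ j) x \<in> B)" for j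
    using sets_vimage[OF A2.measurable_funpow(2) B, of j] by (simp add: pred_def)
  have J_m: "J \<in> measurable unit_borel (count_space UNIV)"
    unfolding J_def using pred by (rule measurable_Least)
  have g: "g \<in> measurable unit_borel (count_space {1..m})"
    unfolding g_def
  proof (rule measurable_If)
    have "(\<lambda>x. f ((T\<^sub>1 ^^ j) (\<theta> ((S\<^sub>2 ^^ j) x)))) \<in> measurable unit_borel (count_space {1..m})" for j
      by (rule measurable_compose[OF measurable_compose[OF measurable_compose[OF A2.measurable_funpow(2) \<theta>]
        A1.measurable_funpow(1)] f])
    from measurable_compose_countable[OF this J_m]
    show "(\<lambda>x. f ((T\<^sub>1 ^^ J x) (\<theta> ((S\<^sub>2 ^^ J x) x)))) \<in> measurable unit_borel (count_space {1..m})" .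
    show "(\<lambda>x. 1) \<in> measurable unit_borel (count_space {1..m})" using m by (intro measurable_const) simp
    show "{x \<in> space unit_borel. \<exists>j<N. (S\<^sub>2 ^^ j) x \<in> B} \<in> sets unit_borel"
      by measurable
  qed
  have g_eq: "g x = f ((T\<^sub>1 ^^ j) (\<theta> ((S\<^sub>2 ^^ j) x)))" if "x \<in> {0..<1}" "j < N" "(S\<^sub>2 ^^ j) x \<in> B" for x j
  proof -
    have "J x \<le> j" "(S\<^sub>2 ^^ J x) x \<in> B" unfolding J_def using that(3) by (auto intro: Least_le LeastI)
    then have "J x = j" using uniq[OF that(1), of "J x" j] that by simp
    then show ?thesis using that by (auto simp: g_def)
  qed
  have words: "f \<in> measurable unit_borel (count_space UNIV)" "g \<in> measurable unit_borel (count_space UNIV)"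
    using measurable_compose[OF f, of "\<lambda>x. x" "count_space UNIV"] measurable_compose[OF g, of "\<lambda>x. x" "count_space UNIV"]
    by auto
  note w1 = measurable_orbit_word[OF A1.T_measurable words(1), of n]
    and w2 = measurable_orbit_word[OF A2.T_measurable words(2), of n]
  let ?p = "\<lambda>A. prob {z \<in> {0..<1}. orbit_word T\<^sub>1 n f z \<in> A}"
  let ?q = "\<lambda>A. prob {z \<in> {0..<1}. orbit_word T\<^sub>2 n g z \<in> A}"
  have lower: "?q A \<ge> ?p A - \<epsilon>" for A
  proof -
    define E where "E = {z \<in> {0..<1}. orbit_word T\<^sub>1 n f z \<in> A}"
    have E: "E \<in> sets unit_borel" unfolding E_def by (rule sets_vimage[OF w1]) simp
    have Ej: "{y \<in> {0..<1}. (T\<^sub>1 ^^ j) y \<in> E} \<in> sets unit_borel" for j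
      by (rule sets_vimage[OF A1.measurable_funpow(1) E])
    have Dj: "{x \<in> B. \<theta> x \<in> {y \<in> {0..<1}. (T\<^sub>1 ^^ j) y \<in> E}} \<in> sets unit_borel" for j
    proof -
      have "{x \<in> B. \<theta> x \<in> {y \<in> {0..<1}. (T\<^sub>1 ^^ j) y \<in> E}} =
          B \<inter> {x \<in> {0..<1}. \<theta> x \<in> {y \<in> {0..<1}. (T\<^sub>1 ^^ j) y \<in> E}}"
        using B by (auto simp: sets_unit_borel_iff)
      then show ?thesis using sets.Int[OF B sets_vimage[OF \<theta> Ej]] by simp
    qed
    \<comment> \<open>the points of level \<open>j\<close> from which a word in \<open>A\<close> has been copied\<close>
    define D where "D j = {z \<in> {0..<1}. (S\<^sub>2 ^^ j) z \<in> {x \<in> B. \<theta> x \<in> {y \<in> {0..<1}. (T\<^sub>1 ^^ j) y \<in> E}}}" for j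
    have D: "D j \<in> sets unit_borel" for j
      unfolding D_def by (rule sets_vimage[OF A2.measurable_funpow(2) Dj])
    have prob_D: "prob (D j) = prob B * ?p A" for j
    proof -
      have "prob (D j) = prob {x \<in> B. \<theta> x \<in> {y \<in> {0..<1}. (T\<^sub>1 ^^ j) y \<in> E}}"
        unfolding D_def by (rule A2.measure_funpow_vimage(2)[OF Dj])
      also have "\<dots> = prob B * prob {y \<in> {0..<1}. (T\<^sub>1 ^^ j) y \<in> E}" by (rule \<theta>_unif[OF Ej])
      also have "prob {y \<in> {0..<1}. (T\<^sub>1 ^^ j) y \<in> E} = prob E" by (rule A1.measure_funpow_vimage(1)[OF E])
      finally show ?thesis by (simp only: E_def)
    qed
    have D_sub: "D j \<subseteq> {z \<in> {0..<1}. orbit_word T\<^sub>2 n g z \<in> A}" if j: "j < N + 1 - n" for j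
    proof
      fix z assume "z \<in> D j"
      then have z: "z \<in> {0..<1}" "(S\<^sub>2 ^^ j) z \<in> B" "(T\<^sub>1 ^^ j) (\<theta> ((S\<^sub>2 ^^ j) z)) \<in> E" by (auto simp: D_def)
      have "g ((T\<^sub>2 ^^ i) z) = f ((T\<^sub>1 ^^ i) ((T\<^sub>1 ^^ j) (\<theta> ((S\<^sub>2 ^^ j) z))))" if "i < n" for i
      proof -
        have "(S\<^sub>2 ^^ (i + j)) ((T\<^sub>2 ^^ i) z) = (S\<^sub>2 ^^ j) z"
          using A2.funpow_ST[OF z(1), of i i] by (simp add: add.commute[of i] funpow_add)
        then show ?thesis
          using g_eq[OF A2.funpow_T_in[OF z(1)], of "i + j" i] z(2) that j by (simp add: funpow_add)
      qed
      then have "orbit_word T\<^sub>2 n g z = orbit_word T\<^sub>1 n f ((T\<^sub>1 ^^ j) (\<theta> ((S\<^sub>2 ^^ j) z)))"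
        by (simp add: orbit_word_def)
      then show "z \<in> {z \<in> {0..<1}. orbit_word T\<^sub>2 n g z \<in> A}" using z by (simp add: E_def)
    qed
    \<comment> \<open>from \<open>N + 1 - n\<close> levels a word of length \<open>n\<close> fits into the tower; for \<open>n = 0\<close> this number
      exceeds the height of the tower\<close>
    have disj: "disjoint_family_on D {..<N + 1 - n}" if "n > 0"
      unfolding disjoint_family_on_def
    proof (intro ballI impI equals0I)
      fix i j z assume ij: "i \<in> {..<N + 1 - n}" "j \<in> {..<N + 1 - n}" "i \<noteq> j" and z: "z \<in> D i \<inter> D j"
      have "i < N" "j < N" using ij that by auto
      then show False using uniq[of z i j] ij(3) z by (auto simp: D_def)
    qed
    have upper_B: "real N * prob B \<le> 1"
    proof -
      let ?L = "\<lambda>i. {x \<in> {0..<1}. (S\<^sub>2 ^^ i) x \<in> B}"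
      have "real N * prob B = (\<Sum>i<N. prob (?L i))"
        by (simp add: A2.measure_funpow_vimage(2)[OF B] del: atLeastLessThan_iff)
      also have "\<dots> = prob (\<Union>i<N. ?L i)"
        by (rule finite_measure_finite_Union[symmetric])
          (use sets_vimage[OF A2.measurable_funpow(2) B] uniq in \<open>auto simp: disjoint_family_on_def\<close>)
      finally show ?thesis by simp
    qed
    have p01: "0 \<le> ?p A" "?p A \<le> 1" by auto
    show ?thesis
    proof (cases "n = 0")
      case True
      then show ?thesis using \<epsilon> by (simp add: orbit_word_def)
    next
      case False
      have "real (N + 1 - n) * (prob B * ?p A) = (\<Sum>j<N + 1 - n. prob (D j))" by (simp only: prob_D) simp
      also have "\<dots> = prob (\<Union>j<N + 1 - n. D j)"
        by (rule finite_measure_finite_Union[symmetric]) (use D disj False in auto)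
      also have "\<dots> \<le> ?q A"
        by (rule finite_measure_mono) (use D_sub sets_vimage[OF w2] in auto)
      finally have q: "real (N + 1 - n) * (prob B * ?p A) \<le> ?q A" .
      have "real (N + 1 - n) * prob B \<ge> real N * prob B - real n * prob B"
        using N by (simp add: of_nat_diff algebra_simps)
      moreover have "real n * prob B \<le> \<epsilon> / 2"
      proof -
        have "prob B \<le> 1 / real N" using upper_B N by (simp add: field_simps)
        then have "real n * prob B \<le> real n * (1 / real N)" by (intro mult_left_mono) auto
        also have "\<dots> \<le> \<epsilon> / 2" using nN by simp
        finally show ?thesis .
      qed
      ultimately have "real (N + 1 - n) * prob B \<ge> 1 - \<epsilon>" using tower \<delta>(3) by linarith
      then have "(1 - \<epsilon>) * ?p A \<le> real (N + 1 - n) * prob B * ?p A" using p01 by (intro mult_right_mono) auto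
      moreover have "(1 - \<epsilon>) * ?p A \<ge> ?p A - \<epsilon>"
        using mult_left_mono[OF p01(2), of \<epsilon>] \<epsilon> by (simp add: algebra_simps)
      ultimately show ?thesis using q by (simp add: mult.assoc)
    qed
  qed
  have compl: "?p (- A) = 1 - ?p A" "?q (- A) = 1 - ?q A" for A
  proof -
    have "prob {z \<in> {0..<1}. h z \<in> - A} = 1 - prob {z \<in> {0..<1}. h z \<in> A}"
      if h: "h \<in> measurable unit_borel (count_space (UNIV :: nat list set))" for h
    proof -
      have "{z \<in> {0..<1}. h z \<in> - A} = space unit_borel - {z \<in> {0..<1}. h z \<in> A}" by auto
      moreover have "{z \<in> {0..<1}. h z \<in> A} \<in> sets unit_borel" by (rule sets_vimage[OF h]) simp
      ultimately show ?thesis by (simp only: prob_compl)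
    qed
    from this[OF w1] this[OF w2] show "?p (- A) = 1 - ?p A" "?q (- A) = 1 - ?q A" .
  qed
  show thesis
  proof (rule that[OF g])
    show "\<bar>?q A - ?p A\<bar> \<le> \<epsilon>" for A using lower[of A] lower[of "- A"] compl[of A] by linarith
  qed
qed

lemma local_laws_subset_closure:
  assumes 1: "sweeping_automorphism T\<^sub>1 S\<^sub>1" and 2: "sweeping_automorphism T\<^sub>2 S\<^sub>2" and m: "m \<ge> 1"
  shows "local_laws (orbit_graphing T\<^sub>1) r m \<subseteq> closure (local_laws (orbit_graphing T\<^sub>2) r m)"
proof
  interpret A1: sweeping_automorphism T\<^sub>1 S\<^sub>1 by (rule 1)
  interpret A2: sweeping_automorphism T\<^sub>2 S\<^sub>2 by (rule 2)
  fix L assume "L \<in> local_laws (orbit_graphing T\<^sub>1) r m"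
  then obtain f0 where f0: "f0 \<in> measurable unit_lebesgue (count_space {1..m})"
    "L = nbhd_law (orbit_graphing T\<^sub>1) r f0" unfolding local_laws_def vspace_orbit_graphing by blast
  obtain f where f: "f \<in> measurable unit_borel (count_space {1..m})" "AE x in unit_borel. f0 x = f x"
    by (rule borel_coloring_exists[OF f0(1) m]) (rule that)
  have "\<exists>L'\<in>local_laws (orbit_graphing T\<^sub>2) r m. \<forall>C. \<bar>L' C - L C\<bar> \<le> 1 / real (Suc k)" for k
  proof -
    obtain g where g: "g \<in> measurable unit_borel (count_space {1..m})"
      "\<And>A. \<bar>measure unit_borel {z \<in> {0..<1}. orbit_word T\<^sub>2 (2 * r + 1) g z \<in> A} -
          measure unit_borel {z \<in> {0..<1}. orbit_word T\<^sub>1 (2 * r + 1) f z \<in> A}\<bar> \<le> 1 / real (Suc k)"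
      by (rule coloring_transfer[OF A1.borel_automorphism_axioms 2 f(1) m, of "1 / real (Suc k)" "2 * r + 1"])
        (simp, rule that)
    have "f \<in> measurable unit_borel (count_space UNIV)" "g \<in> measurable unit_borel (count_space UNIV)"
      using measurable_compose[OF f(1), of "\<lambda>x. x" "count_space UNIV"] measurable_compose[OF g(1), of "\<lambda>x. x" "count_space UNIV"]
      by auto
    then have eq: "L C = measure unit_borel {z \<in> {0..<1}. orbit_word T\<^sub>1 (2 * r + 1) f z \<in> {w. path_class r w = C}}"
      "nbhd_law (orbit_graphing T\<^sub>2) r g C =
       measure unit_borel {z \<in> {0..<1}. orbit_word T\<^sub>2 (2 * r + 1) g z \<in> {w. path_class r w = C}}" for C
      using A1.nbhd_law_orbit_graphing[OF _ f(2)] A2.nbhd_law_orbit_graphing[of g g] f0(2) by simp_all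
    have "\<forall>C. \<bar>nbhd_law (orbit_graphing T\<^sub>2) r g C - L C\<bar> \<le> 1 / real (Suc k)"
      unfolding eq by (intro allI g(2))
    moreover have "nbhd_law (orbit_graphing T\<^sub>2) r g \<in> local_laws (orbit_graphing T\<^sub>2) r m"
      unfolding local_laws_def using measurable_completion[OF g(1)] by auto
    ultimately show ?thesis by blast
  qed
  then obtain L' where L': "\<And>k. L' k \<in> local_laws (orbit_graphing T\<^sub>2) r m"
    "\<And>k C. \<bar>L' k C - L C\<bar> \<le> 1 / real (Suc k)" by metis
  have "(\<lambda>k. L' k C) \<longlonglongrightarrow> L C" for C
  proof (rule LIM_zero_cancel, rule Lim_null_comparison)
    show "\<forall>\<^sub>F k in sequentially. norm (L' k C - L C) \<le> 1 / real (Suc k)" using L'(2) by simp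
    show "(\<lambda>k. 1 / real (Suc k)) \<longlonglongrightarrow> 0" using LIMSEQ_inverse_real_of_nat by (simp add: inverse_eq_divide)
  qed
  then have "limitin (product_topology (\<lambda>_. euclidean) UNIV) L' L sequentially"
    by (simp add: limitin_componentwise)
  then have "L' \<longlonglongrightarrow> L" unfolding euclidean_product_topology by simp
  then show "L \<in> closure (local_laws (orbit_graphing T\<^sub>2) r m)"
    by (rule Lim_in_closed_set[OF closed_closure _ sequentially_bot, rotated])
      (use L'(1) closure_subset in \<open>auto intro!: always_eventually\<close>)
qed

theorem sweeping_local_global_equivalent:
  assumes "sweeping_automorphism T\<^sub>1 S\<^sub>1" "sweeping_automorphism T\<^sub>2 S\<^sub>2"
  shows "local_global_equivalent (orbit_graphing T\<^sub>1) (orbit_graphing T\<^sub>2)"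
  unfolding local_global_equivalent_def
  using assms local_laws_subset_closure by (intro allI impI equalityI closure_minimal closed_closure) blast+



section \<open>An automorphism group without compact group topology\<close>

text \<open>In a compact Hausdorff group the solution set of an equation is closed, so that an infinite
  system of equations is solvable as soon as its finite parts are.\<close>

lemma compact_group_solves_system:
  assumes "group G" and \<tau>: "group_topology G \<tau>" "compact_space \<tau>" "Hausdorff_space \<tau>"
    and ab: "\<And>i::nat. a i \<in> carrier G" "\<And>i. b i \<in> carrier G"
    and fin: "\<And>n. \<exists>x\<in>carrier G. \<forall>i<n. x \<otimes>\<^bsub>G\<^esub> a i = b i \<otimes>\<^bsub>G\<^esub> x"
  shows "\<exists>x\<in>carrier G. \<forall>i. x \<otimes>\<^bsub>G\<^esub> a i = b i \<otimes>\<^bsub>G\<^esub> x"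
proof -
  have top: "topspace \<tau> = carrier G" and
    mult: "continuous_map (prod_topology \<tau> \<tau>) \<tau> (\<lambda>(x, y). x \<otimes>\<^bsub>G\<^esub> y)"
    using \<tau>(1) unfolding group_topology_def by auto
  define K where "K i = {x \<in> topspace \<tau>. x \<otimes>\<^bsub>G\<^esub> a i = b i \<otimes>\<^bsub>G\<^esub> x}" for i
  have K: "closedin \<tau> (K i)" for i
    unfolding K_def
  proof (rule closedin_continuous_maps_eq[OF \<tau>(3)])
    have pair: "continuous_map \<tau> (prod_topology \<tau> \<tau>) (\<lambda>x. (x, a i))"
      "continuous_map \<tau> (prod_topology \<tau> \<tau>) (\<lambda>x. (b i, x))"
      using ab by (simp_all add: continuous_map_paired top)
    show "continuous_map \<tau> \<tau> (\<lambda>x. x \<otimes>\<^bsub>G\<^esub> a i)" "continuous_map \<tau> \<tau> (\<lambda>x. b i \<otimes>\<^bsub>G\<^esub> x)"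
      using continuous_map_compose[OF pair(1) mult] continuous_map_compose[OF pair(2) mult]
      by (simp_all add: o_def)
  qed
  have fip: "\<Inter>F \<noteq> {}" if F: "finite F" "F \<subseteq> range K" for F
  proof -
    obtain J where J: "finite J" "F = K ` J" using finite_subset_image[OF F] by blast
    obtain n where n: "\<And>j. j \<in> J \<Longrightarrow> j < n" using finite_nat_bounded[OF J(1)] by auto
    obtain x where "x \<in> carrier G" "\<forall>i<n. x \<otimes>\<^bsub>G\<^esub> a i = b i \<otimes>\<^bsub>G\<^esub> x" using fin by blast
    then have "x \<in> \<Inter>F" using J n by (auto simp: K_def top)
    then show ?thesis by blast
  qed
  have "\<Inter>(range K) \<noteq> {}"
    using \<tau>(2)[unfolded compact_space_fip, rule_format, of "range K"] K fip by blast
  then obtain x where "x \<in> \<Inter>(range K)" by blast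
  then show ?thesis by (auto simp: K_def top)
qed

subsection \<open>Permutations of dyadic intervals\<close>

text \<open>The map that permutes the dyadic intervals of length \<open>2\<^sup>-\<^sup>m\<close> by translations,
  according to the permutation \<open>\<pi>\<close> of their indices.\<close>

definition dyadic_exchange :: "nat \<Rightarrow> (int \<Rightarrow> int) \<Rightarrow> real \<Rightarrow> real" where
  "dyadic_exchange m \<pi> t = t + of_int (\<pi> \<lfloor>2 ^ m * t\<rfloor> - \<lfloor>2 ^ m * t\<rfloor>) / 2 ^ m"

lemma in_unit_iff_floor_dyadic:
  fixes t :: real
  shows "t \<in> {0..<1} \<longleftrightarrow> \<lfloor>2 ^ m * t\<rfloor> \<in> {0..<2 ^ m}"
proof -
  have "(0::real) < 2 ^ m" by simp
  then have "0 \<le> \<lfloor>2 ^ m * t\<rfloor> \<longleftrightarrow> 0 \<le> t" using mult_le_cancel_left_pos[of "2 ^ m" 0 t] by simp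
  moreover have "\<lfloor>2 ^ m * t\<rfloor> < 2 ^ m \<longleftrightarrow> t < 1"
    using floor_less_iff[of "2 ^ m * t" "2 ^ m"] by simp
  ultimately show ?thesis by auto
qed

lemma floor_dyadic_exchange: "\<lfloor>2 ^ m * dyadic_exchange m \<pi> t\<rfloor> = \<pi> \<lfloor>2 ^ m * t\<rfloor>"
proof -
  have "2 ^ m * dyadic_exchange m \<pi> t = 2 ^ m * t + of_int (\<pi> \<lfloor>2 ^ m * t\<rfloor> - \<lfloor>2 ^ m * t\<rfloor>)"
    unfolding dyadic_exchange_def by (simp add: distrib_left)
  also have "\<lfloor>\<dots>\<rfloor> = \<lfloor>2 ^ m * t\<rfloor> + (\<pi> \<lfloor>2 ^ m * t\<rfloor> - \<lfloor>2 ^ m * t\<rfloor>)" by (rule floor_add_int[symmetric])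
  finally show ?thesis by simp
qed

lemma dyadic_exchange_comp:
  "dyadic_exchange m \<rho> (dyadic_exchange m \<pi> t) = dyadic_exchange m (\<rho> \<circ> \<pi>) t"
  unfolding dyadic_exchange_def[of m \<rho>] floor_dyadic_exchange
  by (simp add: dyadic_exchange_def add_divide_distrib[symmetric])

lemma dyadic_exchange_cong:
  assumes "t \<in> {0..<1}" "\<And>k. k \<in> {0..<2 ^ m} \<Longrightarrow> \<pi> k = \<rho> k"
  shows "dyadic_exchange m \<pi> t = dyadic_exchange m \<rho> t"
  using assms(2)[of "\<lfloor>2 ^ m * t\<rfloor>"] assms(1) in_unit_iff_floor_dyadic[of t m] by (simp add: dyadic_exchange_def)

lemma borel_automorphism_dyadic_exchange:
  assumes \<pi>: "\<And>k. k \<in> {0..<2 ^ m} \<Longrightarrow> \<pi> k \<in> {0..<2 ^ m}" "\<And>k. k \<in> {0..<2 ^ m} \<Longrightarrow> \<rho> (\<pi> k) = k"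
    and \<rho>: "\<And>k. k \<in> {0..<2 ^ m} \<Longrightarrow> \<rho> k \<in> {0..<2 ^ m}" "\<And>k. k \<in> {0..<2 ^ m} \<Longrightarrow> \<pi> (\<rho> k) = k"
  shows "borel_automorphism (dyadic_exchange m \<pi>) (dyadic_exchange m \<rho>)"
proof -
  have meas: "dyadic_exchange m \<sigma> \<in> measurable unit_borel unit_borel"
    if "\<And>k. k \<in> {0..<2 ^ m} \<Longrightarrow> \<sigma> k \<in> {0..<2 ^ m}" for \<sigma>
  proof (rule measurable_unit_borelI)
    have "(\<lambda>t::real. \<lfloor>2 ^ m * t\<rfloor>) \<in> measurable borel (count_space UNIV)" by measurable
    then have "(\<lambda>t::real. of_int (\<sigma> \<lfloor>2 ^ m * t\<rfloor> - \<lfloor>2 ^ m * t\<rfloor>) / 2 ^ m :: real) \<in> borel_measurable borel"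
      by (rule measurable_compose) simp
    then have "(\<lambda>t. t + of_int (\<sigma> \<lfloor>2 ^ m * t\<rfloor> - \<lfloor>2 ^ m * t\<rfloor>) / 2 ^ m :: real) \<in> borel_measurable borel"
      by (intro borel_measurable_add) auto
    then show "dyadic_exchange m \<sigma> \<in> borel_measurable unit_borel"
      unfolding dyadic_exchange_def[abs_def] by (intro measurable_restrict_space1) simp
    show "dyadic_exchange m \<sigma> t \<in> {0..<1}" if "t \<in> space unit_borel" for t
      using \<open>\<And>k. k \<in> {0..<2 ^ m} \<Longrightarrow> \<sigma> k \<in> {0..<2 ^ m}\<close> that
      unfolding in_unit_iff_floor_dyadic[of _ m] floor_dyadic_exchange
      by (simp only: space_unit_borel in_unit_iff_floor_dyadic[of _ m])
  qed
  have id: "dyadic_exchange m \<sigma> t = t" if "t \<in> {0..<1}" "\<And>k. k \<in> {0..<2 ^ m} \<Longrightarrow> \<sigma> k = k" for \<sigma> t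
    using dyadic_exchange_cong[OF that(1), of m \<sigma> id] that(2) by (simp add: dyadic_exchange_def)
  have inv: "dyadic_exchange m \<rho> (dyadic_exchange m \<pi> t) = t" "dyadic_exchange m \<pi> (dyadic_exchange m \<rho> t) = t"
    if "t \<in> {0..<1}" for t
    unfolding dyadic_exchange_comp using that \<pi>(2) \<rho>(2) by (auto intro!: id)
  show ?thesis
  proof
    show "distr unit_borel unit_borel (dyadic_exchange m \<pi>) = unit_borel"
    proof (rule distr_piecewise_translation[where \<psi> = "dyadic_exchange m \<rho>" and D = "range (\<lambda>n::int. of_int n / 2 ^ m)"])
      show "dyadic_exchange m \<pi> t - t \<in> range (\<lambda>n::int. of_int n / 2 ^ m)" for t
        by (auto simp: dyadic_exchange_def simp del: of_int_diff)
    qed (use meas \<pi> \<rho> inv in auto)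
  qed (use meas \<pi> \<rho> inv in auto)
qed

text \<open>Bits are counted from the low end of the index \<open>k\<close> of a dyadic interval, so that digit \<open>i\<close> of a point
  is bit \<open>m - i\<close> of the index of its interval of length \<open>2\<^sup>-\<^sup>m\<close>.\<close>

definition flip_bit :: "nat \<Rightarrow> int \<Rightarrow> int" where
  "flip_bit b k = (if even (k div 2 ^ b) then k + 2 ^ b else k - 2 ^ b)"

definition digit_flip :: "nat \<Rightarrow> real \<Rightarrow> real" where
  "digit_flip i = dyadic_exchange i (flip_bit 0)"

text \<open>The last of the first \<open>m\<close> digits is moved to the front.\<close>

definition rotate_bits :: "nat \<Rightarrow> int \<Rightarrow> int" where
  "rotate_bits m k = k div 2 + (k mod 2) * 2 ^ (m - 1)"

lemma digit_flip_refine: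
  assumes "i \<le> m"
  shows "digit_flip i t = dyadic_exchange m (flip_bit (m - i)) t"
proof -
  have pow: "(2::real) ^ m = 2 ^ (m - i) * 2 ^ i" using assms by (simp flip: power_add)
  have "2 ^ i * t = (2 ^ m * t) / real_of_int (2 ^ (m - i))" by (simp add: pow)
  then have "\<lfloor>2 ^ i * t\<rfloor> = \<lfloor>2 ^ m * t\<rfloor> div 2 ^ (m - i)" using floor_divide_real_eq_div[of "2 ^ (m - i)" "2 ^ m * t"] by simp
  moreover have "2 ^ (m - i) / 2 ^ m = 1 / (2::real) ^ i" by (simp add: pow)
  ultimately show ?thesis
    by (simp add: digit_flip_def dyadic_exchange_def flip_bit_def)
qed

lemma flip_bit_0: "flip_bit 0 k = (if even k then k + 1 else k - 1)"
  by (simp add: flip_bit_def)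

lemma borel_automorphism_digit_flip:
  assumes "i \<ge> 1"
  shows "borel_automorphism (digit_flip i) (digit_flip i)"
proof -
  obtain h where h: "(2::int) ^ i = 2 * h" using assms by (cases i) auto
  have in_range: "flip_bit 0 k \<in> {0..<2 ^ i}" if "k \<in> {0..<2 ^ i}" for k
    using that unfolding flip_bit_0 h atLeastLessThan_iff by presburger
  have "flip_bit 0 (flip_bit 0 k) = k" for k by (simp add: flip_bit_0)
  then show ?thesis unfolding digit_flip_def using in_range
    by (intro borel_automorphism_dyadic_exchange) auto
qed

lemma rotate_flip_bit:
  assumes b: "1 \<le> b" "b < m"
  shows "rotate_bits m (flip_bit b k) = flip_bit (b - 1) (rotate_bits m k)"
proof -
  obtain c where c: "b = Suc c" using b(1) by (cases b) auto
  obtain e where e: "m - 1 = c + Suc e" using that[of "m - 2 - c"] b c by simp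
  define q r where "q = k div 2" and "r = k mod 2"
  have k: "k = 2 * q + r" "r = 0 \<or> r = 1" by (auto simp: q_def r_def)
  have "k div 2 ^ b = q div 2 ^ c" by (simp add: c q_def zdiv_zmult2_eq)
  then have "flip_bit b k = 2 * flip_bit c q + r" using k(1) by (simp add: flip_bit_def c)
  moreover have "(2 * flip_bit c q + r) div 2 = flip_bit c q" "(2 * flip_bit c q + r) mod 2 = r" using k(2) by auto
  ultimately have "rotate_bits m (flip_bit b k) = flip_bit c q + r * 2 ^ (m - 1)"
    by (simp add: rotate_bits_def)
  moreover have "flip_bit c (q + r * 2 ^ (m - 1)) = flip_bit c q + r * 2 ^ (m - 1)"
  proof -
    have "(2::int) ^ (m - 1) = 2 * 2 ^ e * 2 ^ c" unfolding e by (simp add: power_add)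
    then have shift: "q + r * 2 ^ (m - 1) = q + (r * 2 * 2 ^ e) * 2 ^ c" by simp
    have "(q + r * 2 ^ (m - 1)) div 2 ^ c = q div 2 ^ c + r * 2 * 2 ^ e" unfolding shift by simp
    then show ?thesis by (simp add: flip_bit_def)
  qed
  ultimately show ?thesis by (simp add: c rotate_bits_def q_def r_def)
qed

lemma borel_automorphism_rotate:
  assumes m: "m \<ge> 1"
  shows "\<exists>S. borel_automorphism (dyadic_exchange m (rotate_bits m)) S"
proof -
  define h where "h = (2::int) ^ (m - 1)"
  have h: "h > 0" "2 ^ m = 2 * h" using m by (auto simp: h_def power_Suc[symmetric] simp del: power_Suc)
  have rotate: "rotate_bits m k = k div 2 + k mod 2 * h" for k by (simp add: rotate_bits_def h_def)
  define \<rho> where "\<rho> k = 2 * (k mod h) + k div h" for k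
  have "borel_automorphism (dyadic_exchange m (rotate_bits m)) (dyadic_exchange m \<rho>)"
  proof (rule borel_automorphism_dyadic_exchange)
    fix k :: int assume k: "k \<in> {0..<2 ^ m}"
    have q: "0 \<le> k div 2" "k div 2 < h" using k h by auto
    have r: "k mod 2 = 0 \<or> k mod 2 = 1" by auto
    show "rotate_bits m k \<in> {0..<2 ^ m}"
      using q r h by (auto simp: rotate)
    have "(k div 2 + k mod 2 * h) mod h = k div 2" "(k div 2 + k mod 2 * h) div h = k mod 2"
      using q h by auto
    then show "\<rho> (rotate_bits m k) = k" by (simp add: \<rho>_def rotate)
    have d: "k div h = 0 \<or> k div h = 1"
    proof (cases "k < h")
      case True then show ?thesis using k by simp
    next
      case False
      then have "(k - h) div h = 0" using k h by (intro div_pos_pos_trivial) auto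
      then show ?thesis using div_pos_geq[of h k] False h by simp
    qed
    have mm: "0 \<le> k mod h" "k mod h < h" using h by auto
    show "\<rho> k \<in> {0..<2 ^ m}"
      using d unfolding \<rho>_def h(2) atLeastLessThan_iff by (elim disjE) (use mm in linarith)+
    have "(2 * (k mod h) + k div h) div 2 = k mod h" "(2 * (k mod h) + k div h) mod 2 = k div h" using d by auto
    then show "rotate_bits m (\<rho> k) = k"
      by (simp add: \<rho>_def rotate)
  qed
  then show ?thesis by blast
qed

text \<open>The rotation moves digit \<open>i\<close> to place \<open>i + 1\<close>.\<close>

lemma digit_flip_rotate:
  assumes i: "1 \<le> i" "i < m"
  shows "dyadic_exchange m (rotate_bits m) (digit_flip i t) = digit_flip (Suc i) (dyadic_exchange m (rotate_bits m) t)"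
proof -
  have "rotate_bits m \<circ> flip_bit (m - i) = flip_bit (m - Suc i) \<circ> rotate_bits m"
    using rotate_flip_bit[of "m - i" m] i by (auto simp: fun_eq_iff)
  then show ?thesis using i by (simp add: digit_flip_refine[of _ m] dyadic_exchange_comp)
qed

subsection \<open>A zero-one law\<close>

text \<open>A set that is invariant under all digit flips meets the two halves of every dyadic interval in
  equal measure. So it occupies the same proportion of every dyadic interval, and then of
  every set; in particular, of itself.\<close>

lemma digit_flip_zero_one:
  assumes B: "B \<in> sets unit_borel"
    and inv: "\<And>i. i \<ge> 1 \<Longrightarrow> AE t in unit_borel. digit_flip i t \<in> B \<longleftrightarrow> t \<in> B"
  shows "measure unit_borel B = 0 \<or> measure unit_borel B = 1"
proof -
  interpret prob_space unit_borel by (rule prob_space_unit_borel)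
  have BV: "B \<subseteq> {0..<1}" "B \<in> sets borel" using B by (auto simp: sets_unit_borel_iff)
  define D where "D n k = {t \<in> B. \<lfloor>2 ^ n * t\<rfloor> = k}" for n :: nat and k :: int
  have sets: "{t \<in> B. P \<lfloor>2 ^ n * t\<rfloor>} \<in> sets unit_borel" for P and n :: nat
  proof -
    have "{t \<in> space borel. P \<lfloor>2 ^ n * t :: real\<rfloor>} \<in> sets borel" by measurable
    then have "B \<inter> {t. P \<lfloor>2 ^ n * t :: real\<rfloor>} \<in> sets borel" using BV by auto
    moreover have "B \<inter> {t. P \<lfloor>2 ^ n * t\<rfloor>} = {t \<in> B. P \<lfloor>2 ^ n * t\<rfloor>}" by auto
    ultimately show ?thesis using BV by (auto simp: sets_unit_borel_iff)
  qed
  have D: "D n k \<in> sets unit_borel" for n k unfolding D_def by (rule sets)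
  have D_prob: "prob (D n k) = prob B / 2 ^ n" if "k \<in> {0..<2 ^ n}" for n k
    using that
  proof (induction n arbitrary: k)
    case 0
    have "\<lfloor>t\<rfloor> = 0" if "t \<in> B" for t using BV that by (intro floor_unique) auto
    then have "D 0 k = B" using 0 by (auto simp: D_def)
    then show ?case by simp
  next
    case (Suc n)
    interpret F: borel_automorphism "digit_flip (Suc n)" "digit_flip (Suc n)"
      by (rule borel_automorphism_digit_flip) simp
    define j where "j = k div 2"
    have j: "j \<in> {0..<2 ^ n}" using Suc.prems by (auto simp: j_def)
    have "prob (D (Suc n) (2 * j)) = prob (D (Suc n) (2 * j + 1))"
    proof -
      have "prob (D (Suc n) (2 * j)) = prob {t \<in> {0..<1}. digit_flip (Suc n) t \<in> D (Suc n) (2 * j)}"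
        using F.measure_funpow_vimage(1)[OF D, of 1] by simp
      also have "\<dots> = prob (D (Suc n) (2 * j + 1))"
      proof (rule measure_eq_AE)
        have flipped: "AE t in unit_borel. digit_flip (Suc n) t \<in> B \<longleftrightarrow> t \<in> B" by (rule inv) simp
        have index: "flip_bit 0 k = 2 * j \<longleftrightarrow> k = 2 * j + 1" for k by (auto simp: flip_bit_0; presburger)
        show "AE t in unit_borel. t \<in> {t \<in> {0..<1}. digit_flip (Suc n) t \<in> D (Suc n) (2 * j)} \<longleftrightarrow> t \<in> D (Suc n) (2 * j + 1)"
          using flipped AE_space
          by eventually_elim
            (use BV index in \<open>auto simp: D_def digit_flip_def floor_dyadic_exchange simp del: power_Suc\<close>)
        show "{t \<in> {0..<1}. digit_flip (Suc n) t \<in> D (Suc n) (2 * j)} \<in> sets unit_borel"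
          by (rule sets_unit_borel_preimage[OF F.T_measurable D])
      qed (rule D)
      finally show ?thesis .
    qed
    moreover have "prob (D n j) = prob (D (Suc n) (2 * j)) + prob (D (Suc n) (2 * j + 1))"
    proof -
      \<comment> \<open>the two halves of a dyadic interval\<close>
      have "\<lfloor>2 ^ n * t\<rfloor> = \<lfloor>2 ^ Suc n * t\<rfloor> div 2" for t :: real
        using floor_divide_real_eq_div[of 2 "2 ^ Suc n * t"] by simp
      then have "D n j = D (Suc n) (2 * j) \<union> D (Suc n) (2 * j + 1)" unfolding D_def by auto
      then show ?thesis by (simp only:) (rule finite_measure_Union[OF D D], auto simp: D_def)
    qed
    moreover have "k = 2 * j \<or> k = 2 * j + 1" by (auto simp: j_def)
    ultimately have "2 * prob (D (Suc n) k) = prob (D n j)" by auto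
    then show ?case using Suc.IH[OF j] by simp
  qed
  have G_prob: "prob {t \<in> B. \<lfloor>2 ^ n * t\<rfloor> < int k} = real k * prob B / 2 ^ n" if "k \<le> 2 ^ n" for n k
    using that
  proof (induction k)
    case 0
    have "\<not> \<lfloor>2 ^ n * t\<rfloor> < 0" if "t \<in> B" for t
    proof -
      have "t \<in> {0..<1}" using BV(1) that by blast
      then show ?thesis unfolding in_unit_iff_floor_dyadic[of t n] by simp
    qed
    then have empty: "{t \<in> B. \<lfloor>2 ^ n * t\<rfloor> < int 0} = {}" by auto
    show ?case unfolding empty by simp
  next
    case (Suc k)
    have "{t \<in> B. \<lfloor>2 ^ n * t\<rfloor> < int (Suc k)} = {t \<in> B. \<lfloor>2 ^ n * t\<rfloor> < int k} \<union> D n (int k)"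
      by (auto simp: D_def)
    then have "prob {t \<in> B. \<lfloor>2 ^ n * t\<rfloor> < int (Suc k)} = prob {t \<in> B. \<lfloor>2 ^ n * t\<rfloor> < int k} + prob (D n (int k))"
      using D sets[of "\<lambda>l. l < int k" n] by (simp only:) (rule finite_measure_Union, auto simp: D_def)
    moreover have "int k \<in> {0..<2 ^ n}"
      using Suc.prems by (metis Suc_le_lessD atLeastLessThan_iff of_nat_0_le_iff of_nat_less_iff of_nat_numeral of_nat_power)
    ultimately show ?case using Suc D_prob[of "int k" n] by (simp add: field_simps)
  qed
  have cdf_B: "prob (B \<inter> {..t}) = t * prob B" if t: "0 \<le> t" "t < 1" for t
  proof -
    have bound: "\<bar>prob (B \<inter> {..t}) - t * prob B\<bar> \<le> 1 / 2 ^ n" for n :: nat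
    proof -
      define k where "k = nat \<lfloor>2 ^ n * t\<rfloor>"
      have fl: "\<lfloor>2 ^ n * t\<rfloor> \<in> {0..<2 ^ n}" using t in_unit_iff_floor_dyadic[of t n] by auto
      then have k: "int k = \<lfloor>2 ^ n * t\<rfloor>" by (simp add: k_def)
      then have "int k < int (2 ^ n)" using fl by simp
      then have kn: "k < 2 ^ n" by (simp only: of_nat_less_iff)
      have kt: "real k \<le> 2 ^ n * t" "2 ^ n * t < real k + 1"
        using k[symmetric] floor_correct[of "2 ^ n * t"] by auto
      have m: "B \<inter> {..t} \<in> sets unit_borel" using BV by (auto simp: sets_unit_borel_iff)
      have "{s \<in> B. \<lfloor>2 ^ n * s\<rfloor> < int k} \<subseteq> B \<inter> {..t}"
      proof
        fix s assume s: "s \<in> {s \<in> B. \<lfloor>2 ^ n * s\<rfloor> < int k}"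
        then have "2 ^ n * s < real k" by (simp add: floor_less_iff)
        then have "2 ^ n * s < 2 ^ n * t" using kt(1) by linarith
        then show "s \<in> B \<inter> {..t}" using s by simp
      qed
      from finite_measure_mono[OF this m] have "real k * prob B / 2 ^ n \<le> prob (B \<inter> {..t})"
        unfolding G_prob[OF less_imp_le[OF kn]] .
      moreover
      have "B \<inter> {..t} \<subseteq> {s \<in> B. \<lfloor>2 ^ n * s\<rfloor> < int (Suc k)}"
      proof
        fix s assume s: "s \<in> B \<inter> {..t}"
        then have "2 ^ n * s \<le> 2 ^ n * t" by simp
        then have "2 ^ n * s < real k + 1" using kt(2) by linarith
        then have "2 ^ n * s < real_of_int (int (Suc k))" by simp
        then show "s \<in> {s \<in> B. \<lfloor>2 ^ n * s\<rfloor> < int (Suc k)}" using s by (simp only: floor_less_iff) auto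
      qed
      from finite_measure_mono[OF this sets] have "prob (B \<inter> {..t}) \<le> real (Suc k) * prob B / 2 ^ n"
        unfolding G_prob[OF Suc_leI[OF kn]] .
      moreover have "real k / 2 ^ n * prob B \<le> t * prob B" "t * prob B \<le> (real k + 1) / 2 ^ n * prob B"
        using kt by (intro mult_right_mono; simp add: field_simps)+
      moreover have "(real k + 1) / 2 ^ n * prob B - real k / 2 ^ n * prob B \<le> 1 / 2 ^ n"
        by (simp add: field_simps)
      ultimately show ?thesis by (simp add: abs_le_iff algebra_simps)
    qed
    have "(\<lambda>n. 1 / 2 ^ n :: real) \<longlonglongrightarrow> 0"
      using LIMSEQ_realpow_zero[of "1 / 2 :: real"] by (simp add: power_one_over)
    then have "\<bar>prob (B \<inter> {..t}) - t * prob B\<bar> \<le> 0"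
      using bound by (intro LIMSEQ_le_const) auto
    then show ?thesis by simp
  qed
  show ?thesis
  proof (rule ccontr)
    assume neither: "\<not> (prob B = 0 \<or> prob B = 1)"
    then have pos: "prob B > 0" using measure_nonneg[of unit_borel B] by linarith
    define M where "M = distr (uniform_measure unit_borel B) borel (\<lambda>x. x)"
    define U where "U = distr unit_borel borel (\<lambda>x. x :: real)"
    note M = uniform_distribution_on[OF B pos, folded M_def]
    note U = uniform_distribution_unit_interval[folded U_def]
    have "M = U"
    proof (rule cdf_unique[OF M(1) U(1)], rule ext)
      fix t :: real
      have eq: "cdf M t = prob (B \<inter> {..t}) / prob B" unfolding cdf_def by (rule M(2)) simp
      consider "t < 0" | "0 \<le> t" "t < 1" | "1 \<le> t" by linarith
      then show "cdf M t = cdf U t"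
      proof cases
        case 1
        then have "B \<inter> {..t} = {}" using BV by auto
        then show ?thesis using 1 by (simp add: eq U(2))
      next
        case 2
        then show ?thesis using cdf_B pos by (simp add: eq U(2))
      next
        case 3
        then have "B \<inter> {..t} = B" using BV by auto
        then show ?thesis using 3 pos by (simp add: eq U(2))
      qed
    qed
    then have "prob B = 1" using M(2)[OF BV(2)] U(3)[OF B] pos by simp
    with neither show False by simp
  qed
qed

subsection \<open>The graphing without edges\<close>

lemma Aut_graphing_no_edges: "Aut_graphing (orbit_graphing id) = Aut_space unit_lebesgue"
proof -
  let ?N = unit_lebesgue
  have edges: "edges (orbit_graphing id) = {}" by (auto simp: orbit_graphing_def)
  have \<eta>: "edge_measure (orbit_graphing id) = null_measure (?N \<Otimes>\<^sub>M ?N)"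
    by (rule edge_measure_eqI) (simp_all add: prob_space_unit_lebesgue edges_to_def edges)
  have "distr (null_measure (?N \<Otimes>\<^sub>M ?N)) (?N \<Otimes>\<^sub>M ?N) (map_prod \<phi> \<phi>) = null_measure (?N \<Otimes>\<^sub>M ?N)"
    if "\<phi> \<in> invertible_mpt ?N" for \<phi>
  proof -
    have "map_prod \<phi> \<phi> \<in> measurable (?N \<Otimes>\<^sub>M ?N) (?N \<Otimes>\<^sub>M ?N)"
      unfolding map_prod_def split_beta' using invertible_mptD(1)[OF that] by measurable
    then have "map_prod \<phi> \<phi> \<in> measurable (null_measure (?N \<Otimes>\<^sub>M ?N)) (?N \<Otimes>\<^sub>M ?N)"
      by (simp add: measurable_def)
    then show ?thesis by (intro measure_eqI) (simp_all add: emeasure_distr)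
  qed
  then have "{c \<in> carrier (Aut_space ?N). \<forall>\<phi>\<in>c.
      distr (edge_measure (orbit_graphing id)) (?N \<Otimes>\<^sub>M ?N) (map_prod \<phi> \<phi>) = edge_measure (orbit_graphing id)} =
      carrier (Aut_space ?N)"
    unfolding \<eta> carrier_Aut_space by (auto simp: ae_class_def)
  then show ?thesis unfolding Aut_graphing_def vspace_orbit_graphing by simp
qed

text \<open>The equations \<open>x \<sigma>\<^sub>i = \<sigma>\<^sub>i\<^sub>+\<^sub>1 x\<close> for the digit flips \<open>\<sigma>\<^sub>1, \<sigma>\<^sub>2, \<dots>\<close> are solvable for \<open>i \<le> n\<close>, by a
  rotation of the first \<open>n + 1\<close> digits. A common solution of all of them would pull the
  set of points with first digit \<open>0\<close>, which is invariant under \<open>\<sigma>\<^sub>2, \<sigma>\<^sub>3, \<dots>\<close>, back to a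
  set of measure \<open>1/2\<close> that is invariant under all digit flips.\<close>

lemma Aut_space_unit_lebesgue_no_compact_topology:
  "\<not> (\<exists>\<tau>. group_topology (Aut_space unit_lebesgue) \<tau> \<and> compact_space \<tau> \<and> Hausdorff_space \<tau>)"
proof
  assume "\<exists>\<tau>. group_topology (Aut_space unit_lebesgue) \<tau> \<and> compact_space \<tau> \<and> Hausdorff_space \<tau>"
  then obtain \<tau> where \<tau>: "group_topology (Aut_space unit_lebesgue) \<tau>" "compact_space \<tau>" "Hausdorff_space \<tau>" by blast
  let ?N = unit_lebesgue
  interpret prob_space ?N by (rule prob_space_unit_lebesgue)
  have flip: "digit_flip (Suc i) \<in> invertible_mpt ?N" for i
    by (rule borel_automorphism.T_invertible[OF borel_automorphism_digit_flip]) simp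
  have "\<exists>x\<in>carrier (Aut_space ?N). \<forall>i. x \<otimes>\<^bsub>Aut_space ?N\<^esub> ae_class ?N (digit_flip (Suc i)) =
      ae_class ?N (digit_flip (Suc (Suc i))) \<otimes>\<^bsub>Aut_space ?N\<^esub> x"
  proof (rule compact_group_solves_system[OF group_Aut_space \<tau>])
    fix n
    define x where "x = dyadic_exchange (Suc n) (rotate_bits (Suc n))"
    obtain S where "borel_automorphism x S"
      using borel_automorphism_rotate[of "Suc n"] unfolding x_def by auto
    then have x: "x \<in> invertible_mpt ?N" by (rule borel_automorphism.T_invertible)
    show "\<exists>x\<in>carrier (Aut_space ?N). \<forall>i<n. x \<otimes>\<^bsub>Aut_space ?N\<^esub> ae_class ?N (digit_flip (Suc i)) =
        ae_class ?N (digit_flip (Suc (Suc i))) \<otimes>\<^bsub>Aut_space ?N\<^esub> x"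
    proof (intro bexI[of _ "ae_class ?N x"] allI impI)
      fix i assume "i < n"
      then have "x \<circ> digit_flip (Suc i) = digit_flip (Suc (Suc i)) \<circ> x"
        unfolding x_def by (auto simp: fun_eq_iff digit_flip_rotate)
      then show "ae_class ?N x \<otimes>\<^bsub>Aut_space ?N\<^esub> ae_class ?N (digit_flip (Suc i)) =
          ae_class ?N (digit_flip (Suc (Suc i))) \<otimes>\<^bsub>Aut_space ?N\<^esub> ae_class ?N x"
        using x flip by (simp add: mult_ae_class)
    qed (rule ae_class_in_carrier[OF x])
  qed (rule ae_class_in_carrier[OF flip])+
  then obtain x where x: "x \<in> invertible_mpt ?N" and
    eq: "\<And>i. ae_class ?N x \<otimes>\<^bsub>Aut_space ?N\<^esub> ae_class ?N (digit_flip (Suc i)) =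
      ae_class ?N (digit_flip (Suc (Suc i))) \<otimes>\<^bsub>Aut_space ?N\<^esub> ae_class ?N x"
    unfolding carrier_Aut_space by blast
  have comm: "AE t in ?N. x (digit_flip (Suc i) t) = digit_flip (Suc (Suc i)) (x t)" for i
    using eq[of i] x flip by (simp add: mult_ae_class ae_class_eq_iff invertible_mpt_comp)
  define A where "A = {0..<1 / 2 :: real}"
  have A: "A \<in> sets unit_borel" by (auto simp: A_def sets_unit_borel_iff)
  define A' where "A' = x -` A \<inter> space ?N"
  have A': "A' \<in> sets ?N" unfolding A'_def using A by (intro measurable_sets[OF invertible_mptD(1)[OF x]]) auto
  have "prob A' = prob A"
    unfolding A'_def by (rule measure_vimage[OF invertible_mptD[OF x]]) (use A in auto)
  also have "prob A = measure unit_borel A" using A by simp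
  also have "\<dots> = 1 / 2" using measure_unit_borel[OF A] by (simp add: A_def)
  finally have A'_half: "prob A' = 1 / 2" .
  have A_inv: "digit_flip (Suc (Suc i)) t \<in> A \<longleftrightarrow> t \<in> A" if t: "t \<in> {0..<1}" for i t
  proof -
    have "\<not> (2::real) ^ i \<le> 0" by (simp add: not_le)
    then have half: "s \<in> A \<longleftrightarrow> \<lfloor>2 ^ Suc (Suc i) * s\<rfloor> \<in> {0..<2 * 2 ^ i}" for s
      unfolding A_def atLeastLessThan_iff floor_less_iff le_floor_iff by (simp add: zero_le_mult_iff mult.commute)
    have "flip_bit 0 k \<in> {0..<2 * 2 ^ i} \<longleftrightarrow> k \<in> {0..<2 * 2 ^ i}" for k :: int
      unfolding flip_bit_0 by (auto; presburger)
    then show ?thesis unfolding half digit_flip_def floor_dyadic_exchange by blast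
  qed
  have inv': "AE t in ?N. digit_flip (Suc i) t \<in> A' \<longleftrightarrow> t \<in> A'" for i
  proof -
    have "AE t in ?N. x t \<in> {0..<1}" using AE_invertible[OF x AE_space] by simp
    moreover have "AE t in ?N. digit_flip (Suc i) t \<in> {0..<1}" using AE_invertible[OF flip AE_space] by simp
    ultimately show ?thesis using comm[of i] AE_space
      by eventually_elim (simp add: A'_def A_inv)
  qed
  \<comment> \<open>a Borel set that differs from \<open>A'\<close> by a null set\<close>
  define B where "B = main_part unit_borel A'"
  have B: "B \<in> sets unit_borel" unfolding B_def using A' by simp
  have BA: "AE t in ?N. t \<in> B \<longleftrightarrow> t \<in> A'"
    unfolding B_def AE_completion_iff using AE_in_main_part[OF A'] by (auto elim: AE_mp)
  have "AE t in unit_borel. digit_flip i t \<in> B \<longleftrightarrow> t \<in> B" if i: "i \<ge> 1" for i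
  proof -
    obtain j where j: "i = Suc j" using i by (cases i) auto
    have "AE t in ?N. digit_flip i t \<in> B \<longleftrightarrow> digit_flip i t \<in> A'"
      unfolding j by (rule AE_invertible[OF flip BA])
    then have "AE t in ?N. digit_flip i t \<in> B \<longleftrightarrow> t \<in> B"
      using inv'[of j] BA unfolding j by eventually_elim blast
    then show ?thesis unfolding AE_completion_iff .
  qed
  then have "measure unit_borel B = 0 \<or> measure unit_borel B = 1" by (rule digit_flip_zero_one[OF B])
  moreover have "measure unit_borel B = prob A'"
  proof -
    have "prob B = prob A'" using BA A' B by (intro measure_eq_AE) auto
    then show ?thesis using B by simp
  qed
  ultimately show False using A'_half by simp
qed

lemma borel_automorphism_id: "borel_automorphism id id"
  by unfold_locales (auto simp: id_def distr_id2)


theorem corollary1p9: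
  shows "(\<forall>(X :: 'a measure) T.
            standard_probability_space X \<and> \<not> finitely_many_atoms X \<and>
            T \<in> invertible_mpt X \<and> ergodic X T \<longrightarrow>
            (\<exists>\<Gamma> :: real graphing_data.
               graphing \<Gamma> \<and>
               reversing_symmetry_group X T \<cong> Aut_graphing \<Gamma> \<and>
               (\<forall>a. a \<notin> \<rat> \<longrightarrow> local_global_equivalent \<Gamma> (cyclic_graphing a)))) \<and>
         (\<exists>\<Gamma> :: real graphing_data.
            graphing \<Gamma> \<and>
            \<not> (\<exists>\<tau>. group_topology (Aut_graphing \<Gamma>) \<tau> \<and> compact_space \<tau> \<and> Hausdorff_space \<tau>))"
proof (intro conjI allI impI)
  fix X :: "'a measure" and T
  assume "standard_probability_space X \<and> \<not> finitely_many_atoms X \<and> T \<in> invertible_mpt X \<and> ergodic X T"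
  then have X: "standard_probability_space X" "\<not> finitely_many_atoms X"
    and T: "T \<in> invertible_mpt X" and erg: "ergodic X T" by auto
  obtain f where f: "iso_mod_null X unit_lebesgue f"
    by (rule ergodic_iso_unit_interval[OF X T erg]) (rule that)
  obtain g where fg: "f \<in> measurable X unit_lebesgue" "distr X unit_lebesgue f = unit_lebesgue"
    "AE x in X. g (f x) = x" "AE y in unit_lebesgue. f (g y) = y" "iso_mod_null unit_lebesgue X g"
    using f by (rule iso_mod_nullE)
  note conj = reversing_symmetry_group_conjugate[OF f fg(5) fg(3,4) T]
  obtain U S where US: "borel_automorphism U S" and U: "AE x in unit_lebesgue. U x = (f \<circ> T \<circ> g) x"
    by (rule borel_automorphism_exists[OF conj(1)]) (rule that)
  interpret borel_automorphism U S by (rule US)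
  have "ae_ergodic unit_lebesgue (f \<circ> T \<circ> g)"
    using invertible_mptD[OF T] by (intro ae_ergodic_conjugate[OF fg(1,2) _ _ fg(3)] ergodic_imp_ae_ergodic erg)
  then have erg_U: "ae_ergodic unit_lebesgue U"
    by (rule ae_ergodic_AE_cong) (use U in \<open>auto elim: AE_mp\<close>)
  interpret sweeping_automorphism U S by (rule ergodic_imp_sweeping[OF erg_U])
  have "ae_class unit_lebesgue U = ae_class unit_lebesgue (f \<circ> T \<circ> g)"
    using U by (subst ae_class_eq_iff[OF T_invertible conj(1)])
  then have "reversing_symmetry_group unit_lebesgue U = reversing_symmetry_group unit_lebesgue (f \<circ> T \<circ> g)"
    unfolding reversing_symmetry_group_def by simp
  then have "reversing_symmetry_group X T \<cong> Aut_graphing (orbit_graphing U)"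
    using conj(2) Aut_graphing_orbit_graphing[OF AE_neighbours_distinct erg_U] by simp
  moreover have "local_global_equivalent (orbit_graphing U) (cyclic_graphing a)" if "a \<notin> \<rat>" for a
    unfolding cyclic_graphing_eq_orbit_graphing[OF that]
    by (rule sweeping_local_global_equivalent[OF sweeping_automorphism_axioms sweeping_rotation[OF that]])
  ultimately show "\<exists>\<Gamma> :: real graphing_data. graphing \<Gamma> \<and> reversing_symmetry_group X T \<cong> Aut_graphing \<Gamma> \<and>
      (\<forall>a. a \<notin> \<rat> \<longrightarrow> local_global_equivalent \<Gamma> (cyclic_graphing a))"
    using graphing_orbit_graphing by blast
next
  show "\<exists>\<Gamma> :: real graphing_data. graphing \<Gamma> \<and>
      \<not> (\<exists>\<tau>. group_topology (Aut_graphing \<Gamma>) \<tau> \<and> compact_space \<tau> \<and> Hausdorff_space \<tau>)"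
    using borel_automorphism.graphing_orbit_graphing[OF borel_automorphism_id]
      Aut_space_unit_lebesgue_no_compact_topology unfolding Aut_graphing_no_edges[symmetric] by blast
qed

end
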